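(* Suppose the spin system has SSM. Then there is a constant $c>0$ (depending on the spin system and the SSM constants, but not on $V$, $\psi$ or the blocks) such that for every $d$-dimensional cube $V\subset\mathbb{Z}^d$, every boundary condition $\psi$ on $\partial V$, and every collection $\mathcal{A}=\{A_1,\dots,A_r\}$ of subsets of $V$ with $\bigcup_iA_i=V$, the heat-bath block dynamics $\mathcal{B}_\mathcal{A}$ satisfies $\lambda(\mathcal{B}_\mathcal{A})\ge c/r$; i.e., its relaxation time is $O(r)$.
   Context: Fix $d\ge1$; $\mathbb{Z}^d$ has edges between $u,v$ with $\|u-v\|_1=1$; for finite $V$, $G=(V,E)$ is the induced subgraph and $\partial V$ the set of outside vertices adjacent to $V$. A spin system: spins $S=\{1,\dots,q\}$, symmetric edge potential $U:S\times S\to\mathbb{R}\cup\{-\infty\}$, vertex potential $W:S\to\mathbb{R}$; boundary condition $\psi:A^\psi\to S$, $A^\psi\subseteq\partial V$; Gibbs distribution $\mu^\psi(\sigma)\propto\exp\big(\sum_{(u,v)\in E}U(\sigma(u),\sigma(v))+\sum_{u\in A^\psi,v\in V,u\sim v}U(\psi(u),\sigma(v))+\sum_{u\in V}W(\sigma(u))\big)$. The system is permissive and the single-site heat-bath Glauber dynamics is assumed irreducible on the set $\Omega$ of valid configurations. SSM: there exist $a,b>0$ such that for every $d$-dimensional cube $\Lambda$, all $B\subseteq\Lambda$, all $u\in\partial\Lambda$ and all boundary conditions $\psi,\psi_u$ on $\partial\Lambda$ differing only at $u$, $\|\mu^\psi_B-\mu^{\psi_u}_B\|_{TV}\le b\,e^{-a\,\mathrm{dist}(u,B)}$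 ($\mu_B$ the marginal on $B$, $\mathrm{dist}$ the minimal $\ell_1$ distance). Heat-bath block dynamics $\mathcal{B}_\mathcal{A}$: from $\sigma_t$, pick $i$ uniformly from $\{1,\dots,r\}$ and replace $\sigma_t(A_i)$ by a sample from $\mu^\psi(\cdot\mid\sigma_t(V\setminus A_i))$. For $P$ reversible w.r.t. $\mu$ with eigenvalues $1=\lambda_1\ge\dots\ge\lambda_N$, $\lambda(P)=1-\max\{|\lambda_2|,|\lambda_N|\}$. *)

theory Defs
  imports "Jordan_Normal_Form.Char_Poly" "HOL-Library.FuncSet" "HOL-Library.Extended_Real"
begin

text \<open>Vertices of Z^d are functions from a finite index type 'd (the d coordinates) to int.\<close>

definition l1dist :: "('d::finite \<Rightarrow> int) \<Rightarrow> ('d \<Rightarrow> int) \<Rightarrow> int" where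
  "l1dist u v = (\<Sum>i\<in>UNIV. \<bar>u i - v i\<bar>)"

definition adj :: "('d::finite \<Rightarrow> int) \<Rightarrow> ('d \<Rightarrow> int) \<Rightarrow> bool" where
  "adj u v \<longleftrightarrow> l1dist u v = 1"

text \<open>d-dimensional cube: a product of d integer intervals of the same length n \<ge> 1.\<close>
definition is_cube :: "('d::finite \<Rightarrow> int) set \<Rightarrow> bool" where
  "is_cube V \<longleftrightarrow> (\<exists>a n. n \<ge> (1::int) \<and> V = {x. \<forall>i. a i \<le> x i \<and> x i \<le> a i + n - 1})"

definition bdry :: "('d::finite \<Rightarrow> int) set \<Rightarrow> ('d \<Rightarrow> int) set" where
  "bdry V = {u. u \<notin> V \<and> (\<exists>v\<in>V. adj u v)}"

text \<open>minimal l1 distance from a vertex to a (finite, nonempty) set\<close>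
definition set_dist :: "('d::finite \<Rightarrow> int) \<Rightarrow> ('d \<Rightarrow> int) set \<Rightarrow> int" where
  "set_dist u B = Min (l1dist u ` B)"

text \<open>A boundary condition psi : A^psi \<rightarrow> S with A^psi \<subseteq> \<partial>V, as a partial map.\<close>
definition is_bc :: "('d::finite \<Rightarrow> int) set \<Rightarrow> (('d \<Rightarrow> int) \<rightharpoonup> 's) \<Rightarrow> bool" where
  "is_bc V \<psi> \<longleftrightarrow> dom \<psi> \<subseteq> bdry V"

text \<open>exp extended to R \<union> {-\<infinity>}, with exp(-\<infinity>) = 0\<close>
definition eexp :: "ereal \<Rightarrow> real" where
  "eexp x = (case x of ereal r \<Rightarrow> exp r | _ \<Rightarrow> 0)"

text \<open>Configurations on V (extensional functions V \<rightarrow> S).\<close>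
definition configs :: "('d::finite \<Rightarrow> int) set \<Rightarrow> (('d \<Rightarrow> int) \<Rightarrow> 's::finite) set" where
  "configs V = V \<rightarrow>\<^sub>E UNIV"

text \<open>Hamiltonian. The sum over (unordered) edges of G is written as one half of the sum
  over ordered adjacent pairs (U is symmetric).\<close>
definition hamil :: "('s \<Rightarrow> 's \<Rightarrow> ereal) \<Rightarrow> ('s \<Rightarrow> real) \<Rightarrow> ('d::finite \<Rightarrow> int) set
    \<Rightarrow> (('d \<Rightarrow> int) \<rightharpoonup> 's) \<Rightarrow> (('d \<Rightarrow> int) \<Rightarrow> 's) \<Rightarrow> ereal" where
  "hamil U W V \<psi> \<sigma> =
     ereal (1/2) * (\<Sum>(u,v)\<in>{(u,v). u \<in> V \<and> v \<in> V \<and> adj u v}. U (\<sigma> u) (\<sigma> v))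
     + (\<Sum>(u,v)\<in>{(u,v). u \<in> dom \<psi> \<and> v \<in> V \<and> adj u v}. U (the (\<psi> u)) (\<sigma> v))
     + ereal (\<Sum>u\<in>V. W (\<sigma> u))"

definition gweight where
  "gweight U W V \<psi> \<sigma> = eexp (hamil U W V \<psi> \<sigma>)"

text \<open>valid configurations\<close>
definition Omega where
  "Omega U W V \<psi> = {\<sigma> \<in> configs V. gweight U W V \<psi> \<sigma> > 0}"

definition gibbs where
  "gibbs U W V \<psi> \<sigma> = (if \<sigma> \<in> Omega U W V \<psi>
      then gweight U W V \<psi> \<sigma> / (\<Sum>\<eta>\<in>Omega U W V \<psi>. gweight U W V \<psi> \<eta>) else 0)"

text \<open>mu^psi(tau | sigma(V - A)): heat-bath update of the block A\<close>
definition cond_update where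
  "cond_update U W V \<psi> A \<sigma> \<tau> =
     (if \<tau> \<in> Omega U W V \<psi> \<and> (\<forall>x\<in>V - A. \<tau> x = \<sigma> x)
      then gibbs U W V \<psi> \<tau> /
           (\<Sum>\<eta>\<in>{\<eta>\<in>Omega U W V \<psi>. \<forall>x\<in>V - A. \<eta> x = \<sigma> x}. gibbs U W V \<psi> \<eta>)
      else 0)"

text \<open>Heat-bath block dynamics B_A for the collection As = [A_1,...,A_r]\<close>
definition block_dyn where
  "block_dyn U W V \<psi> As \<sigma> \<tau> =
     (\<Sum>i<length As. cond_update U W V \<psi> (As ! i) \<sigma> \<tau>) / real (length As)"

text \<open>Single-site heat-bath Glauber dynamics\<close>
definition glauber where
  "glauber U W V \<psi> \<sigma> \<tau> =
     (\<Sum>v\<in>V. cond_update U W V \<psi> {v} \<sigma> \<tau>) / real (card V)"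

definition irreducible_on :: "'a set \<Rightarrow> ('a \<Rightarrow> 'a \<Rightarrow> real) \<Rightarrow> bool" where
  "irreducible_on \<Omega> P \<longleftrightarrow>
     (\<forall>\<sigma>\<in>\<Omega>. \<forall>\<tau>\<in>\<Omega>. (\<sigma>, \<tau>) \<in> {(x, y). x \<in> \<Omega> \<and> y \<in> \<Omega> \<and> P x y > 0}\<^sup>*)"

text \<open>Transition matrix of a kernel on a finite state space (any enumeration)\<close>
definition kernel_mat :: "'a set \<Rightarrow> ('a \<Rightarrow> 'a \<Rightarrow> real) \<Rightarrow> real mat" where
  "kernel_mat \<Omega> P = (let xs = (SOME xs. distinct xs \<and> set xs = \<Omega>)
     in mat (length xs) (length xs) (\<lambda>(i, j). P (xs ! i) (xs ! j)))"

text \<open>eigenvalues with multiplicity, in non-increasing order lambda_1 \<ge> ... \<ge> lambda_N\<close>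
definition eigs_desc :: "real mat \<Rightarrow> real list" where
  "eigs_desc M = rev (sorted_list_of_multiset (proots (char_poly M)))"

text \<open>lambda(P) = 1 - max(|lambda_2|, |lambda_N|); when N = 1 there is no lambda_2 and
  we use the convention lambda(P) = 1.\<close>
definition spectral_gap :: "real mat \<Rightarrow> real" where
  "spectral_gap M = (let ls = eigs_desc M in
     if length ls \<le> 1 then 1 else 1 - max \<bar>ls ! 1\<bar> \<bar>last ls\<bar>)"

definition tv_marginal where
  "tv_marginal U W V \<psi> \<psi>' B =
     (1/2) * (\<Sum>\<eta>\<in>(\<lambda>\<sigma>. restrict \<sigma> B) ` (Omega U W V \<psi> \<union> Omega U W V \<psi>').
        \<bar>(\<Sum>\<sigma>\<in>{\<sigma>\<in>Omega U W V \<psi>. restrict \<sigma> B = \<eta>}. gibbs U W V \<psi> \<sigma>)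
         - (\<Sum>\<sigma>\<in>{\<sigma>\<in>Omega U W V \<psi>'. restrict \<sigma> B = \<eta>}. gibbs U W V \<psi>' \<sigma>)\<bar>)"

definition SSM :: "('s::finite \<Rightarrow> 's \<Rightarrow> ereal) \<Rightarrow> ('s \<Rightarrow> real) \<Rightarrow> ('d::finite itself) \<Rightarrow> bool" where
  "SSM U W _ \<longleftrightarrow> (\<exists>a b. a > 0 \<and> b > 0 \<and>
     (\<forall>(\<Lambda>::('d \<Rightarrow> int) set) B u \<psi> \<psi>'. is_cube \<Lambda> \<longrightarrow> B \<subseteq> \<Lambda> \<longrightarrow> u \<in> bdry \<Lambda> \<longrightarrow>
        is_bc \<Lambda> \<psi> \<longrightarrow> is_bc \<Lambda> \<psi>' \<longrightarrow> (\<forall>x. x \<noteq> u \<longrightarrow> \<psi> x = \<psi>' x) \<longrightarrow>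
        tv_marginal U W \<Lambda> \<psi> \<psi>' B \<le> b * exp (- a * real_of_int (set_dist u B))))"

text \<open>permissive: every finite region with every boundary condition has a valid configuration\<close>
definition permissive :: "('s::finite \<Rightarrow> 's \<Rightarrow> ereal) \<Rightarrow> ('s \<Rightarrow> real) \<Rightarrow> ('d::finite itself) \<Rightarrow> bool" where
  "permissive U W _ \<longleftrightarrow> (\<forall>(V::('d \<Rightarrow> int) set) \<psi>. finite V \<longrightarrow> is_bc V \<psi> \<longrightarrow> Omega U W V \<psi> \<noteq> {})"

definition glauber_irreducible :: "('s::finite \<Rightarrow> 's \<Rightarrow> ereal) \<Rightarrow> ('s \<Rightarrow> real) \<Rightarrow> ('d::finite itself) \<Rightarrow> bool" where
  "glauber_irreducible U W _ \<longleftrightarrow> (\<forall>(V::('d \<Rightarrow> int) set) \<psi>. finite V \<longrightarrow> is_bc V \<psi> \<longrightarrow>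
      irreducible_on (Omega U W V \<psi>) (glauber U W V \<psi>))"

end

(* The block dynamics is a convex combination of the conditional expectations avg A, so its spectral gap
   is controlled by a Poincare inequality with the energies |f|^2 - |avg A f|^2.

   Strong spatial mixing makes the average, over a bounded family of tilings by well separated cubes of
   side between L and 2 L, of the heat bath on all cubes of a tiling contract the largest oscillation of
   a function at a single site: a site is covered with probability bounded below, is a boundary site of
   some cube with probability O(1/L), and in the latter case influences, up to an exponentially small
   error, only the sites within distance m << L.  By log-convexity this rate bounds the spectrum.

   The energy of a tiling is compared with the energies of arbitrary covering blocks A_1, ..., A_r one cube
   Q at a time: conditional expectations on separated sets commute, so the losses of avg (A_i \<inter> Q) for
   the different cubes Q add up to at most the loss of avg A_i.  No factor r is lost, because within a
   single cube of bounded size irreducibility already gives a uniform constant. *)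

theory Submission
  imports Defs "HOL-Library.Cardinality"
begin

section \<open>Spectral gap from quadratic forms\<close>

text \<open>Hard constraints shape the argument: two valid configurations that differ at few sites
  need not be joined by few valid single-site changes. Oscillations are therefore measured over all
  configurations, valid or not; permissiveness makes every conditional expectation meaningful there,
  and mixing is available for every boundary condition. Irreducibility is used only inside cubes of
  bounded size. Contraction of oscillations alone bounds square norms only up to a factor depending
  on the volume of V. Self-adjointness removes it, since log-convex norms shrink most in the first
  step. Sites near the faces of V must be covered as well, so each coordinate uses the two extreme
  intervals with fixed positive probability. For a single side length their ends would be grazed too
  often; averaging over side lengths spreads these ends, and a given site is affected by at most two
  lengths per coordinate. The scale L is m^(d+1) because a boundary site costs of order m^d.\<close>

lemma char_poly_row_sums_one:
  fixes K :: "nat \<Rightarrow> nat \<Rightarrow> real"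
  assumes row: "\<And>i. i \<le> n \<Longrightarrow> (\<Sum>j\<le>n. K i j) = 1"
  shows "char_poly (mat (Suc n) (Suc n) (\<lambda>(i, j). K i j)) =
    [:-1, 1:] * char_poly (mat n n (\<lambda>(i, j). K (Suc i) (Suc j) - K 0 (Suc j)))"
proof -
  define M where "M = mat (Suc n) (Suc n) (\<lambda>(i, j). K i j)"
  define N where "N = mat n n (\<lambda>(i, j). K (Suc i) (Suc j) - K 0 (Suc j))"
  \<comment> \<open>The columns of \<open>P\<close> are the all-ones vector and the unit vectors
    other than the zeroth. The all-ones vector is fixed by \<open>M\<close>, so in this basis the
    matrix is block triangular and one factor for the root 1 splits off, whatever the multiplicity
    of that root.\<close>
  define P where "P = mat (Suc n) (Suc n) (\<lambda>(i, j). if i = j \<or> j = 0 then 1 else 0 :: real)"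
  define Q where "Q = mat (Suc n) (Suc n) (\<lambda>(i, j). if i = j then 1 else if j = 0 then - 1 else 0 :: real)"
  define B where "B = four_block_mat (mat 1 1 (\<lambda>_. 1)) (mat 1 n (\<lambda>(i, j). K 0 (Suc j))) (0\<^sub>m n 1) N"
  have row': "(\<Sum>j<Suc n. K i j) = 1" if "i < Suc n" for i
    using row[of i] that by (simp add: lessThan_Suc_atMost)
  have PQ: "P * Q = 1\<^sub>m (Suc n)"
  proof (rule eq_matI)
    fix i j assume ij: "i < dim_row (1\<^sub>m (Suc n) :: real mat)" "j < dim_col (1\<^sub>m (Suc n) :: real mat)"
    have "(P * Q) $$ (i, j) = (\<Sum>k<Suc n. (if i = k \<or> k = 0 then 1 else 0) * (if k = j then 1 else if j = 0 then - 1 else 0 :: real))"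
      using ij by (simp add: P_def Q_def scalar_prod_def atLeast0LessThan)
    also have "\<dots> = (\<Sum>k<Suc n. (if k = j then (if i = k \<or> k = 0 then 1 else 0) else 0)
       + (if k = i then (if i \<noteq> j \<and> j = 0 then -1 else 0) else 0))"
      by (rule sum.cong) auto
    also have "\<dots> = 1\<^sub>m (Suc n) $$ (i, j)"
      using ij by (auto simp: sum.distrib simp del: sum.lessThan_Suc)
    finally show "(P * Q) $$ (i, j) = 1\<^sub>m (Suc n) $$ (i, j)" .
  qed (auto simp: P_def Q_def)
  have car: "P \<in> carrier_mat (Suc n) (Suc n)" "Q \<in> carrier_mat (Suc n) (Suc n)"
    "M \<in> carrier_mat (Suc n) (Suc n)" "B \<in> carrier_mat (Suc n) (Suc n)"
    by (auto simp: P_def Q_def M_def B_def N_def)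
  have QP: "Q * P = 1\<^sub>m (Suc n)"
    using mat_mult_left_right_inverse[OF car(1,2) PQ] .
  have MP: "M * P = P * B"
  proof (rule eq_matI)
    fix i j assume "i < dim_row (P * B)" "j < dim_col (P * B)"
    then have ij: "i < Suc n" "j < Suc n" using car by auto
    have B: "B $$ (k, l) = (if k = 0 then (if l = 0 then 1 else K 0 l) else if l = 0 then 0 else K k l - K 0 l)"
      if "k < Suc n" "l < Suc n" for k l
      using that by (cases k; cases l) (auto simp: B_def N_def)
    have "(M * P) $$ (i, j) = (\<Sum>k<Suc n. K i k * (if k = j \<or> j = 0 then 1 else 0))"
      using ij by (simp add: M_def P_def scalar_prod_def atLeast0LessThan)
    also have "\<dots> = (if j = 0 then 1 else K i j)"
    proof (cases "j = 0")
      case True then show ?thesis using row'[OF ij(1)] by (simp del: sum.lessThan_Suc)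
    next
      case False
      then have "(\<Sum>k<Suc n. K i k * (if k = j \<or> j = 0 then 1 else 0)) = (\<Sum>k<Suc n. if k = j then K i k else 0)"
        by (intro sum.cong) auto
      then show ?thesis using False ij by (simp del: sum.lessThan_Suc)
    qed
    also have "\<dots> = (\<Sum>k<Suc n. (if k = i \<or> k = 0 then 1 else 0) * B $$ (k, j))"
    proof -
      have "(\<Sum>k<Suc n. (if k = i \<or> k = 0 then 1 else 0) * B $$ (k, j)) =
         (\<Sum>k<Suc n. (if k = i then B $$ (k, j) else 0) + (if k = 0 then (if i = 0 then 0 else B $$ (k, j)) else 0))"
        by (rule sum.cong) auto
      also have "\<dots> = (if j = 0 then 1 else K i j)"
        using ij by (simp add: sum.distrib B del: sum.lessThan_Suc)
      finally show ?thesis by simp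
    qed
    also have "\<dots> = (P * B) $$ (i, j)"
      using ij car by (auto simp: P_def scalar_prod_def atLeast0LessThan intro!: sum.cong)
    finally show "(M * P) $$ (i, j) = (P * B) $$ (i, j)" .
  qed (use car in auto)
  have "M = M * (P * Q)" using PQ car by simp
  also have "\<dots> = P * B * Q" using car MP by (metis assoc_mult_mat)
  finally have "similar_mat M B" using PQ QP car by (intro similar_matI[of _ _ P Q "Suc n"]) auto
  then have "char_poly M = char_poly B" by (rule char_poly_similar)
  also have "\<dots> = char_poly (mat 1 1 (\<lambda>_. 1 :: real)) * char_poly N"
    unfolding B_def by (rule char_poly_four_block_zeros_col) (auto simp: N_def)
  also have "char_poly (mat 1 1 (\<lambda>_. 1 :: real)) = [:-1, 1:]"
    by (simp add: char_poly_defs det_def sign_def)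
  finally show ?thesis unfolding M_def N_def .
qed

text \<open>A left eigenvector of the deflated matrix receives minus the sum of its entries as
  zeroth entry; the zeroth equation then follows because row sums one preserve the total. This also
  covers \<open>l = 1\<close>, so a repeated top eigenvalue is not overlooked.\<close>

lemma left_eigenvector_deflated:
  fixes K :: "nat \<Rightarrow> nat \<Rightarrow> real"
  assumes row: "\<And>i. i \<le> n \<Longrightarrow> (\<Sum>j\<le>n. K i j) = 1"
    and root: "poly (char_poly (mat n n (\<lambda>(i, j). K (Suc i) (Suc j) - K 0 (Suc j)))) l = 0"
  obtains u where "\<exists>i\<le>n. u i \<noteq> 0" "(\<Sum>i\<le>n. u i) = 0"
    "\<And>j. j \<le> n \<Longrightarrow> (\<Sum>i\<le>n. u i * K i j) = l * u j"
proof -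
  define N where "N = mat n n (\<lambda>(i, j). K (Suc i) (Suc j) - K 0 (Suc j))"
  have N: "N \<in> carrier_mat n n" by (simp add: N_def)
  have "poly (char_poly (transpose_mat N)) l = 0" using root N by (simp add: N_def[symmetric])
  then have "eigenvalue (transpose_mat N) l"
    using eigenvalue_root_char_poly[of "transpose_mat N" n l] N by auto
  then obtain v where v: "v \<in> carrier_vec n" "v \<noteq> 0\<^sub>v n" "transpose_mat N *\<^sub>v v = l \<cdot>\<^sub>v v"
    using N unfolding eigenvalue_def eigenvector_def by auto
  have veq: "(\<Sum>i<n. v $ i * (K (Suc i) (Suc j) - K 0 (Suc j))) = l * v $ j" if "j < n" for j
  proof -
    have "(transpose_mat N *\<^sub>v v) $ j = (\<Sum>i<n. (K (Suc i) (Suc j) - K 0 (Suc j)) * v $ i)"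
      using that v(1) by (auto simp: N_def scalar_prod_def atLeast0LessThan)
    then show ?thesis using v that by (simp add: mult.commute)
  qed
  define u where "u i = (case i of 0 \<Rightarrow> - (\<Sum>i<n. v $ i) | Suc i \<Rightarrow> v $ i)" for i
  have split: "(\<Sum>i\<le>n. F i) = F 0 + (\<Sum>i<n. F (Suc i))" for F :: "nat \<Rightarrow> real"
    by (simp add: lessThan_Suc_atMost[symmetric] sum.lessThan_Suc_shift del: sum.lessThan_Suc)
  have sum0: "(\<Sum>i\<le>n. u i) = 0" unfolding split by (simp add: u_def)
  obtain i where "i < n" "v $ i \<noteq> 0" using v(1,2) by (metis eq_vecI carrier_vecD index_zero_vec)
  then have nz: "\<exists>i\<le>n. u i \<noteq> 0" by (intro exI[of _ "Suc i"]) (auto simp: u_def)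
  have S: "(\<Sum>i\<le>n. u i * K i (Suc j)) = l * u (Suc j)" if "j < n" for j
    using veq[OF that] unfolding split
    by (simp add: u_def algebra_simps sum_subtractf sum_distrib_left sum_distrib_right)
  have eq: "(\<Sum>i\<le>n. u i * K i j) = l * u j" if "j \<le> n" for j
  proof (cases j)
    case (Suc k)
    then show ?thesis using S that by auto
  next
    case 0
    have "(\<Sum>j\<le>n. \<Sum>i\<le>n. u i * K i j) = (\<Sum>i\<le>n. u i * (\<Sum>j\<le>n. K i j))"
      by (subst sum.swap) (simp add: sum_distrib_left)
    also have "\<dots> = 0" using row sum0 by simp
    finally have "(\<Sum>i\<le>n. u i * K i 0) + (\<Sum>j<n. \<Sum>i\<le>n. u i * K i (Suc j)) = 0"
      by (simp add: split[of "\<lambda>j. \<Sum>i\<le>n. u i * K i j"])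
    then have "(\<Sum>i\<le>n. u i * K i 0) = - (\<Sum>j<n. l * u (Suc j))" using S by simp
    then show ?thesis using 0 by (simp add: u_def sum_distrib_left)
  qed
  show ?thesis using that[OF nz sum0 eq] .
qed

text \<open>By reversibility, dividing a left eigenvector of sum zero by \<open>m\<close> gives a
  right eigenfunction of mean zero, on which the quadratic form is \<open>l\<close> times the
  squared norm; \<open>psd\<close> and \<open>gap\<close> then trap \<open>l\<close> between 0 and
  \<open>1 - c\<close>. Nonnegativity is what handles the absolute value of the smallest
  eigenvalue.\<close>

lemma spectral_gap_ge:
  fixes K :: "'a \<Rightarrow> 'a \<Rightarrow> real" and m :: "'a \<Rightarrow> real"
  assumes fin: "finite S" and ne: "S \<noteq> {}"
    and pos: "\<And>x. x \<in> S \<Longrightarrow> m x > 0"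
    and row: "\<And>x. x \<in> S \<Longrightarrow> (\<Sum>y\<in>S. K x y) = 1"
    and rev: "\<And>x y. x \<in> S \<Longrightarrow> y \<in> S \<Longrightarrow> m x * K x y = m y * K y x"
    and psd: "\<And>f. (\<Sum>x\<in>S. m x * f x * (\<Sum>y\<in>S. K x y * f y)) \<ge> 0"
    and gap: "\<And>f. (\<Sum>x\<in>S. m x * f x) = 0 \<Longrightarrow>
      (\<Sum>x\<in>S. m x * f x * (\<Sum>y\<in>S. K x y * f y)) \<le> (1 - c) * (\<Sum>x\<in>S. m x * (f x)\<^sup>2)"
    and c: "0 \<le> c" "c \<le> 1"
  shows "spectral_gap (kernel_mat S K) \<ge> c"
proof -
  define xs where "xs = (SOME xs. distinct xs \<and> set xs = S)"
  have "\<exists>xs. distinct xs \<and> set xs = S" using finite_distinct_list[OF fin] by auto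
  then have xs: "distinct xs" "set xs = S" unfolding xs_def by (metis (mono_tags, lifting) someI_ex)+
  then obtain n where n: "length xs = Suc n" using ne by (cases xs) auto
  define k where "k i j = K (xs ! i) (xs ! j)" for i j
  have bij: "bij_betw ((!) xs) {..n} S"
    using bij_betw_nth[OF xs(1), of "{..n}" S] n xs(2) by (simp add: lessThan_Suc_atMost[symmetric])
  have reidx: "(\<Sum>i\<le>n. F (xs ! i)) = (\<Sum>x\<in>S. F x)" for F :: "'a \<Rightarrow> real"
    by (rule sum.reindex_bij_betw[OF bij])
  have inS: "xs ! i \<in> S" if "i \<le> n" for i using that n xs(2) by (metis le_imp_less_Suc nth_mem)
  have krow: "(\<Sum>j\<le>n. k i j) = 1" if "i \<le> n" for i
    unfolding k_def reidx using row[OF inS[OF that]] .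
  define N where "N = mat n n (\<lambda>(i, j). k (Suc i) (Suc j) - k 0 (Suc j))"
  have kmat: "kernel_mat S K = mat (Suc n) (Suc n) (\<lambda>(i, j). k i j)"
    unfolding kernel_mat_def Let_def xs_def[symmetric] n k_def ..
  have cp: "char_poly (kernel_mat S K) = [:-1, 1:] * char_poly N"
    unfolding kmat N_def by (rule char_poly_row_sums_one[OF krow])
  have cpN0: "char_poly N \<noteq> 0"
    using degree_monic_char_poly[of N n] by (auto simp: N_def)
  have range: "0 \<le> l \<and> l \<le> 1 - c" if rt: "poly (char_poly N) l = 0" for l
  proof -
    obtain u where u: "\<exists>i\<le>n. u i \<noteq> 0" "(\<Sum>i\<le>n. u i) = 0"
      "\<And>j. j \<le> n \<Longrightarrow> (\<Sum>i\<le>n. u i * k i j) = l * u j"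
      by (rule left_eigenvector_deflated[OF krow rt[unfolded N_def]]) blast+
    define f where "f x = u (the_inv_into {..n} ((!) xs) x) / m x" for x
    have f: "m (xs ! i) * f (xs ! i) = u i" if "i \<le> n" for i
    proof -
      have "the_inv_into {..n} ((!) xs) (xs ! i) = i"
        using bij that by (intro the_inv_into_f_f) (auto simp: bij_betw_def)
      then show ?thesis using pos[OF inS[OF that]] by (simp add: f_def)
    qed
    have mean: "(\<Sum>x\<in>S. m x * f x) = 0" unfolding reidx[symmetric] using u(2) f by simp
    have ev: "(\<Sum>y\<in>S. K x y * f y) = l * f x" if "x \<in> S" for x
    proof -
      have "x \<in> (!) xs ` {..n}" unfolding bij_betw_imp_surj_on[OF bij] by (rule that)
      then obtain j where j: "j \<le> n" "x = xs ! j" by auto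
      have "m x * (\<Sum>y\<in>S. K x y * f y) = (\<Sum>y\<in>S. (m y * f y) * K y x)"
        unfolding sum_distrib_left
      proof (intro sum.cong refl)
        fix y assume "y \<in> S"
        then show "m x * (K x y * f y) = m y * f y * K y x"
          using arg_cong[OF rev[OF that \<open>y \<in> S\<close>], of "\<lambda>z. z * f y"] by (simp only: mult_ac)
      qed
      also have "\<dots> = (\<Sum>i\<le>n. u i * k i j)"
        unfolding reidx[symmetric] using j f by (intro sum.cong refl) (simp add: k_def)
      also have "\<dots> = m x * (l * f x)" using u(3)[OF j(1)] f[OF j(1)] j by simp
      finally show ?thesis using pos[OF that] by simp
    qed
    define q where "q = (\<Sum>x\<in>S. m x * (f x)\<^sup>2)"
    obtain i where i: "i \<le> n" "u i \<noteq> 0" using u(1) by auto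
    have "0 < q" unfolding q_def
    proof (rule sum_pos2[OF fin inS[OF i(1)]])
      show "0 < m (xs ! i) * (f (xs ! i))\<^sup>2" 
      proof (rule mult_pos_pos[OF pos[OF inS[OF i(1)]]])
        have "f (xs ! i) \<noteq> 0" using f[OF i(1)] i(2) by (metis mult_zero_right)
        then show "0 < (f (xs ! i))\<^sup>2" by simp
      qed
    next
      fix x assume "x \<in> S" then show "0 \<le> m x * (f x)\<^sup>2" using pos[of x] by (simp add: less_imp_le)
    qed
    moreover have "(\<Sum>x\<in>S. m x * f x * (\<Sum>y\<in>S. K x y * f y)) = l * q"
    proof -
      have "(\<Sum>x\<in>S. m x * f x * (\<Sum>y\<in>S. K x y * f y)) = (\<Sum>x\<in>S. m x * f x * (l * f x))"
        by (intro sum.cong refl) (simp only: ev)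
      then show ?thesis
        by (simp add: q_def sum_distrib_left power2_eq_square mult_ac)
    qed
    ultimately show ?thesis using psd[of f] gap[OF mean] unfolding q_def[symmetric]
      by (auto simp: zero_le_mult_iff)
  qed
  define R where "R = proots (char_poly N)"
  have R: "0 \<le> l \<and> l \<le> 1 - c" if "l \<in># R" for l
    using that range cpN0 by (simp add: R_def)
  \<comment> \<open>All roots in \<open>R\<close> are at most 1, so the split-off root comes last in
    increasing order; in decreasing order the list of \<open>R\<close> starts at position 1.\<close>
  have "sorted_list_of_multiset (proots (char_poly (kernel_mat S K))) = sorted_list_of_multiset R @ [1]"
  proof -
    have "proots (char_poly (kernel_mat S K)) = add_mset 1 R"
      unfolding cp R_def using cpN0 by (subst proots_mult) auto
    moreover have "sorted (sorted_list_of_multiset R @ [1])"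
      using R c by (force simp: sorted_append)
    ultimately show ?thesis
      by (metis (no_types, lifting) mset_append mset_single_iff_right sorted_list_of_multiset_mset
          add_mset_add_single mset_sorted_list_of_multiset sorted_sort_id)
  qed
  then have ls: "eigs_desc (kernel_mat S K) = 1 # rev (sorted_list_of_multiset R)"
    by (simp add: eigs_desc_def)
  show ?thesis
  proof (cases "rev (sorted_list_of_multiset R)")
    case Nil
    then show ?thesis using ls c by (simp add: spectral_gap_def)
  next
    case (Cons a as)
    have set: "set (a # as) = set_mset R" by (metis Cons set_rev set_sorted_list_of_multiset)
    have "a \<in># R" "last (a # as) \<in># R" using set last_in_set[of "a # as"] by auto
    then have "\<bar>a\<bar> \<le> 1 - c" "\<bar>last (a # as)\<bar> \<le> 1 - c" using R by fastforce+
    then show ?thesis unfolding spectral_gap_def ls Cons Let_def by simp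
  qed
qed

section \<open>Conditional expectations of a spin field\<close>

text \<open>Configurations are total functions frozen outside \<open>A\<close>, not extensional
  functions on \<open>A\<close>: averages over different regions then act on one function space and
  can be composed.\<close>

definition cyl :: "'a set \<Rightarrow> ('a \<Rightarrow> 's) \<Rightarrow> ('a \<Rightarrow> 's) set" where
  "cyl A \<sigma> = {\<tau>. \<forall>x. x \<notin> A \<longrightarrow> \<tau> x = \<sigma> x}"

lemma cyl_iff: "\<tau> \<in> cyl A \<sigma> \<longleftrightarrow> (\<forall>x. x \<notin> A \<longrightarrow> \<tau> x = \<sigma> x)"
  by (simp add: cyl_def)

lemma cyl_self [simp]: "\<sigma> \<in> cyl A \<sigma>"
  by (simp add: cyl_def)

lemma cyl_eq: "\<tau> \<in> cyl A \<sigma> \<Longrightarrow> cyl A \<tau> = cyl A \<sigma>"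
  by (auto simp: cyl_def)

lemma cyl_sym: "\<tau> \<in> cyl A \<sigma> \<longleftrightarrow> \<sigma> \<in> cyl A \<tau>"
  by (auto simp: cyl_def)

lemma cyl_mono: "A \<subseteq> B \<Longrightarrow> cyl A \<sigma> \<subseteq> cyl B \<sigma>"
  by (auto simp: cyl_def)

lemma bij_betw_restrict_cyl: "bij_betw (\<lambda>\<tau>. restrict \<tau> A) (cyl A \<sigma>) (A \<rightarrow>\<^sub>E UNIV)"
  by (rule bij_betw_byWitness[where f' = "\<lambda>\<eta> x. if x \<in> A then \<eta> x else \<sigma> x"])
     (auto simp: cyl_def fun_eq_iff PiE_def extensional_def)

lemma finite_cyl [simp]: "finite A \<Longrightarrow> finite (cyl A (\<sigma> :: 'a \<Rightarrow> 's::finite))"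
  using bij_betw_finite[OF bij_betw_restrict_cyl, of A \<sigma>] by (simp add: finite_PiE)

lemma card_cyl: "finite A \<Longrightarrow> card (cyl A (\<sigma> :: 'a \<Rightarrow> 's::finite)) = CARD('s) ^ card A"
  using bij_betw_same_card[OF bij_betw_restrict_cyl, of A \<sigma>] by (simp add: card_PiE)

section \<open>Lattice geometry: pairs meeting a region, balls and neighbours\<close>

definition touching :: "('d::finite \<Rightarrow> int) set \<Rightarrow> (('d \<Rightarrow> int) \<times> ('d \<Rightarrow> int)) set" where
  "touching A = {(u, v). adj u v \<and> (u \<in> A \<or> v \<in> A)}"

lemma l1dist_commute: "l1dist u v = l1dist v u"
  by (simp add: l1dist_def abs_minus_commute)

lemma l1dist_self [simp]: "l1dist u u = 0"
  by (simp add: l1dist_def)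

lemma l1dist_triangle: "l1dist u w \<le> l1dist u v + l1dist v w"
  unfolding l1dist_def sum.distrib[symmetric] by (rule sum_mono) linarith

lemma abs_le_l1dist: "\<bar>u i - v i\<bar> \<le> l1dist u v"
  unfolding l1dist_def by (rule member_le_sum) auto

lemma adj_commute: "adj u v \<longleftrightarrow> adj v u"
  by (simp add: adj_def l1dist_commute)

lemma l1ball_subset_box:
  "{v. l1dist u v \<le> int m} \<subseteq> PiE UNIV (\<lambda>i. {u i - int m .. u i + int m})"
proof
  fix v assume "v \<in> {v. l1dist u v \<le> int m}"
  then have "\<bar>u i - v i\<bar> \<le> int m" for i using abs_le_l1dist[of u i v] by auto
  then have "v i \<in> {u i - int m .. u i + int m}" for i by (smt (verit) atLeastAtMost_iff)
  then show "v \<in> PiE UNIV (\<lambda>i. {u i - int m .. u i + int m})" by auto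
qed

lemma finite_l1ball: "finite {v :: 'd::finite \<Rightarrow> int. l1dist u v \<le> int m}"
  by (rule finite_subset[OF l1ball_subset_box]) (auto intro!: finite_PiE)

lemma card_l1ball: "card {v :: 'd::finite \<Rightarrow> int. l1dist u v \<le> int m} \<le> (2 * m + 1) ^ CARD('d)"
proof -
  have "card {v :: 'd \<Rightarrow> int. l1dist u v \<le> int m} \<le> card (PiE UNIV (\<lambda>i. {u i - int m .. u i + int m}))"
    by (rule card_mono[OF _ l1ball_subset_box]) (auto intro!: finite_PiE)
  also have "\<dots> = (\<Prod>i\<in>(UNIV :: 'd set). nat (2 * int m + 1))"
    by (subst card_PiE) (auto simp: algebra_simps)
  also have "\<dots> = (2 * m + 1) ^ CARD('d)"
    by (simp add: nat_add_distrib nat_mult_distrib)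
  finally show ?thesis .
qed

lemma neighbours_subset: "{v. adj u v} \<subseteq> {v. l1dist u v \<le> int 1}"
  by (auto simp: adj_def)

lemma finite_neighbours [simp]: "finite {v :: 'd::finite \<Rightarrow> int. adj u v}"
  by (rule finite_subset[OF neighbours_subset finite_l1ball])

lemma card_neighbours: "card {v :: 'd::finite \<Rightarrow> int. adj u v} \<le> 3 ^ CARD('d)"
  using card_mono[OF finite_l1ball neighbours_subset, of u] card_l1ball[of u 1] by simp

lemma touching_subset:
  "touching A \<subseteq> Sigma A (\<lambda>u. {v. adj u v}) \<union> prod.swap ` Sigma A (\<lambda>u. {v. adj u v})"
  by (auto simp: touching_def adj_commute image_iff)

lemma finite_touching: "finite A \<Longrightarrow> finite (touching A)"
  by (rule finite_subset[OF touching_subset]) auto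

lemma card_touching:
  assumes "finite (A :: ('d::finite \<Rightarrow> int) set)"
  shows "card (touching A) \<le> 2 * card A * 3 ^ CARD('d)"
proof -
  have S: "card (Sigma A (\<lambda>u. {v. adj u v})) \<le> card A * 3 ^ CARD('d)"
    using assms by (simp add: card_SigmaI) (metis sum_bounded_above card_neighbours of_nat_id)
  have "card (touching A) \<le> card (Sigma A (\<lambda>u. {v. adj u v}) \<union> prod.swap ` Sigma A (\<lambda>u. {v. adj u v}))"
    by (rule card_mono[OF _ touching_subset]) (use assms in auto)
  also have "\<dots> \<le> card (Sigma A (\<lambda>u. {v. adj u v})) + card (prod.swap ` Sigma A (\<lambda>u. {v. adj u v}))"
    by (rule card_Un_le)
  also have "card (prod.swap ` Sigma A (\<lambda>u. {v. adj u v})) = card (Sigma A (\<lambda>u. {v. adj u v}))"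
    by (simp add: card_image)
  finally show ?thesis using S by simp
qed

text \<open>Sites outside \<^term>\<open>D\<close> carry no spin: pairs leaving \<^term>\<open>D\<close> do not interact.  Pairs are
  ordered, so every edge contributes its weight twice.\<close>

definition weight where
  "weight h k D A \<sigma> =
     (\<Prod>(u, v)\<in>touching A. if u \<in> D \<and> v \<in> D then h (\<sigma> u) (\<sigma> v) else 1) * (\<Prod>v\<in>A. k (\<sigma> v))"

text \<open>\<open>ex_pos\<close> abstracts permissiveness. It is required for every \<sigma>, so
  averages are defined even at configurations of weight zero.\<close>

locale spin_field =
  fixes h :: "'s::finite \<Rightarrow> 's \<Rightarrow> real" and k :: "'s \<Rightarrow> real"
    and D V :: "('d::finite \<Rightarrow> int) set"
  assumes finV: "finite V"
    and h_nonneg: "\<And>s t. 0 \<le> h s t"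
    and k_pos: "\<And>s. 0 < k s"
    and ex_pos: "\<And>A \<sigma>. A \<subseteq> V \<Longrightarrow> \<exists>\<tau>\<in>cyl A \<sigma>. weight h k D A \<tau> > 0"
begin

abbreviation w where "w \<equiv> weight h k D"

definition Z :: "('d \<Rightarrow> int) set \<Rightarrow> (('d \<Rightarrow> int) \<Rightarrow> 's) \<Rightarrow> real" where
  "Z A \<sigma> = (\<Sum>\<tau>\<in>cyl A \<sigma>. w A \<tau>)"

definition avg :: "('d \<Rightarrow> int) set \<Rightarrow> ((('d \<Rightarrow> int) \<Rightarrow> 's) \<Rightarrow> real) \<Rightarrow> (('d \<Rightarrow> int) \<Rightarrow> 's) \<Rightarrow> real" where
  "avg A g \<sigma> = (\<Sum>\<tau>\<in>cyl A \<sigma>. w A \<tau> * g \<tau>) / Z A \<sigma>"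

lemma finA: "A \<subseteq> V \<Longrightarrow> finite A"
  using finV finite_subset by blast

lemma w_nonneg: "0 \<le> w A \<tau>"
  unfolding weight_def
  by (intro mult_nonneg_nonneg prod_nonneg) (auto simp: h_nonneg k_pos less_imp_le)

lemma Z_pos: assumes "A \<subseteq> V" shows "Z A \<sigma> > 0"
proof -
  obtain \<tau> where "\<tau> \<in> cyl A \<sigma>" "w A \<tau> > 0" using ex_pos[OF assms] by blast
  then show ?thesis unfolding Z_def using finA[OF assms] w_nonneg by (intro sum_pos2) auto
qed

lemma Z_eq: "\<tau> \<in> cyl A \<sigma> \<Longrightarrow> Z A \<tau> = Z A \<sigma>"
  by (simp add: Z_def cyl_eq)

lemma avg_eq: "\<tau> \<in> cyl A \<sigma> \<Longrightarrow> avg A g \<tau> = avg A g \<sigma>"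
  by (simp add: avg_def Z_eq cyl_eq)

lemma avg_cong: "(\<And>\<tau>. \<tau> \<in> cyl A \<sigma> \<Longrightarrow> g \<tau> = g' \<tau>) \<Longrightarrow> avg A g \<sigma> = avg A g' \<sigma>"
  by (simp add: avg_def)

lemma avg_add: "avg A (\<lambda>\<tau>. f \<tau> + g \<tau>) \<sigma> = avg A f \<sigma> + avg A g \<sigma>"
  by (simp add: avg_def distrib_left sum.distrib add_divide_distrib)

lemma avg_diff: "avg A (\<lambda>\<tau>. f \<tau> - g \<tau>) \<sigma> = avg A f \<sigma> - avg A g \<sigma>"
  by (simp add: avg_def right_diff_distrib sum_subtractf diff_divide_distrib)

lemma avg_cmult: "avg A (\<lambda>\<tau>. c * g \<tau>) \<sigma> = c * avg A g \<sigma>"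
  by (simp add: avg_def sum_distrib_left mult_ac)

lemma avg_sum: "avg A (\<lambda>\<tau>. \<Sum>i\<in>I. g i \<tau>) \<sigma> = (\<Sum>i\<in>I. avg A (g i) \<sigma>)"
  unfolding avg_def sum_distrib_left sum.swap[of _ I] by (simp add: sum_divide_distrib)

lemma avg_const: "A \<subseteq> V \<Longrightarrow> avg A (\<lambda>_. c) \<sigma> = c"
  using Z_pos[of A \<sigma>] by (simp add: avg_def Z_def sum_distrib_right[symmetric])

lemma avg_mono:
  assumes "A \<subseteq> V" "\<And>\<tau>. \<tau> \<in> cyl A \<sigma> \<Longrightarrow> f \<tau> \<le> g \<tau>"
  shows "avg A f \<sigma> \<le> avg A g \<sigma>"
  unfolding avg_def using Z_pos[OF assms(1), of \<sigma>] assms(2) w_nonneg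
  by (intro divide_right_mono sum_mono mult_left_mono) auto

lemma avg_nonneg: "A \<subseteq> V \<Longrightarrow> (\<And>\<tau>. 0 \<le> g \<tau>) \<Longrightarrow> 0 \<le> avg A g \<sigma>"
  using avg_mono[of A \<sigma> "\<lambda>_. 0" g] avg_const[of A 0 \<sigma>] by simp

lemma avg_abs_diff_le:
  assumes "A \<subseteq> V" "\<And>\<tau>. \<tau> \<in> cyl A \<sigma> \<Longrightarrow> \<bar>f \<tau> - g \<tau>\<bar> \<le> c"
  shows "\<bar>avg A f \<sigma> - avg A g \<sigma>\<bar> \<le> c"
proof -
  have "avg A f \<sigma> - avg A g \<sigma> \<le> c"
    using avg_mono[OF assms(1), of \<sigma> "\<lambda>\<tau>. f \<tau> - g \<tau>" "\<lambda>_. c"] assms(2) avg_const[OF assms(1)]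
    by (fastforce simp: avg_diff abs_le_iff)
  moreover have "avg A g \<sigma> - avg A f \<sigma> \<le> c"
    using avg_mono[OF assms(1), of \<sigma> "\<lambda>\<tau>. g \<tau> - f \<tau>" "\<lambda>_. c"] assms(2) avg_const[OF assms(1)]
    by (fastforce simp: avg_diff abs_le_iff)
  ultimately show ?thesis by linarith
qed

text \<open>Spatial Markov property: \<open>r\<close> collects the factors of \<open>B\<close> whose
  sites avoid \<open>A\<close>, and these cannot see a change inside \<open>A\<close>.\<close>

lemma w_split:
  assumes AB: "A \<subseteq> B" "B \<subseteq> V"
  obtains r where "\<And>\<tau>. 0 \<le> r \<tau>" "\<And>\<tau>. w B \<tau> = w A \<tau> * r \<tau>" "\<And>\<tau> \<tau>'. \<tau>' \<in> cyl A \<tau> \<Longrightarrow> r \<tau>' = r \<tau>"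
proof
  let ?h = "\<lambda>\<tau> (u, v). if u \<in> D \<and> v \<in> D then h (\<tau> u) (\<tau> v) else 1"
  let ?r = "\<lambda>\<tau>. (\<Prod>e\<in>touching B - touching A. ?h \<tau> e) * (\<Prod>v\<in>B - A. k (\<tau> v))"
  have fin: "finite (touching B)" "finite B" using finA[OF AB(2)] finite_touching by auto
  have sub: "touching A \<subseteq> touching B" using AB by (auto simp: touching_def)
  fix \<tau> :: "('d \<Rightarrow> int) \<Rightarrow> 's"
  show "0 \<le> ?r \<tau>"
    by (intro mult_nonneg_nonneg prod_nonneg) (auto simp: h_nonneg k_pos less_imp_le)
  show "w B \<tau> = w A \<tau> * ?r \<tau>"
    unfolding weight_def prod.subset_diff[OF sub fin(1)] prod.subset_diff[OF AB(1) fin(2)]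
    by simp
  fix \<tau>' assume t: "\<tau>' \<in> cyl A \<tau>"
  have e1: "?h \<tau>' e = ?h \<tau> e" if "e \<in> touching B - touching A" for e
  proof -
    obtain u v where e: "e = (u, v)" by (cases e)
    then have "u \<notin> A" "v \<notin> A" using that AB(1) by (auto simp: touching_def)
    then show ?thesis using t by (simp add: e cyl_iff)
  qed
  have e2: "k (\<tau>' v) = k (\<tau> v)" if "v \<in> B - A" for v using that t by (auto simp: cyl_iff)
  show "?r \<tau>' = ?r \<tau>" by (intro arg_cong2[where f = "(*)"] prod.cong refl e1 e2)
qed

section \<open>Consistency, self-adjointness and commutation of the averages\<close>

lemma avg_pull_out:
  assumes "A \<subseteq> B"
  shows "avg A (\<lambda>\<tau>. f \<tau> * avg B g \<tau>) \<sigma> = avg A f \<sigma> * avg B g \<sigma>"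
proof -
  have "avg B g \<tau> = avg B g \<sigma>" if "\<tau> \<in> cyl A \<sigma>" for \<tau>
    using that cyl_mono[OF assms] avg_eq by blast
  then have "avg A (\<lambda>\<tau>. f \<tau> * avg B g \<tau>) \<sigma> = avg A (\<lambda>\<tau>. avg B g \<sigma> * f \<tau>) \<sigma>"
    by (intro avg_cong) (simp only: mult.commute)
  then show ?thesis by (simp add: avg_cmult)
qed

text \<open>Consistency of the Gibbs specification. Since \<open>r\<close> and \<open>Z A\<close>
  are constant on each \<open>cyl A\<close>, detailed balance
  \<open>w B \<tau> * w A \<tau>' = w A \<tau> * w B \<tau>'\<close> holds there; after exchanging
  the double sum, the inner sum normalises to 1.\<close>

lemma avg_tower:
  assumes AB: "A \<subseteq> B" "B \<subseteq> V"
  shows "avg B (avg A f) = avg B f"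
proof
  fix \<sigma> :: "('d \<Rightarrow> int) \<Rightarrow> 's"
  obtain r where r: "\<And>\<tau>. 0 \<le> r \<tau>" "\<And>\<tau>. w B \<tau> = w A \<tau> * r \<tau>" "\<And>\<tau> \<tau>'. \<tau>' \<in> cyl A \<tau> \<Longrightarrow> r \<tau>' = r \<tau>"
    using w_split[OF AB] by metis
  have AV: "A \<subseteq> V" using AB by auto
  have fin: "finite (cyl B \<sigma>)" using finA[OF AB(2)] by simp
  have dec: "(\<Sum>\<tau>'\<in>cyl A \<tau>. F \<tau>') = (\<Sum>\<tau>'\<in>cyl B \<sigma>. if \<tau>' \<in> cyl A \<tau> then F \<tau>' else 0)"
    if "\<tau> \<in> cyl B \<sigma>" for \<tau> and F :: "(('d \<Rightarrow> int) \<Rightarrow> 's) \<Rightarrow> real"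
  proof -
    have "cyl A \<tau> \<subseteq> cyl B \<sigma>" using cyl_mono[OF AB(1), of \<tau>] cyl_eq[OF that] by simp
    then have "cyl B \<sigma> \<inter> cyl A \<tau> = cyl A \<tau>" by blast
    then show ?thesis using fin by (simp add: sum.inter_restrict[symmetric])
  qed
  have "(\<Sum>\<tau>\<in>cyl B \<sigma>. w B \<tau> * avg A f \<tau>) =
      (\<Sum>\<tau>\<in>cyl B \<sigma>. \<Sum>\<tau>'\<in>cyl B \<sigma>. if \<tau>' \<in> cyl A \<tau> then w B \<tau> * (w A \<tau>' * f \<tau>') / Z A \<tau> else 0)"
    by (intro sum.cong refl)
       (auto simp: avg_def dec sum_distrib_left sum_divide_distrib intro!: sum.cong)
  also have "\<dots> = (\<Sum>\<tau>'\<in>cyl B \<sigma>. \<Sum>\<tau>\<in>cyl B \<sigma>. if \<tau> \<in> cyl A \<tau>' then w A \<tau> * (w B \<tau>' * f \<tau>' / Z A \<tau>') else 0)"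
  proof (subst sum.swap, intro sum.cong refl if_cong)
    fix \<tau> \<tau>' :: "('d \<Rightarrow> int) \<Rightarrow> 's"
    show "(\<tau>' \<in> cyl A \<tau>) = (\<tau> \<in> cyl A \<tau>')" by (rule cyl_sym)
    assume "\<tau> \<in> cyl A \<tau>'"
    then show "w B \<tau> * (w A \<tau>' * f \<tau>') / Z A \<tau> = w A \<tau> * (w B \<tau>' * f \<tau>' / Z A \<tau>')"
      using r(3)[of \<tau> \<tau>'] by (simp add: r(2) Z_eq)
  qed
  also have "\<dots> = (\<Sum>\<tau>'\<in>cyl B \<sigma>. w B \<tau>' * f \<tau>')"
  proof (intro sum.cong refl)
    fix \<tau>' assume "\<tau>' \<in> cyl B \<sigma>"
    then have "(\<Sum>\<tau>\<in>cyl B \<sigma>. if \<tau> \<in> cyl A \<tau>' then w A \<tau> * (w B \<tau>' * f \<tau>' / Z A \<tau>') else 0)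
       = (\<Sum>\<tau>\<in>cyl A \<tau>'. w A \<tau> * (w B \<tau>' * f \<tau>' / Z A \<tau>'))" by (rule dec[symmetric])
    also have "\<dots> = w B \<tau>' * f \<tau>'"
      using Z_pos[OF AV, of \<tau>'] by (subst sum_distrib_right[symmetric]) (simp add: Z_def)
    finally show "(\<Sum>\<tau>\<in>cyl B \<sigma>. if \<tau> \<in> cyl A \<tau>' then w A \<tau> * (w B \<tau>' * f \<tau>' / Z A \<tau>') else 0) = w B \<tau>' * f \<tau>'" .
  qed
  finally show "avg B (avg A f) \<sigma> = avg B f \<sigma>" by (simp add: avg_def)
qed

text \<open>For \<open>B = V\<close> this says that \<open>avg A\<close> acts as an orthogonal
  projection for the scalar product
  \<open>avg V (\<lambda>\<tau>. f \<tau> * g \<tau>)\<close>.\<close>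

lemma avg_selfadjoint:
  assumes "A \<subseteq> B" "B \<subseteq> V"
  shows "avg B (\<lambda>\<tau>. f \<tau> * avg A g \<tau>) = avg B (\<lambda>\<tau>. avg A f \<tau> * avg A g \<tau>)"
proof -
  have "avg B (\<lambda>\<tau>. f \<tau> * avg A g \<tau>) = avg B (avg A (\<lambda>\<tau>. f \<tau> * avg A g \<tau>))"
    by (simp add: avg_tower[OF assms])
  also have "avg A (\<lambda>\<tau>. f \<tau> * avg A g \<tau>) = (\<lambda>\<tau>. avg A f \<tau> * avg A g \<tau>)"
    by (simp add: avg_pull_out fun_eq_iff)
  finally show ?thesis .
qed

lemma w_cong:
  assumes "\<And>x. x \<in> A \<union> bdry A \<Longrightarrow> x \<in> D \<or> x \<in> A \<Longrightarrow> \<tau> x = \<tau>' x"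
  shows "w A \<tau> = w A \<tau>'"
proof -
  have "\<tau> u = \<tau>' u \<and> \<tau> v = \<tau>' v" if "(u, v) \<in> touching A" "u \<in> D" "v \<in> D" for u v
    using that assms adj_commute unfolding touching_def bdry_def by blast
  moreover have "\<tau> u = \<tau>' u" if "u \<in> A" for u using that assms by blast
  ultimately show ?thesis unfolding weight_def
    by (intro arg_cong2[where f = "(*)"] prod.cong) (auto split: prod.split)
qed

definition far :: "('d \<Rightarrow> int) set \<Rightarrow> ('d \<Rightarrow> int) set \<Rightarrow> bool" where
  "far A B \<longleftrightarrow> A \<inter> B = {} \<and> A \<inter> bdry B = {} \<and> B \<inter> bdry A = {}"

lemma far_sym: "far A B \<Longrightarrow> far B A"
  by (auto simp: far_def)

text \<open>Regions that neither meet nor touch do not see each other's spins, so both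
  normalisations factor out and the iterated average takes a form symmetric in \<open>A\<close> and
  \<open>B\<close>; commutation is read off from it.\<close>

lemma avg_avg_far:
  assumes far: "far A B" and AB: "A \<subseteq> V" "B \<subseteq> V"
  shows "avg A (avg B f) \<sigma> =
    (\<Sum>\<tau>\<in>cyl (A \<union> B) \<sigma>. w A \<tau> * w B \<tau> * f \<tau>) / (Z A \<sigma> * Z B \<sigma>)"
proof -
  \<comment> \<open>A pair of successive updates is determined by its second component: resetting
    \<open>B\<close> to \<sigma> recovers the first.\<close>
  have bij: "bij_betw snd (Sigma (cyl A \<sigma>) (cyl B)) (cyl (A \<union> B) \<sigma>)"
    using far
    by (intro bij_betw_byWitness[where f' = "\<lambda>\<tau>'. ((\<lambda>x. if x \<in> B then \<sigma> x else \<tau>' x), \<tau>')"])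
       (auto simp: cyl_def far_def fun_eq_iff)
  have wA: "w A \<tau>' = w A \<tau>" if "\<tau>' \<in> cyl B \<tau>" for \<tau> \<tau>' :: "('d \<Rightarrow> int) \<Rightarrow> 's"
    using that far by (intro w_cong) (auto simp: cyl_iff far_def)
  have swap: "bij_betw (\<lambda>\<tau>' x. if x \<in> B then \<tau>' x else \<sigma> x) (cyl B \<tau>) (cyl B \<sigma>)" for \<tau>
    by (rule bij_betw_byWitness[where f' = "\<lambda>\<tau>' x. if x \<in> B then \<tau>' x else \<tau> x"])
       (auto simp: cyl_def fun_eq_iff)
  have ZB: "Z B \<tau> = Z B \<sigma>" if t: "\<tau> \<in> cyl A \<sigma>" for \<tau>
  proof -
    have "Z B \<tau> = (\<Sum>\<tau>'\<in>cyl B \<tau>. w B (\<lambda>x. if x \<in> B then \<tau>' x else \<sigma> x))"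
      unfolding Z_def
    proof (intro sum.cong refl)
      fix \<tau>' assume "\<tau>' \<in> cyl B \<tau>"
      then show "w B \<tau>' = w B (\<lambda>x. if x \<in> B then \<tau>' x else \<sigma> x)"
        using t far by (intro w_cong) (auto simp: cyl_iff far_def)
    qed
    also have "\<dots> = Z B \<sigma>" unfolding Z_def by (rule sum.reindex_bij_betw[OF swap])
    finally show ?thesis .
  qed
  have "(\<Sum>\<tau>\<in>cyl A \<sigma>. w A \<tau> * avg B f \<tau>) =
     (\<Sum>\<tau>\<in>cyl A \<sigma>. \<Sum>\<tau>'\<in>cyl B \<tau>. w A \<tau>' * w B \<tau>' * f \<tau>' / Z B \<sigma>)"
  proof (intro sum.cong refl)
    fix \<tau> assume t: "\<tau> \<in> cyl A \<sigma>"
    have "w A \<tau> * avg B f \<tau> = (\<Sum>\<tau>'\<in>cyl B \<tau>. w A \<tau> * w B \<tau>' * f \<tau>' / Z B \<sigma>)"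
      unfolding avg_def ZB[OF t] by (simp add: sum_distrib_left sum_divide_distrib mult.assoc)
    also have "\<dots> = (\<Sum>\<tau>'\<in>cyl B \<tau>. w A \<tau>' * w B \<tau>' * f \<tau>' / Z B \<sigma>)"
      by (intro sum.cong refl) (simp only: wA)
    finally show "w A \<tau> * avg B f \<tau> = (\<Sum>\<tau>'\<in>cyl B \<tau>. w A \<tau>' * w B \<tau>' * f \<tau>' / Z B \<sigma>)" .
  qed
  also have "\<dots> = (\<Sum>p\<in>Sigma (cyl A \<sigma>) (cyl B). w A (snd p) * w B (snd p) * f (snd p) / Z B \<sigma>)"
    using finA[OF AB(1)] finA[OF AB(2)] by (simp add: sum.Sigma case_prod_unfold)
  also have "\<dots> = (\<Sum>\<tau>\<in>cyl (A \<union> B) \<sigma>. w A \<tau> * w B \<tau> * f \<tau> / Z B \<sigma>)"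
    by (rule sum.reindex_bij_betw[OF bij])
  finally show ?thesis by (simp add: avg_def sum_divide_distrib mult.commute)
qed

lemma avg_commute: "far A B \<Longrightarrow> A \<subseteq> V \<Longrightarrow> B \<subseteq> V \<Longrightarrow> avg A (avg B f) = avg B (avg A f)"
  by (rule ext) (simp add: avg_avg_far far_sym Un_commute mult_ac)

lemma energy_eq:
  assumes "A \<subseteq> B" "B \<subseteq> V"
  shows "avg B (\<lambda>\<tau>. (f \<tau> - avg A f \<tau>)\<^sup>2) \<sigma> = avg B (\<lambda>\<tau>. (f \<tau>)\<^sup>2) \<sigma> - avg B (\<lambda>\<tau>. (avg A f \<tau>)\<^sup>2) \<sigma>"
proof -
  have "avg B (\<lambda>\<tau>. (f \<tau> - avg A f \<tau>)\<^sup>2) \<sigma> =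
     avg B (\<lambda>\<tau>. ((f \<tau>)\<^sup>2 - 2 * (f \<tau> * avg A f \<tau>)) + avg A f \<tau> * avg A f \<tau>) \<sigma>"
    by (simp add: power2_eq_square algebra_simps)
  also have "\<dots> = avg B (\<lambda>\<tau>. (f \<tau>)\<^sup>2) \<sigma> - 2 * avg B (\<lambda>\<tau>. f \<tau> * avg A f \<tau>) \<sigma> + avg B (\<lambda>\<tau>. avg A f \<tau> * avg A f \<tau>) \<sigma>"
    by (simp only: avg_add avg_diff avg_cmult)
  finally show ?thesis unfolding avg_selfadjoint[OF assms, of f f] by (simp add: power2_eq_square)
qed

text \<open>The mean minimises the mean squared deviation, so any centre \<open>c\<close> may be
  used. The bound is asked only where the weight is positive, which is where connectivity is
  available under hard constraints.\<close>

lemma variance_le: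
  assumes A: "A \<subseteq> V"
    and M: "\<And>\<tau>. \<tau> \<in> cyl A \<sigma> \<Longrightarrow> 0 < w A \<tau> \<Longrightarrow> (f \<tau> - c)\<^sup>2 \<le> M"
  shows "avg A (\<lambda>\<tau>. (f \<tau>)\<^sup>2) \<sigma> - (avg A f \<sigma>)\<^sup>2 \<le> M"
proof -
  have "avg A (\<lambda>\<tau>. (f \<tau> - c)\<^sup>2) \<sigma> = avg A (\<lambda>\<tau>. ((f \<tau>)\<^sup>2 - (2 * c) * f \<tau>) + c\<^sup>2) \<sigma>"
    by (simp add: power2_eq_square algebra_simps)
  also have "\<dots> = avg A (\<lambda>\<tau>. (f \<tau>)\<^sup>2) \<sigma> - 2 * c * avg A f \<sigma> + c\<^sup>2"
    by (simp only: avg_add avg_diff avg_cmult avg_const[OF A])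
  finally have "avg A (\<lambda>\<tau>. (f \<tau>)\<^sup>2) \<sigma> - (avg A f \<sigma>)\<^sup>2 = avg A (\<lambda>\<tau>. (f \<tau> - c)\<^sup>2) \<sigma> - (avg A f \<sigma> - c)\<^sup>2"
    by (simp add: power2_eq_square algebra_simps)
  also have "\<dots> \<le> avg A (\<lambda>\<tau>. (f \<tau> - c)\<^sup>2) \<sigma>" by simp
  also have "\<dots> \<le> avg A (\<lambda>_. M) \<sigma>"
    unfolding avg_def
  proof (intro divide_right_mono sum_mono)
    fix \<tau> assume t: "\<tau> \<in> cyl A \<sigma>"
    show "w A \<tau> * (f \<tau> - c)\<^sup>2 \<le> w A \<tau> * M"
      using M[OF t] w_nonneg[of A \<tau>] by (cases "w A \<tau> = 0") (auto intro: mult_left_mono)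
  qed (use Z_pos[OF A] in \<open>auto simp: less_imp_le\<close>)
  finally show ?thesis by (simp add: avg_const[OF A])
qed

text \<open>Every atom has conditional mass at least \<open>p\<close>, so the energy
  \<open>E\<close> bounds a single-site deviation by the square root of \<open>E / p\<close>, and a
  step within the support changes \<open>f\<close> by at most twice that. A path needs at most as
  many steps as there are pairs among at most \<open>N\<close> configurations, that is
  \<open>N * N\<close>; squaring gives \<open>4 * N ^ 4 / p\<close>.\<close>

lemma local_poincare:
  assumes A: "A \<subseteq> V" and p: "0 < p"
    and lower: "\<And>\<tau>. \<tau> \<in> cyl A \<sigma> \<Longrightarrow> 0 < w A \<tau> \<Longrightarrow> p * Z A \<sigma> \<le> w A \<tau>"
    and S: "S = {\<tau> \<in> cyl A \<sigma>. 0 < w A \<tau>}"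
    and conn: "\<And>\<tau> \<tau>'. \<tau> \<in> S \<Longrightarrow> \<tau>' \<in> S \<Longrightarrow>
      (\<tau>, \<tau>') \<in> {(\<tau>, \<tau>'). \<tau> \<in> S \<and> \<tau>' \<in> S \<and> (\<exists>x\<in>A. \<tau>' \<in> cyl {x} \<tau>)}\<^sup>*"
  shows "avg A (\<lambda>\<tau>. (f \<tau>)\<^sup>2) \<sigma> - (avg A f \<sigma>)\<^sup>2 \<le>
    4 * real (CARD('s) ^ card A) ^ 4 / p * (\<Sum>x\<in>A. avg A (\<lambda>\<tau>. (f \<tau> - avg {x} f \<tau>)\<^sup>2) \<sigma>)"
proof -
  define R where "R = {(\<tau>, \<tau>'). \<tau> \<in> S \<and> \<tau>' \<in> S \<and> (\<exists>x\<in>A. \<tau>' \<in> cyl {x} \<tau>)}"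
  define E where "E = (\<Sum>x\<in>A. avg A (\<lambda>\<tau>. (f \<tau> - avg {x} f \<tau>)\<^sup>2) \<sigma>)"
  define N where "N = CARD('s) ^ card A"
  note fA = finA[OF A]
  have finS: "finite S" and cS: "card S \<le> N"
    using fA card_mono[of "cyl A \<sigma>" S] by (auto simp: S N_def card_cyl)
  have RS: "R \<subseteq> S \<times> S" by (auto simp: R_def)
  have finR: "finite R" using finite_subset[OF RS] finS by auto
  have "card R \<le> card S * card S" using card_mono[OF _ RS] finS by (simp add: card_cartesian_product)
  also have "\<dots> \<le> N * N" using cS by (intro mult_mono) auto
  finally have cR: "card R \<le> N * N" .
  have E0: "0 \<le> E" unfolding E_def by (intro sum_nonneg avg_nonneg A) auto
  define e where "e = sqrt (E / p)"
  have e0: "0 \<le> e" using E0 p by (simp add: e_def)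
  have dev: "\<bar>f \<tau> - avg {x} f \<tau>\<bar> \<le> e" if t: "\<tau> \<in> S" and x: "x \<in> A" for \<tau> x
  proof -
    let ?d = "\<lambda>\<tau>. (f \<tau> - avg {x} f \<tau>)\<^sup>2"
    have tc: "\<tau> \<in> cyl A \<sigma>" "0 < w A \<tau>" using t by (auto simp: S)
    have "p * Z A \<sigma> * ?d \<tau> \<le> w A \<tau> * ?d \<tau>"
      using lower[OF tc] by (intro mult_right_mono) auto
    also have "\<dots> \<le> (\<Sum>\<tau>\<in>cyl A \<sigma>. w A \<tau> * ?d \<tau>)"
      using tc fA w_nonneg by (intro member_le_sum) auto
    also have "\<dots> = Z A \<sigma> * avg A ?d \<sigma>" using Z_pos[OF A, of \<sigma>] by (simp add: avg_def)
    finally have "p * ?d \<tau> \<le> avg A ?d \<sigma>" using Z_pos[OF A, of \<sigma>] by (simp add: mult_ac)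
    also have "\<dots> \<le> E"
      unfolding E_def using fA x by (intro member_le_sum[of x A "\<lambda>x. avg A (\<lambda>\<tau>. (f \<tau> - avg {x} f \<tau>)\<^sup>2) \<sigma>"] avg_nonneg A) auto
    finally have "?d \<tau> \<le> E / p" using p by (simp add: field_simps)
    then show ?thesis unfolding e_def using real_sqrt_le_mono by fastforce
  qed
  have step: "\<bar>f \<tau> - f \<tau>'\<bar> \<le> 2 * e" if r: "(\<tau>, \<tau>') \<in> R" for \<tau> \<tau>'
  proof -
    obtain x where x: "x \<in> A" "\<tau>' \<in> cyl {x} \<tau>" "\<tau> \<in> S" "\<tau>' \<in> S" using r by (auto simp: R_def)
    have "avg {x} f \<tau>' = avg {x} f \<tau>" by (rule avg_eq[OF x(2)])
    then show ?thesis using dev[OF x(3,1)] dev[OF x(4,1)] by linarith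
  qed
  have path: "\<bar>f \<tau> - f \<tau>'\<bar> \<le> real n * (2 * e)" if "(\<tau>, \<tau>') \<in> R ^^ n" for n \<tau> \<tau>'
    using that
  proof (induction n arbitrary: \<tau>')
    case (Suc n)
    then obtain \<rho> where r: "(\<tau>, \<rho>) \<in> R ^^ n" "(\<rho>, \<tau>') \<in> R" by auto
    show ?case using Suc.IH[OF r(1)] step[OF r(2)] by (simp add: algebra_simps)
  qed simp
  have diff: "(f \<tau> - f \<tau>')\<^sup>2 \<le> 4 * real N ^ 4 * (E / p)" if t: "\<tau> \<in> S" "\<tau>' \<in> S" for \<tau> \<tau>'
  proof -
    have "(\<tau>, \<tau>') \<in> R\<^sup>*" using conn[OF t] by (simp add: R_def)
    then obtain n where n: "n \<le> card R" "(\<tau>, \<tau>') \<in> R ^^ n"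
      unfolding rtrancl_finite_eq_relpow[OF finR] by auto
    have "\<bar>f \<tau> - f \<tau>'\<bar> \<le> real n * (2 * e)" by (rule path[OF n(2)])
    also have "\<dots> \<le> real (N * N) * (2 * e)"
      using n(1) cR e0 by (intro mult_right_mono of_nat_mono) auto
    finally have "\<bar>f \<tau> - f \<tau>'\<bar>\<^sup>2 \<le> (real (N * N) * (2 * e))\<^sup>2" by (intro power_mono) auto
    also have "\<dots> = 4 * real N ^ 4 * e\<^sup>2" by (simp add: power_mult_distrib power2_eq_square power4_eq_xxxx)
    also have "e\<^sup>2 = E / p" using E0 p by (simp add: e_def)
    finally show ?thesis by simp
  qed
  obtain \<tau>0 where t0: "\<tau>0 \<in> S" using ex_pos[OF A, of \<sigma>] by (auto simp: S)
  have "avg A (\<lambda>\<tau>. (f \<tau>)\<^sup>2) \<sigma> - (avg A f \<sigma>)\<^sup>2 \<le> 4 * real N ^ 4 * (E / p)"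
  proof (rule variance_le[OF A])
    fix \<tau> assume "\<tau> \<in> cyl A \<sigma>" "0 < w A \<tau>"
    then have "\<tau> \<in> S" by (simp add: S)
    then show "(f \<tau> - f \<tau>0)\<^sup>2 \<le> 4 * real N ^ 4 * (E / p)" by (rule diff[OF _ t0])
  qed
  then show ?thesis by (simp add: E_def N_def)
qed

section \<open>Simultaneous updates on separated tiles\<close>

definition scan :: "('d \<Rightarrow> int) set list \<Rightarrow> ((('d \<Rightarrow> int) \<Rightarrow> 's) \<Rightarrow> real) \<Rightarrow> (('d \<Rightarrow> int) \<Rightarrow> 's) \<Rightarrow> real" where
  "scan Qs g = foldr avg Qs g"

lemma scan_simps [simp]: "scan [] g = g" "scan (Q # Qs) g = avg Q (scan Qs g)"
  by (simp_all add: scan_def)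

text \<open>Distance at least 2 makes the updates of distinct tiles commute. The threshold 3
  moreover ensures that a boundary site of one tile is neither a member nor a boundary site of
  another.\<close>

definition tiles :: "('d \<Rightarrow> int) set list \<Rightarrow> bool" where
  "tiles Qs \<longleftrightarrow> distinct Qs \<and> (\<forall>Q\<in>set Qs. Q \<subseteq> V) \<and>
     (\<forall>Q\<in>set Qs. \<forall>Q'\<in>set Qs. Q \<noteq> Q' \<longrightarrow> (\<forall>x\<in>Q. \<forall>y\<in>Q'. 3 \<le> l1dist x y))"

lemma tiles_Cons: "tiles (Q # Qs) \<Longrightarrow> tiles Qs"
  by (simp add: tiles_def)

lemma tiles_sub: "tiles Qs \<Longrightarrow> Q \<in> set Qs \<Longrightarrow> Q \<subseteq> V"
  by (simp add: tiles_def)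

lemma tiles_far: "tiles Qs \<Longrightarrow> Q \<in> set Qs \<Longrightarrow> Q' \<in> set Qs \<Longrightarrow> Q \<noteq> Q' \<Longrightarrow> far Q Q'"
  unfolding tiles_def far_def bdry_def adj_def
  by (fastforce simp: l1dist_commute)

lemma far_mono:
  assumes "far A B" "A' \<subseteq> A"
  shows "far A' B"
proof -
  have "B \<inter> bdry A' \<subseteq> B \<inter> (bdry A \<union> A)" using assms(2) by (auto simp: bdry_def)
  then show ?thesis using assms by (auto simp: far_def)
qed

lemma scan_diff: "scan Qs (\<lambda>\<tau>. f \<tau> - g \<tau>) = (\<lambda>\<tau>. scan Qs f \<tau> - scan Qs g \<tau>)"
  by (induction Qs) (auto simp: avg_diff)

lemma scan_avg_commute:
  assumes "\<And>Q. Q \<in> set Qs \<Longrightarrow> far B Q \<and> Q \<subseteq> V" "B \<subseteq> V"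
  shows "avg B (scan Qs g) = scan Qs (avg B g)"
  using assms by (induction Qs) (auto simp: avg_commute[of B])

lemma scan_remove1:
  assumes "tiles Qs" "Q \<in> set Qs"
  shows "scan Qs g = avg Q (scan (remove1 Q Qs) g)"
  using assms
proof (induction Qs)
  case (Cons Q' Qs)
  show ?case
  proof (cases "Q' = Q")
    case False
    then have "scan Qs g = avg Q (scan (remove1 Q Qs) g)"
      using Cons tiles_Cons by auto
    moreover have "far Q' Q" using tiles_far[OF Cons.prems(1), of Q' Q] Cons.prems(2) False by auto
    ultimately show ?thesis
      using False avg_commute[of Q' Q] tiles_sub[OF Cons.prems(1)] Cons.prems(2) by auto
  qed simp
qed simp

text \<open>The average over a part of a tile commutes with the other tiles, so it can be moved next
  to the average over its own tile, which absorbs it.\<close>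

lemma scan_restrict_absorb:
  assumes "tiles Qs"
  shows "scan Qs (scan (map ((\<inter>) A) Qs) f) = scan Qs f"
  using assms
proof (induction Qs)
  case (Cons Q Qs)
  have "scan Qs (avg (A \<inter> Q) (scan (map ((\<inter>) A) Qs) f)) = avg (A \<inter> Q) (scan Qs (scan (map ((\<inter>) A) Qs) f))"
  proof (rule scan_avg_commute[symmetric])
    fix Q' assume Q': "Q' \<in> set Qs"
    then have "Q \<noteq> Q'" using Cons.prems by (auto simp: tiles_def)
    then have "far Q Q'" using tiles_far[OF Cons.prems, of Q Q'] Q' by auto
    then show "far (A \<inter> Q) Q' \<and> Q' \<subseteq> V" using far_mono tiles_sub[OF Cons.prems, of Q'] Q' by auto
  qed (use tiles_sub[OF Cons.prems, of Q] in auto)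
  then show ?case
    using Cons.IH[OF tiles_Cons[OF Cons.prems]] tiles_sub[OF Cons.prems, of Q]
    by (simp add: avg_tower)
qed simp

lemma avg_scan_absorb:
  assumes "A \<subseteq> V"
  shows "avg A (scan (map ((\<inter>) A) Qs) f) = avg A f"
  using assms by (induction Qs) (auto simp: avg_tower)

definition nrm :: "(('d \<Rightarrow> int) \<Rightarrow> 's) \<Rightarrow> ((('d \<Rightarrow> int) \<Rightarrow> 's) \<Rightarrow> real) \<Rightarrow> real" where
  "nrm \<sigma> f = avg V (\<lambda>\<tau>. (f \<tau>)\<^sup>2) \<sigma>"

lemma nrm_nonneg: "0 \<le> nrm \<sigma> f"
  unfolding nrm_def by (rule avg_nonneg) auto

lemma nrm_drop: "A \<subseteq> V \<Longrightarrow> nrm \<sigma> (\<lambda>\<tau>. f \<tau> - avg A f \<tau>) = nrm \<sigma> f - nrm \<sigma> (avg A f)"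
  unfolding nrm_def by (rule energy_eq) auto

lemma nrm_avg_le: "A \<subseteq> V \<Longrightarrow> nrm \<sigma> (avg A f) \<le> nrm \<sigma> f"
  using nrm_drop[of A \<sigma> f] nrm_nonneg[of \<sigma> "\<lambda>\<tau>. f \<tau> - avg A f \<tau>"] by simp

lemma nrm_scan_le: "(\<And>Q. Q \<in> set Qs \<Longrightarrow> Q \<subseteq> V) \<Longrightarrow> nrm \<sigma> (scan Qs f) \<le> nrm \<sigma> f"
proof (induction Qs)
  case (Cons Q Qs)
  then show ?case using nrm_avg_le[of Q \<sigma> "scan Qs f"] by force
qed simp

lemma nrm_avg_antimono:
  assumes "A \<subseteq> B" "B \<subseteq> V"
  shows "nrm \<sigma> (avg B f) \<le> nrm \<sigma> (avg A f)"
  using nrm_avg_le[OF assms(2), of \<sigma> "avg A f"] by (simp add: avg_tower[OF assms])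

text \<open>Both products telescope, so neither the number of tiles nor that of blocks enters the
  constant. The next tile \<open>Q\<close> acts on \<open>scan Qs f\<close>, which equals
  \<open>scan Qs\<close> applied to the product \<open>?R i\<close> of the averages over the parts
  \<open>A i \<inter> Q'\<close>. The average over \<open>A i \<inter> Q\<close> commutes with the
  contraction \<open>scan Qs\<close>, so it loses no more there than it does directly after
  \<open>?R i\<close>. The losses of \<open>?R i\<close> add up to at most the loss of
  \<open>avg (A i)\<close>, which absorbs all its factors.\<close>

lemma scan_drop_le:
  fixes n :: nat
  assumes t: "tiles Qs" and A: "\<And>i. i < n \<Longrightarrow> A i \<subseteq> V" and C: "0 \<le> C"
    and loc: "\<And>Q f. Q \<in> set Qs \<Longrightarrow>
      nrm \<sigma> f - nrm \<sigma> (avg Q f) \<le> C * (\<Sum>i<n. nrm \<sigma> f - nrm \<sigma> (avg (A i \<inter> Q) f))"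
  shows "nrm \<sigma> f - nrm \<sigma> (scan Qs f) \<le> C * (\<Sum>i<n. nrm \<sigma> f - nrm \<sigma> (avg (A i) f))"
proof -
  let ?R = "\<lambda>i Qs. scan (map ((\<inter>) (A i)) Qs)"
  have "nrm \<sigma> f - nrm \<sigma> (scan Qs f) \<le> C * (\<Sum>i<n. nrm \<sigma> f - nrm \<sigma> (?R i Qs f))"
    using t loc
  proof (induction Qs)
    case (Cons Q Qs)
    have QV: "Q \<subseteq> V" using tiles_sub[OF Cons.prems(1), of Q] by simp
    have step: "nrm \<sigma> (scan Qs f) - nrm \<sigma> (avg (A i \<inter> Q) (scan Qs f)) \<le>
        nrm \<sigma> (?R i Qs f) - nrm \<sigma> (avg (A i \<inter> Q) (?R i Qs f))" for i
    proof -
      let ?B = "A i \<inter> Q" and ?g = "?R i Qs f"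
      have B: "?B \<subseteq> V" using QV by auto
      have abs: "scan Qs f = scan Qs ?g"
        using scan_restrict_absorb[OF tiles_Cons[OF Cons.prems(1)]] by simp
      have com: "avg ?B (scan Qs ?g) = scan Qs (avg ?B ?g)"
      proof (rule scan_avg_commute[OF _ B])
        fix Q' assume Q': "Q' \<in> set Qs"
        then have "Q \<noteq> Q'" using Cons.prems by (auto simp: tiles_def)
        then have "far Q Q'" using tiles_far[OF Cons.prems(1), of Q Q'] Q' by auto
        then show "far ?B Q' \<and> Q' \<subseteq> V" using far_mono tiles_sub[OF Cons.prems(1), of Q'] Q' by auto
      qed
      have "nrm \<sigma> (scan Qs f) - nrm \<sigma> (avg ?B (scan Qs f)) = nrm \<sigma> (\<lambda>\<tau>. scan Qs ?g \<tau> - avg ?B (scan Qs ?g) \<tau>)"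
        unfolding abs by (rule nrm_drop[OF B, symmetric])
      also have "\<dots> = nrm \<sigma> (scan Qs (\<lambda>\<tau>. ?g \<tau> - avg ?B ?g \<tau>))"
        unfolding com scan_diff ..
      also have "\<dots> \<le> nrm \<sigma> (\<lambda>\<tau>. ?g \<tau> - avg ?B ?g \<tau>)"
        by (rule nrm_scan_le) (use tiles_sub[OF Cons.prems(1)] in auto)
      also have "\<dots> = nrm \<sigma> ?g - nrm \<sigma> (avg ?B ?g)" by (rule nrm_drop[OF B])
      finally show ?thesis .
    qed
    have "nrm \<sigma> f - nrm \<sigma> (scan (Q # Qs) f) =
        (nrm \<sigma> f - nrm \<sigma> (scan Qs f)) + (nrm \<sigma> (scan Qs f) - nrm \<sigma> (avg Q (scan Qs f)))" by simp
    also have "\<dots> \<le> C * (\<Sum>i<n. nrm \<sigma> f - nrm \<sigma> (?R i Qs f)) +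
        C * (\<Sum>i<n. nrm \<sigma> (scan Qs f) - nrm \<sigma> (avg (A i \<inter> Q) (scan Qs f)))"
      using Cons.IH[OF tiles_Cons[OF Cons.prems(1)]] Cons.prems(2) by (intro add_mono) auto
    also have "\<dots> \<le> C * (\<Sum>i<n. nrm \<sigma> f - nrm \<sigma> (?R i Qs f)) +
        C * (\<Sum>i<n. nrm \<sigma> (?R i Qs f) - nrm \<sigma> (avg (A i \<inter> Q) (?R i Qs f)))"
      using C step by (intro add_left_mono mult_left_mono sum_mono) auto
    also have "\<dots> = C * (\<Sum>i<n. nrm \<sigma> f - nrm \<sigma> (?R i (Q # Qs) f))"
      by (simp add: distrib_left[symmetric] sum.distrib[symmetric])
    finally show ?case .
  qed simp
  also have "\<dots> \<le> C * (\<Sum>i<n. nrm \<sigma> f - nrm \<sigma> (avg (A i) f))"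
  proof (intro mult_left_mono sum_mono C)
    fix i assume "i \<in> {..<n}"
    then have "A i \<subseteq> V" using A by auto
    then show "nrm \<sigma> f - nrm \<sigma> (?R i Qs f) \<le> nrm \<sigma> f - nrm \<sigma> (avg (A i) f)"
      using nrm_avg_le[of "A i" \<sigma> "?R i Qs f"] by (simp add: avg_scan_absorb)
  qed
  finally show ?thesis .
qed

end

section \<open>Contraction of the oscillations\<close>

text \<open>A sequence with \<open>N s ^ 2 \<le> N (s - 1) * N (s + 1)\<close> has non-decreasing ratios, so the exponential
  rate of decay controls already the first ratio.\<close>

lemma log_convex_first_ratio:
  fixes N :: "nat \<Rightarrow> real"
  assumes nonneg: "\<And>s. 0 \<le> N s"
    and conv: "\<And>s. (N (Suc s))\<^sup>2 \<le> N s * N (Suc (Suc s))"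
    and decay: "\<And>s. N s \<le> K * q ^ s" and q: "0 < q"
  shows "N 1 \<le> q * N 0"
proof (rule ccontr)
  assume less: "\<not> N 1 \<le> q * N 0"
  have N0: "0 < N 0"
  proof (rule ccontr)
    assume "\<not> 0 < N 0"
    then have "N 0 = 0" using nonneg[of 0] by simp
    then have "N 1 = 0" using conv[of 0] by simp
    then show False using less \<open>N 0 = 0\<close> by simp
  qed
  have N1: "0 < N 1" using less mult_pos_pos[OF q N0] by linarith
  have ratio: "N 1 * N s \<le> N 0 * N (Suc s) \<and> 0 < N s" for s
  proof (induction s)
    case (Suc s)
    have pos: "0 < N (Suc s)"
      using mult_pos_pos[OF N1, of "N s"] Suc.IH N0 by (metis less_le_trans zero_less_mult_pos)
    have "N 1 * N (Suc s) * N s = N 1 * N s * N (Suc s)" by simp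
    also have "\<dots> \<le> N 0 * N (Suc s) * N (Suc s)"
      using Suc.IH pos by (intro mult_right_mono) auto
    also have "\<dots> = N 0 * (N (Suc s))\<^sup>2" by (simp add: power2_eq_square)
    also have "\<dots> \<le> N 0 * (N s * N (Suc (Suc s)))" using conv N0 by (intro mult_left_mono) auto
    finally have "N 1 * N (Suc s) * N s \<le> N 0 * N (Suc (Suc s)) * N s" by (simp add: mult_ac)
    then show ?case using Suc.IH pos by (simp add: mult_le_cancel_right)
  qed (use N0 in simp)
  define \<rho> where "\<rho> = N 1 / N 0"
  have \<rho>: "q < \<rho>" using less N0 by (simp add: \<rho>_def field_simps)
  have geo: "N 0 * \<rho> ^ s \<le> N s" for s
  proof (induction s)
    case (Suc s)
    have "N 0 * \<rho> ^ Suc s = \<rho> * (N 0 * \<rho> ^ s)" by simp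
    also have "\<dots> \<le> \<rho> * N s" using Suc.IH q \<rho> by (intro mult_left_mono) auto
    also have "\<dots> \<le> N (Suc s)" using ratio[of s] N0 by (simp add: \<rho>_def field_simps)
    finally show ?case .
  qed simp
  have "1 < \<rho> / q" using \<rho> q by simp
  then obtain s where s: "K / N 0 < (\<rho> / q) ^ s" using real_arch_pow by blast
  have "N 0 * \<rho> ^ s \<le> K * q ^ s" using geo[of s] decay[of s] by linarith
  then have "(\<rho> / q) ^ s \<le> K / N 0" using N0 q by (simp add: field_simps power_divide)
  then show False using s by simp
qed

section \<open>Single-site oscillations under averages and tilings\<close>

context spin_field
begin

text \<open>The oscillation is taken over all configurations agreeing with \<open>\<sigma>0\<close>
  off \<open>V\<close>, also those of weight zero, so that any two of them are joined by changing
  one site at a time.\<close>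

definition gb :: "(('d \<Rightarrow> int) \<Rightarrow> 's) \<Rightarrow> ('d \<Rightarrow> int) set \<Rightarrow> ((('d \<Rightarrow> int) \<Rightarrow> 's) \<Rightarrow> real) \<Rightarrow> real \<Rightarrow> bool" where
  "gb \<sigma>0 S g l \<longleftrightarrow> (\<forall>x\<in>S. \<forall>\<sigma>\<in>cyl V \<sigma>0. \<forall>s. \<bar>g \<sigma> - g (\<sigma>(x := s))\<bar> \<le> l)"

lemma gbD: "gb \<sigma>0 S g l \<Longrightarrow> x \<in> S \<Longrightarrow> \<sigma> \<in> cyl V \<sigma>0 \<Longrightarrow> \<bar>g \<sigma> - g (\<sigma>(x := s))\<bar> \<le> l"
  by (simp add: gb_def)

lemma gb_mono: "gb \<sigma>0 S g l \<Longrightarrow> S' \<subseteq> S \<Longrightarrow> l \<le> l' \<Longrightarrow> gb \<sigma>0 S' g l'"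
  unfolding gb_def by (meson order_trans subsetD)

lemma gb_path:
  assumes "finite A" "A \<subseteq> V" "gb \<sigma>0 A g l" "\<sigma> \<in> cyl V \<sigma>0" "\<tau> \<in> cyl A \<sigma>"
  shows "\<bar>g \<tau> - g \<sigma>\<bar> \<le> real (card A) * l"
  using assms
proof (induction A arbitrary: \<tau> rule: finite_induct)
  case empty
  then have "\<tau> = \<sigma>" by (auto simp: cyl_iff)
  then show ?case by simp
next
  case (insert x A)
  let ?\<rho> = "\<tau>(x := \<sigma> x)"
  have r: "?\<rho> \<in> cyl A \<sigma>" using insert.prems(4) by (auto simp: cyl_iff)
  then have rV: "?\<rho> \<in> cyl V \<sigma>0" using insert.prems by (auto simp: cyl_iff)
  have "\<bar>g ?\<rho> - g (?\<rho>(x := \<tau> x))\<bar> \<le> l" by (rule gbD[OF insert.prems(2) _ rV]) simp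
  moreover have "\<bar>g ?\<rho> - g \<sigma>\<bar> \<le> real (card A) * l"
    using insert.prems by (intro insert.IH r) (auto simp: gb_def)
  moreover have "?\<rho>(x := \<tau> x) = \<tau>" by simp
  ultimately show ?case using insert.hyps by (simp add: algebra_simps)
qed

lemma bij_betw_upd_cyl:
  assumes "x \<notin> A"
  shows "bij_betw (\<lambda>\<tau>. \<tau>(x := s)) (cyl A \<sigma>) (cyl A (\<sigma>(x := s)))"
  by (rule bij_betw_byWitness[where f' = "\<lambda>\<tau>. \<tau>(x := \<sigma> x)"]) (use assms in \<open>auto simp: cyl_def fun_eq_iff\<close>)

lemma avg_upd:
  assumes x: "x \<notin> Q" "x \<notin> bdry Q"
  shows "avg Q g (\<sigma>(x := s)) = avg Q (\<lambda>\<tau>. g (\<tau>(x := s))) \<sigma>"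
proof -
  have w: "w Q (\<tau>(x := s)) = w Q \<tau>" for \<tau>
    by (rule w_cong) (use x in auto)
  have "Z Q (\<sigma>(x := s)) = Z Q \<sigma>"
    unfolding Z_def sum.reindex_bij_betw[OF bij_betw_upd_cyl[OF x(1)], symmetric] w ..
  then show ?thesis
    unfolding avg_def sum.reindex_bij_betw[OF bij_betw_upd_cyl[OF x(1)], symmetric] w by simp
qed

lemma gb_avg_far:
  assumes "x \<in> V" "x \<notin> Q" "x \<notin> bdry Q" "Q \<subseteq> V" "gb \<sigma>0 {x} g l"
  shows "gb \<sigma>0 {x} (avg Q g) l"
  unfolding gb_def
proof (intro ballI allI)
  fix y \<sigma> s assume y: "y \<in> {x}" and s: "\<sigma> \<in> cyl V \<sigma>0"
  have "\<bar>avg Q g \<sigma> - avg Q (\<lambda>\<tau>. g (\<tau>(x := s))) \<sigma>\<bar> \<le> l"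
  proof (rule avg_abs_diff_le[OF assms(4)])
    fix \<tau> assume "\<tau> \<in> cyl Q \<sigma>"
    then have "\<tau> \<in> cyl V \<sigma>0" using s assms(4) by (auto simp: cyl_iff)
    then show "\<bar>g \<tau> - g (\<tau>(x := s))\<bar> \<le> l" using gbD[OF assms(5)] by simp
  qed
  then show "\<bar>avg Q g \<sigma> - avg Q g (\<sigma>(y := s))\<bar> \<le> l" using y by (simp add: avg_upd assms)
qed

lemma gb_avg_inside: "x \<in> Q \<Longrightarrow> gb \<sigma>0 {x} (avg Q g) 0"
  by (auto simp: gb_def cyl_iff intro!: avg_eq)

text \<open>Dual form of a total variation bound: \<open>H\<close> is a test function of the spins
  of \<open>Q\<close> at distance more than \<open>m\<close> from \<open>u\<close>. The site
  \<open>u\<close> ranges over \<open>V\<close> because spins outside \<open>V\<close> stay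
  frozen.\<close>

definition mixing :: "nat \<Rightarrow> real \<Rightarrow> ('d \<Rightarrow> int) set \<Rightarrow> bool" where
  "mixing m \<epsilon> Q \<longleftrightarrow> (\<forall>u\<in>V \<inter> bdry Q. \<forall>\<sigma> s H. (\<forall>\<tau>. \<bar>H \<tau>\<bar> \<le> 1) \<longrightarrow>
     (\<forall>\<tau> \<tau>'. (\<forall>x\<in>Q. int m < l1dist u x \<longrightarrow> \<tau> x = \<tau>' x) \<longrightarrow> H \<tau> = H \<tau>') \<longrightarrow>
     \<bar>avg Q H \<sigma> - avg Q H (\<sigma>(u := s))\<bar> \<le> \<epsilon>)"

text \<open>The sites of \<open>Q\<close> within distance \<open>m\<close> of \<open>u\<close>, at
  most \<open>c\<close> in number, are paid for one by one under both spins at \<open>u\<close>,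
  with one more step for \<open>u\<close> itself: this is \<open>2 * c + 1\<close>. What depends on
  the remaining sites deviates from \<open>g \<sigma>\<close> by at most \<open>card Q * l\<close>
  and is charged at rate \<epsilon>.\<close>

lemma gb_avg_bdry:
  assumes u: "u \<in> V" "u \<in> bdry Q" and Q: "Q \<subseteq> V" and mix: "mixing m \<epsilon> Q"
    and l: "0 < l" and gb: "gb \<sigma>0 (insert u Q) g l"
    and n: "card Q \<le> n"
  shows "gb \<sigma>0 {u} (avg Q g) ((2 * (2 * real m + 1) ^ CARD('d) + 1 + real n * \<epsilon>) * l)"
  unfolding gb_def
proof (intro ballI allI)
  fix y \<sigma> s assume y: "y \<in> {u}" and \<sigma>: "\<sigma> \<in> cyl V \<sigma>0"
  define \<sigma>' where "\<sigma>' = \<sigma>(u := s)"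
  define B where "B = {x \<in> Q. int m < l1dist u x}"
  \<comment> \<open>Keeping only the far spins of \<tau> and resetting all others, also the one at
    \<open>u\<close>, to \<sigma> turns \<open>g\<close> into an admissible test function for
    \<open>mixing\<close>, the same one under both spins at \<open>u\<close>.\<close>
  define ov where "ov \<tau> = (\<lambda>x. if x \<in> B then \<tau> x else \<sigma> x)" for \<tau> :: "('d \<Rightarrow> int) \<Rightarrow> 's"
  define c where "c = (2 * real m + 1) ^ CARD('d)"
  define N where "N = real (card Q) * l"
  note finQ = finA[OF Q]
  have uQ: "u \<notin> Q" using u by (auto simp: bdry_def)
  have "Q \<noteq> {}" using u(2) by (auto simp: bdry_def)
  then have N0: "0 < N" using finQ l by (simp add: N_def card_gt_0_iff)
  have "card (Q - B) \<le> card {v. l1dist u v \<le> int m}"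
    by (rule card_mono[OF finite_l1ball]) (auto simp: B_def)
  also have "\<dots> \<le> (2 * m + 1) ^ CARD('d)" by (rule card_l1ball)
  finally have "real (card (Q - B)) \<le> real ((2 * m + 1) ^ CARD('d))" by (rule of_nat_mono)
  then have cQB: "real (card (Q - B)) \<le> c" by (simp add: c_def add.commute)
  have BV: "B \<subseteq> V" "B \<subseteq> Q" using Q by (auto simp: B_def)
  have ovV: "ov \<tau> \<in> cyl V \<sigma>0" for \<tau> using \<sigma> BV by (auto simp: ov_def cyl_iff)
  have near: "\<bar>g \<tau> - g (ov \<tau>)\<bar> \<le> c * l" if t: "\<tau> \<in> cyl Q \<sigma>" for \<tau>
  proof -
    have "\<bar>g \<tau> - g (ov \<tau>)\<bar> \<le> real (card (Q - B)) * l"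
    proof (rule gb_path[OF _ _ _ ovV])
      show "gb \<sigma>0 (Q - B) g l" by (rule gb_mono[OF gb]) auto
      show "\<tau> \<in> cyl (Q - B) (ov \<tau>)" using t by (auto simp: cyl_iff ov_def B_def)
    qed (use finQ Q in auto)
    then show ?thesis using mult_right_mono[OF cQB, of l] l by linarith
  qed
  have near': "\<bar>g \<tau> - g (ov \<tau>)\<bar> \<le> (c + 1) * l" if t: "\<tau> \<in> cyl Q \<sigma>'" for \<tau>
  proof -
    have "\<bar>g \<tau> - g (ov \<tau>)\<bar> \<le> real (card (insert u (Q - B))) * l"
    proof (rule gb_path[OF _ _ _ ovV])
      show "gb \<sigma>0 (insert u (Q - B)) g l" by (rule gb_mono[OF gb]) auto
      show "\<tau> \<in> cyl (insert u (Q - B)) (ov \<tau>)" using t by (auto simp: cyl_iff ov_def B_def \<sigma>'_def)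
    qed (use finQ Q u in auto)
    also have "real (card (insert u (Q - B))) = real (card (Q - B)) + 1" using finQ uQ by simp
    finally show ?thesis using mult_right_mono[OF cQB, of l] l unfolding distrib_right by linarith
  qed
  define H where "H \<tau> = (g (ov \<tau>) - g \<sigma>) / N" for \<tau>
  have H1: "\<bar>H \<tau>\<bar> \<le> 1" for \<tau>
  proof -
    have "\<bar>g (ov \<tau>) - g \<sigma>\<bar> \<le> real (card Q) * l"
      by (rule gb_path[OF finQ Q _ \<sigma>]) (use gb BV in \<open>auto simp: gb_def ov_def cyl_iff\<close>)
    then show ?thesis using N0 by (simp add: H_def N_def)
  qed
  have H2: "H \<tau> = H \<tau>'" if "\<forall>x\<in>Q. int m < l1dist u x \<longrightarrow> \<tau> x = \<tau>' x" for \<tau> \<tau>'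
  proof -
    have "ov \<tau> = ov \<tau>'" using that by (auto simp: ov_def B_def)
    then show ?thesis by (simp add: H_def)
  qed
  have H: "\<bar>avg Q H \<sigma> - avg Q H \<sigma>'\<bar> \<le> \<epsilon>"
    using mix u H1 H2 unfolding mixing_def \<sigma>'_def by blast
  have gov: "(\<lambda>\<tau>. g (ov \<tau>)) = (\<lambda>\<tau>. N * H \<tau> + g \<sigma>)" using N0 by (simp add: H_def)
  have "avg Q (\<lambda>\<tau>. g (ov \<tau>)) \<rho> = N * avg Q H \<rho> + g \<sigma>" for \<rho>
    unfolding gov avg_add avg_cmult avg_const[OF Q] ..
  then have "\<bar>avg Q (\<lambda>\<tau>. g (ov \<tau>)) \<sigma> - avg Q (\<lambda>\<tau>. g (ov \<tau>)) \<sigma>'\<bar> = N * \<bar>avg Q H \<sigma> - avg Q H \<sigma>'\<bar>"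
    using N0 by (simp add: abs_mult right_diff_distrib[symmetric])
  also have "\<dots> \<le> N * \<epsilon>" using H N0 by (intro mult_left_mono) auto
  also have "\<dots> \<le> real n * l * \<epsilon>"
    unfolding N_def using n l H by (intro mult_right_mono of_nat_mono) auto
  finally have "\<bar>avg Q (\<lambda>\<tau>. g (ov \<tau>)) \<sigma> - avg Q (\<lambda>\<tau>. g (ov \<tau>)) \<sigma>'\<bar> \<le> real n * l * \<epsilon>" .
  moreover have "\<bar>avg Q g \<sigma> - avg Q (\<lambda>\<tau>. g (ov \<tau>)) \<sigma>\<bar> \<le> c * l"
    by (rule avg_abs_diff_le[OF Q near])
  moreover have "\<bar>avg Q g \<sigma>' - avg Q (\<lambda>\<tau>. g (ov \<tau>)) \<sigma>'\<bar> \<le> (c + 1) * l"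
    by (rule avg_abs_diff_le[OF Q near'])
  moreover have "c * l + (c + 1) * l + real n * l * \<epsilon> = (2 * c + 1 + real n * \<epsilon>) * l"
    by (simp add: algebra_simps)
  ultimately have "\<bar>avg Q g \<sigma> - avg Q g \<sigma>'\<bar> \<le> (2 * c + 1 + real n * \<epsilon>) * l" by linarith
  then show "\<bar>avg Q g \<sigma> - avg Q g (\<sigma>(y := s))\<bar> \<le> (2 * (2 * real m + 1) ^ CARD('d) + 1 + real n * \<epsilon>) * l"
    using y by (simp add: c_def \<sigma>'_def)
qed

lemma gb_scan_far:
  assumes "x \<in> V" "\<And>Q. Q \<in> set Qs \<Longrightarrow> x \<notin> Q \<and> x \<notin> bdry Q \<and> Q \<subseteq> V" "gb \<sigma>0 {x} g l"
  shows "gb \<sigma>0 {x} (scan Qs g) l"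
  using assms(2) by (induction Qs) (auto intro!: gb_avg_far assms(1,3))

lemma gb_scan_inside:
  assumes "tiles Qs" "Q \<in> set Qs" "x \<in> Q"
  shows "gb \<sigma>0 {x} (scan Qs g) 0"
  unfolding scan_remove1[OF assms(1,2)] by (rule gb_avg_inside[OF assms(3)])

text \<open>The average over \<open>Q\<close> is moved outermost. The other tiles act before it and
  keep distance at least 2 from \<open>u\<close> and from \<open>Q\<close>, so they preserve the
  oscillation bound at exactly the sites that \<open>gb_avg_bdry\<close> inspects.\<close>

lemma gb_scan_bdry:
  assumes t: "tiles Qs" and Q: "Q \<in> set Qs" and u: "u \<in> V" "u \<in> bdry Q" and mix: "mixing m \<epsilon> Q"
    and l: "0 < l" and gb: "gb \<sigma>0 V g l" and n: "card Q \<le> n"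
  shows "gb \<sigma>0 {u} (scan Qs g) ((2 * (2 * real m + 1) ^ CARD('d) + 1 + real n * \<epsilon>) * l)"
  unfolding scan_remove1[OF t Q]
proof (rule gb_avg_bdry[OF u tiles_sub[OF t Q] mix l _ n])
  have far: "3 \<le> l1dist x y" if "Q' \<in> set (remove1 Q Qs)" "x \<in> Q" "y \<in> Q'" for Q' x y
  proof -
    have "Q' \<in> set Qs" "Q \<noteq> Q'" using that(1) t by (auto simp: tiles_def)
    then show ?thesis using t Q that(2,3) unfolding tiles_def by blast
  qed
  obtain v where v: "v \<in> Q" "l1dist u v = 1"
    using u(2) by (auto simp: bdry_def adj_def)
  have "gb \<sigma>0 {x} (scan (remove1 Q Qs) g) l" if x: "x \<in> insert u Q" for x
  proof (rule gb_scan_far)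
    have d: "l1dist v x \<le> 1 \<or> x \<in> Q" using x v by (auto simp: l1dist_commute)
    show "x \<in> V" using x u tiles_sub[OF t Q] by auto
    then show "gb \<sigma>0 {x} g l" by (intro gb_mono[OF gb]) auto
    fix Q' assume Q': "Q' \<in> set (remove1 Q Qs)"
    have D: "2 \<le> l1dist x y" if y: "y \<in> Q'" for y
    proof (cases "x \<in> Q")
      case True
      then show ?thesis using far[OF Q' True y] by simp
    next
      case False
      then have "l1dist v x = 1" using x v by (auto simp: l1dist_commute)
      then show ?thesis using far[OF Q' v(1) y] l1dist_triangle[of v y x] by simp
    qed
    have "x \<notin> Q'" using D[of x] by auto
    moreover have "x \<notin> bdry Q'" using D by (fastforce simp: bdry_def adj_def)
    moreover have "Q' \<subseteq> V" using Q' t by (auto simp: tiles_def dest: notin_set_remove1)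
    ultimately show "x \<notin> Q' \<and> x \<notin> bdry Q' \<and> Q' \<subseteq> V" by simp
  qed
  then show "gb \<sigma>0 (insert u Q) (scan (remove1 Q Qs) g) l" by (auto simp: gb_def)
qed

section \<open>From contraction of oscillations to contraction of square norms\<close>

lemma avg_symmetric:
  assumes "A \<subseteq> V"
  shows "avg V (\<lambda>\<tau>. f \<tau> * avg A g \<tau>) = avg V (\<lambda>\<tau>. avg A f \<tau> * g \<tau>)"
proof -
  have "avg V (\<lambda>\<tau>. g \<tau> * avg A f \<tau>) = avg V (\<lambda>\<tau>. avg A g \<tau> * avg A f \<tau>)"
    by (rule avg_selfadjoint[OF assms]) simp
  then show ?thesis
    unfolding avg_selfadjoint[OF assms order_refl, of f g] by (simp add: mult.commute)
qed

lemma scan_symmetric: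
  assumes "tiles Qs"
  shows "avg V (\<lambda>\<tau>. f \<tau> * scan Qs g \<tau>) = avg V (\<lambda>\<tau>. scan Qs f \<tau> * g \<tau>)"
  using assms
proof (induction Qs arbitrary: f)
  case (Cons Q Qs)
  have QV: "Q \<subseteq> V" using tiles_sub[OF Cons.prems, of Q] by simp
  have com: "avg Q (scan Qs f) = scan Qs (avg Q f)"
  proof (rule scan_avg_commute[OF _ QV])
    fix Q' assume Q': "Q' \<in> set Qs"
    then have "Q \<noteq> Q'" using Cons.prems by (auto simp: tiles_def)
    then show "far Q Q' \<and> Q' \<subseteq> V"
      using tiles_far[OF Cons.prems, of Q Q'] tiles_sub[OF Cons.prems, of Q'] Q' by auto
  qed
  show ?case
    by (simp add: avg_symmetric[OF QV, of f] com Cons.IH[OF tiles_Cons[OF Cons.prems]])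
qed simp

lemma scan_idem: "tiles Qs \<Longrightarrow> scan Qs (scan Qs f) = scan Qs f"
  using scan_restrict_absorb[of Qs UNIV f] by (simp add: map_idI)

lemma avg_scan: "(\<And>Q. Q \<in> set Qs \<Longrightarrow> Q \<subseteq> V) \<Longrightarrow> avg V (scan Qs f) = avg V f"
  by (induction Qs) (auto simp: avg_tower)

lemma avg_cauchy_schwarz: "(avg V (\<lambda>\<tau>. f \<tau> * g \<tau>) \<sigma>)\<^sup>2 \<le> nrm \<sigma> f * nrm \<sigma> g"
proof -
  define P where "P = avg V (\<lambda>\<tau>. f \<tau> * g \<tau>) \<sigma>"
  have quad: "0 \<le> a\<^sup>2 * nrm \<sigma> f - 2 * a * b * P + b\<^sup>2 * nrm \<sigma> g" for a b
  proof -
    have "0 \<le> avg V (\<lambda>\<tau>. (a * f \<tau> - b * g \<tau>)\<^sup>2) \<sigma>" by (rule avg_nonneg) auto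
    also have "\<dots> = avg V (\<lambda>\<tau>. (a\<^sup>2 * (f \<tau>)\<^sup>2 - (2 * a * b) * (f \<tau> * g \<tau>)) + b\<^sup>2 * (g \<tau>)\<^sup>2) \<sigma>"
      by (simp add: power2_eq_square algebra_simps)
    also have "\<dots> = a\<^sup>2 * nrm \<sigma> f - 2 * a * b * P + b\<^sup>2 * nrm \<sigma> g"
      unfolding avg_add avg_diff avg_cmult by (simp add: nrm_def P_def)
    finally show ?thesis .
  qed
  show ?thesis
  proof (cases "nrm \<sigma> g = 0")
    case True
    have "P = 0"
    proof (rule ccontr)
      assume "P \<noteq> 0"
      \<comment> \<open>When \<open>g\<close> has norm zero the quadratic form is linear in
        \<open>b\<close>, and this \<open>b\<close> makes it equal to -1.\<close>
      then show False using quad[of 1 "(nrm \<sigma> f + 1) / (2 * P)"] True by simp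
    qed
    then show ?thesis using True by (simp add: P_def)
  next
    case False
    then have pos: "0 < nrm \<sigma> g" using nrm_nonneg[of \<sigma> g] by simp
    have "0 \<le> nrm \<sigma> g * (nrm \<sigma> f * nrm \<sigma> g - P\<^sup>2)"
      using quad[of "nrm \<sigma> g" P] by (simp add: power2_eq_square algebra_simps)
    then show ?thesis using pos by (simp add: P_def zero_le_mult_iff)
  qed
qed

definition mix_scan :: "'j set \<Rightarrow> ('j \<Rightarrow> ('d \<Rightarrow> int) set list) \<Rightarrow> ((('d \<Rightarrow> int) \<Rightarrow> 's) \<Rightarrow> real) \<Rightarrow> (('d \<Rightarrow> int) \<Rightarrow> 's) \<Rightarrow> real" where
  "mix_scan J Qs g \<tau> = (\<Sum>j\<in>J. scan (Qs j) g \<tau>) / real (card J)"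

text \<open>A tiling that covers \<open>u\<close> leaves oscillation 0 there, one with
  \<open>u\<close> on a boundary at most \<open>K * l\<close>, any other at most \<open>l\<close>.
  By \<open>bd\<close> the boundary cases cost at most half of what the covering cases gain, hence
  the rate \<open>1 - p / 2\<close>.\<close>

lemma gb_mix_scan:
  assumes J: "finite J" "J \<noteq> {}" and t: "\<And>j. j \<in> J \<Longrightarrow> tiles (Qs j)"
    and mix: "\<And>j Q. j \<in> J \<Longrightarrow> Q \<in> set (Qs j) \<Longrightarrow> mixing m \<epsilon> Q \<and> card Q \<le> n"
    and K: "K = 2 * (2 * real m + 1) ^ CARD('d) + 1 + real n * \<epsilon>" and \<epsilon>: "0 \<le> \<epsilon>"
    and cov: "\<And>u. u \<in> V \<Longrightarrow> p * real (card J) \<le> real (card {j \<in> J. \<exists>Q\<in>set (Qs j). u \<in> Q})"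
    and bd: "\<And>u. u \<in> V \<Longrightarrow> 2 * K * real (card {j \<in> J. \<exists>Q\<in>set (Qs j). u \<in> bdry Q})
      \<le> real (card {j \<in> J. \<exists>Q\<in>set (Qs j). u \<in> Q})"
    and l: "0 < l" and gb: "gb \<sigma>0 V g l"
  shows "gb \<sigma>0 V (mix_scan J Qs g) ((1 - p / 2) * l)"
  unfolding gb_def
proof (intro ballI allI)
  fix u \<sigma> s assume u: "u \<in> V" and \<sigma>: "\<sigma> \<in> cyl V \<sigma>0"
  define I where "I = {j \<in> J. \<exists>Q\<in>set (Qs j). u \<in> Q}"
  define B where "B = {j \<in> J. \<exists>Q\<in>set (Qs j). u \<in> bdry Q}"
  have K1: "0 \<le> K" using \<epsilon> by (simp add: K)
  have J0: "0 < real (card J)" using J by (simp add: card_gt_0_iff)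
  have each: "\<bar>scan (Qs j) g \<sigma> - scan (Qs j) g (\<sigma>(u := s))\<bar> \<le>
      (1 - (if j \<in> I then 1 else 0)) * l + (if j \<in> B then K else 0) * l" if j: "j \<in> J" for j
  proof (cases "j \<in> I")
    case True
    then obtain Q where Q: "Q \<in> set (Qs j)" "u \<in> Q" by (auto simp: I_def)
    have "gb \<sigma>0 {u} (scan (Qs j) g) 0" by (rule gb_scan_inside[OF t[OF j] Q])
    then have "\<bar>scan (Qs j) g \<sigma> - scan (Qs j) g (\<sigma>(u := s))\<bar> \<le> 0" using gbD \<sigma> by blast
    then show ?thesis using True K1 l by simp
  next
    case nI: False
    show ?thesis
    proof (cases "j \<in> B")
      case True
      then obtain Q where Q: "Q \<in> set (Qs j)" "u \<in> bdry Q" by (auto simp: B_def)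
      have "gb \<sigma>0 {u} (scan (Qs j) g) (K * l)"
        unfolding K using mix[OF j Q(1)] by (intro gb_scan_bdry[OF t[OF j] Q(1) u Q(2) _ l gb]) auto
      then have "\<bar>scan (Qs j) g \<sigma> - scan (Qs j) g (\<sigma>(u := s))\<bar> \<le> K * l" using gbD \<sigma> by blast
      then show ?thesis using True nI l by simp
    next
      case False
      have "gb \<sigma>0 {u} (scan (Qs j) g) l"
      proof (rule gb_scan_far[OF u])
        show "gb \<sigma>0 {u} g l" using u by (intro gb_mono[OF gb]) auto
        fix Q assume "Q \<in> set (Qs j)"
        then show "u \<notin> Q \<and> u \<notin> bdry Q \<and> Q \<subseteq> V"
          using nI False j tiles_sub[OF t[OF j]] by (auto simp: I_def B_def)
      qed
      then have "\<bar>scan (Qs j) g \<sigma> - scan (Qs j) g (\<sigma>(u := s))\<bar> \<le> l" using gbD \<sigma> by blast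
      then show ?thesis using False nI by simp
    qed
  qed
  have cI: "(\<Sum>j\<in>J. if j \<in> I then 1 else 0) = real (card I)"
  proof -
    have "J \<inter> I = I" by (auto simp: I_def)
    then show ?thesis using J by (simp add: sum.If_cases)
  qed
  have cB: "(\<Sum>j\<in>J. if j \<in> B then K else 0) = K * real (card B)"
  proof -
    have "J \<inter> B = B" by (auto simp: B_def)
    then show ?thesis using J by (simp add: sum.If_cases)
  qed
  have "\<bar>mix_scan J Qs g \<sigma> - mix_scan J Qs g (\<sigma>(u := s))\<bar> =
      \<bar>\<Sum>j\<in>J. scan (Qs j) g \<sigma> - scan (Qs j) g (\<sigma>(u := s))\<bar> / real (card J)"
    by (simp add: mix_scan_def sum_subtractf diff_divide_distrib[symmetric])
  also have "\<dots> \<le> (\<Sum>j\<in>J. \<bar>scan (Qs j) g \<sigma> - scan (Qs j) g (\<sigma>(u := s))\<bar>) / real (card J)"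
    using J0 by (intro divide_right_mono sum_abs) auto
  also have "\<dots> \<le> (\<Sum>j\<in>J. (1 - (if j \<in> I then 1 else 0)) * l + (if j \<in> B then K else 0) * l) / real (card J)"
    using J0 each by (intro divide_right_mono sum_mono) auto
  also have "(\<Sum>j\<in>J. (1 - (if j \<in> I then 1 else 0)) * l + (if j \<in> B then K else 0) * l) =
      (real (card J) - real (card I) + K * real (card B)) * l"
    unfolding sum.distrib sum_distrib_right[symmetric] sum_subtractf cI cB by (simp add: algebra_simps)
  also have "\<dots> / real (card J) \<le> ((1 - p / 2) * real (card J)) * l / real (card J)"
    using cov[OF u] bd[OF u] l J0 unfolding I_def[symmetric] B_def[symmetric]
    by (intro divide_right_mono mult_right_mono) (auto simp: algebra_simps)
  also have "\<dots> = (1 - p / 2) * l" using J0 by simp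
  finally show "\<bar>mix_scan J Qs g \<sigma> - mix_scan J Qs g (\<sigma>(u := s))\<bar> \<le> (1 - p / 2) * l" .
qed

lemma avg_mix_scan:
  assumes J: "finite J" "J \<noteq> {}" and t: "\<And>j. j \<in> J \<Longrightarrow> tiles (Qs j)"
  shows "avg V (mix_scan J Qs g) = avg V g"
proof
  fix \<sigma>
  have J0: "0 < real (card J)" using J by (simp add: card_gt_0_iff)
  have "avg V (mix_scan J Qs g) \<sigma> = avg V (\<lambda>\<tau>. inverse (real (card J)) * (\<Sum>j\<in>J. scan (Qs j) g \<tau>)) \<sigma>"
    by (intro avg_cong) (simp add: mix_scan_def field_simps)
  also have "\<dots> = inverse (real (card J)) * (\<Sum>j\<in>J. avg V g \<sigma>)"
    unfolding avg_cmult avg_sum using tiles_sub[OF t]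
    by (intro arg_cong2[where f = "(*)"] sum.cong refl) (simp add: avg_scan)
  finally show "avg V (mix_scan J Qs g) \<sigma> = avg V g \<sigma>" using J0 by simp
qed

lemma avg_times_mix_scan:
  "avg V (\<lambda>\<tau>. f \<tau> * mix_scan J Qs g \<tau>) \<sigma> = (\<Sum>j\<in>J. avg V (\<lambda>\<tau>. f \<tau> * scan (Qs j) g \<tau>) \<sigma>) / real (card J)"
proof -
  have "avg V (\<lambda>\<tau>. f \<tau> * mix_scan J Qs g \<tau>) \<sigma> =
      avg V (\<lambda>\<tau>. inverse (real (card J)) * (\<Sum>j\<in>J. f \<tau> * scan (Qs j) g \<tau>)) \<sigma>"
    unfolding mix_scan_def sum_distrib_left[symmetric] by (simp add: field_simps)
  then show ?thesis unfolding avg_cmult avg_sum by (simp add: field_simps)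
qed

lemma mix_scan_symmetric:
  assumes t: "\<And>j. j \<in> J \<Longrightarrow> tiles (Qs j)"
  shows "avg V (\<lambda>\<tau>. f \<tau> * mix_scan J Qs g \<tau>) \<sigma> = avg V (\<lambda>\<tau>. mix_scan J Qs f \<tau> * g \<tau>) \<sigma>"
proof -
  have "avg V (\<lambda>\<tau>. mix_scan J Qs f \<tau> * g \<tau>) \<sigma> = avg V (\<lambda>\<tau>. g \<tau> * mix_scan J Qs f \<tau>) \<sigma>"
    by (simp add: mult.commute)
  also have "\<dots> = (\<Sum>j\<in>J. avg V (\<lambda>\<tau>. scan (Qs j) g \<tau> * f \<tau>) \<sigma>) / real (card J)"
    unfolding avg_times_mix_scan
    by (intro arg_cong2[where f = "(/)"] sum.cong refl) (simp add: scan_symmetric t)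
  also have "\<dots> = avg V (\<lambda>\<tau>. f \<tau> * mix_scan J Qs g \<tau>) \<sigma>"
    unfolding avg_times_mix_scan by (simp add: mult.commute)
  finally show ?thesis ..
qed

lemma ex_gb: "\<exists>l>0. gb \<sigma>0 V g l"
proof -
  define M where "M = (\<Sum>\<tau>\<in>cyl V \<sigma>0. \<bar>g \<tau>\<bar>)"
  have M: "\<bar>g \<tau>\<bar> \<le> M" if "\<tau> \<in> cyl V \<sigma>0" for \<tau>
    unfolding M_def using that finV by (intro member_le_sum) auto
  have "gb \<sigma>0 V g (2 * M + 1)"
    unfolding gb_def
  proof (intro ballI allI)
    fix x \<sigma> s assume "x \<in> V" "\<sigma> \<in> cyl V \<sigma>0"
    then have "\<bar>g \<sigma>\<bar> \<le> M" "\<bar>g (\<sigma>(x := s))\<bar> \<le> M" by (auto intro!: M simp: cyl_iff)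
    then show "\<bar>g \<sigma> - g (\<sigma>(x := s))\<bar> \<le> 2 * M + 1" by linarith
  qed
  moreover have "0 < 2 * M + 1" using M[of \<sigma>0] by auto
  ultimately show ?thesis by blast
qed

text \<open>Passing from oscillations to the norm costs a factor depending on \<open>card V\<close>,
  but the same factor for all iterates \<open>G s\<close>. Symmetry and Cauchy-Schwarz make
  \<open>N\<close> log-convex, so the exponential rate already holds for the first ratio. Each scan
  is a projection, so its quadratic form at \<open>g\<close> is the squared norm of
  \<open>scan (Qs j) g\<close>.\<close>

lemma mix_scan_gap:
  assumes J: "finite J" "J \<noteq> {}" and t: "\<And>j. j \<in> J \<Longrightarrow> tiles (Qs j)"
    and contr: "\<And>g l. 0 < l \<Longrightarrow> gb \<sigma>0 V g l \<Longrightarrow> gb \<sigma>0 V (mix_scan J Qs g) (q * l)"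
    and q: "0 < q" and mean: "avg V g \<sigma>0 = 0"
  shows "(\<Sum>j\<in>J. nrm \<sigma>0 (scan (Qs j) g)) / real (card J) \<le> q * nrm \<sigma>0 g"
proof -
  let ?T = "mix_scan J Qs"
  define G where "G s = (?T ^^ s) g" for s
  have G0: "G 0 = g" and GS: "G (Suc s) = ?T (G s)" for s by (simp_all add: G_def)
  obtain l where l: "0 < l" "gb \<sigma>0 V g l" using ex_gb by blast
  have gbG: "gb \<sigma>0 V (G s) (q ^ s * l)" for s
  proof (induction s)
    case (Suc s)
    have "0 < q ^ s * l" using q l by simp
    from contr[OF this Suc.IH] show ?case by (simp add: GS mult_ac)
  qed (simp add: G0 l)
  have meanG: "avg V (G s) \<sigma>0 = 0" for s
    by (induction s) (simp_all add: G0 GS mean avg_mix_scan[OF J t])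
  define N where "N s = nrm \<sigma>0 (G s)" for s
  have decay: "N s \<le> (real (card V) * l)\<^sup>2 * (q\<^sup>2) ^ s" for s
  proof -
    have "avg V (\<lambda>\<tau>. (G s \<tau>)\<^sup>2) \<sigma>0 - (avg V (G s) \<sigma>0)\<^sup>2 \<le> (real (card V) * (q ^ s * l))\<^sup>2"
    proof (rule variance_le[OF order_refl])
      fix \<tau> assume "\<tau> \<in> cyl V \<sigma>0"
      then have "\<bar>G s \<tau> - G s \<sigma>0\<bar> \<le> real (card V) * (q ^ s * l)"
        by (intro gb_path[OF finV order_refl gbG]) auto
      then have "\<bar>G s \<tau> - G s \<sigma>0\<bar>\<^sup>2 \<le> (real (card V) * (q ^ s * l))\<^sup>2" by (intro power_mono) auto
      then show "(G s \<tau> - G s \<sigma>0)\<^sup>2 \<le> (real (card V) * (q ^ s * l))\<^sup>2" by simp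
    qed
    then show ?thesis
      by (simp add: N_def nrm_def meanG power_mult_distrib power_mult[symmetric] mult_ac)
  qed
  have symG: "avg V (\<lambda>\<tau>. G s \<tau> * G (Suc s') \<tau>) \<sigma>0 = avg V (\<lambda>\<tau>. G (Suc s) \<tau> * G s' \<tau>) \<sigma>0" for s s'
    unfolding GS by (rule mix_scan_symmetric[OF t])
  have conv: "(N (Suc s))\<^sup>2 \<le> N s * N (Suc (Suc s))" for s
  proof -
    have "N (Suc s) = avg V (\<lambda>\<tau>. G s \<tau> * G (Suc (Suc s)) \<tau>) \<sigma>0"
      unfolding symG[of s "Suc s"] by (simp add: N_def nrm_def power2_eq_square)
    then show ?thesis using avg_cauchy_schwarz by (simp add: N_def)
  qed
  have "N 1 \<le> q\<^sup>2 * N 0"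
    by (rule log_convex_first_ratio[of N "(real (card V) * l)\<^sup>2", OF _ conv decay])
       (use q in \<open>auto simp: N_def nrm_nonneg\<close>)
  then have N1: "nrm \<sigma>0 (?T g) \<le> q\<^sup>2 * nrm \<sigma>0 g" by (simp add: N_def G0 GS)
  have "(avg V (\<lambda>\<tau>. g \<tau> * ?T g \<tau>) \<sigma>0)\<^sup>2 \<le> nrm \<sigma>0 g * nrm \<sigma>0 (?T g)" by (rule avg_cauchy_schwarz)
  also have "\<dots> \<le> nrm \<sigma>0 g * (q\<^sup>2 * nrm \<sigma>0 g)" by (rule mult_left_mono[OF N1 nrm_nonneg])
  also have "\<dots> = (q * nrm \<sigma>0 g)\<^sup>2" by (simp add: power2_eq_square)
  finally have "avg V (\<lambda>\<tau>. g \<tau> * ?T g \<tau>) \<sigma>0 \<le> q * nrm \<sigma>0 g"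
    by (rule power2_le_imp_le) (use q nrm_nonneg in auto)
  moreover have "avg V (\<lambda>\<tau>. g \<tau> * scan (Qs j) g \<tau>) \<sigma>0 = nrm \<sigma>0 (scan (Qs j) g)" if "j \<in> J" for j
    using scan_symmetric[OF t[OF that], of g "scan (Qs j) g"]
    by (simp add: scan_idem[OF t[OF that]] nrm_def power2_eq_square)
  ultimately show ?thesis by (simp add: avg_times_mix_scan)
qed

text \<open>By the contraction, a tiling loses on average at least the fraction \<open>p / 2\<close>
  of the squared norm, and \<open>scan_drop_le\<close> charges the loss of each tiling to the
  blocks.\<close>

lemma poincare_tiles:
  fixes n :: nat
  assumes J: "finite J" "J \<noteq> {}" and t: "\<And>j. j \<in> J \<Longrightarrow> tiles (Qs j)"
    and contr: "\<And>g l. 0 < l \<Longrightarrow> gb \<sigma>0 V g l \<Longrightarrow> gb \<sigma>0 V (mix_scan J Qs g) ((1 - p / 2) * l)"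
    and p: "0 < p" "p < 2" and mean: "avg V g \<sigma>0 = 0"
    and A: "\<And>i. i < n \<Longrightarrow> A i \<subseteq> V" and C: "0 \<le> C"
    and loc: "\<And>j Q f. j \<in> J \<Longrightarrow> Q \<in> set (Qs j) \<Longrightarrow>
      nrm \<sigma>0 f - nrm \<sigma>0 (avg Q f) \<le> C * (\<Sum>i<n. nrm \<sigma>0 f - nrm \<sigma>0 (avg (A i \<inter> Q) f))"
  shows "nrm \<sigma>0 g \<le> 2 / p * C * (\<Sum>i<n. nrm \<sigma>0 g - nrm \<sigma>0 (avg (A i) g))"
proof -
  have J0: "0 < real (card J)" using J by (simp add: card_gt_0_iff)
  define R where "R = C * (\<Sum>i<n. nrm \<sigma>0 g - nrm \<sigma>0 (avg (A i) g))"
  have "(\<Sum>j\<in>J. nrm \<sigma>0 (scan (Qs j) g)) / real (card J) \<le> (1 - p / 2) * nrm \<sigma>0 g"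
    using p by (intro mix_scan_gap[OF J t contr _ mean]) auto
  then have "(\<Sum>j\<in>J. nrm \<sigma>0 (scan (Qs j) g)) \<le> (1 - p / 2) * nrm \<sigma>0 g * real (card J)"
    using J0 by (simp add: field_simps)
  moreover have "(\<Sum>j\<in>J. nrm \<sigma>0 g - nrm \<sigma>0 (scan (Qs j) g)) \<le> (\<Sum>j\<in>J. R)"
    unfolding R_def by (intro sum_mono scan_drop_le[OF t A C loc]) auto
  ultimately have "p / 2 * nrm \<sigma>0 g * real (card J) \<le> R * real (card J)"
    by (simp add: sum_subtractf algebra_simps)
  then have "p / 2 * nrm \<sigma>0 g \<le> R" using J0 by simp
  then show ?thesis using p by (simp add: R_def field_simps)
qed

end

section \<open>Tilings of a cube\<close>

definition box :: "('d::finite \<Rightarrow> int) \<Rightarrow> int \<Rightarrow> ('d \<Rightarrow> int) set" where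
  "box s l = {x. \<forall>i. s i \<le> x i \<and> x i \<le> s i + l - 1}"

lemma box_eq_PiE: "box s l = PiE UNIV (\<lambda>i. {s i .. s i + l - 1})"
  by (auto simp: box_def PiE_def Pi_def)

lemma finite_box [simp]: "finite (box s l)"
  unfolding box_eq_PiE by (intro finite_PiE) auto

lemma card_box: "card (box (s :: 'd::finite \<Rightarrow> int) l) = nat l ^ CARD('d)"
  unfolding box_eq_PiE by (subst card_PiE) auto

lemma is_cube_box: "1 \<le> l \<Longrightarrow> is_cube (box s l)"
  by (auto simp: is_cube_def box_def)

text \<open>Starting points in \<open>[0, n)\<close> of the intervals of length \<open>l\<close> of type \<open>t\<close>: for \<open>t < M\<close> all
  translates with start congruent to \<open>t\<close> modulo \<open>M\<close>, and for \<open>M \<le> t < 2 M\<close> (so with half of the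
  total weight) the two extreme intervals, since hardly any translate covers a site near an end point.\<close>

definition starts :: "int \<Rightarrow> int \<Rightarrow> int \<Rightarrow> int \<Rightarrow> int set" where
  "starts n M l t = (if t < M then {s. 0 \<le> s \<and> s \<le> n - l \<and> s mod M = t} else {0, n - l})"

lemma starts_range: "s \<in> starts n M l t \<Longrightarrow> l \<le> n \<Longrightarrow> 0 \<le> s \<and> s \<le> n - l"
  by (auto simp: starts_def split: if_splits)

lemma finite_starts [simp]: "finite (starts n M l t)"
  by (auto simp: starts_def intro: finite_subset[of _ "{0..n - l}"])

text \<open>Starting points \<open>l + 2\<close> apart leave a distance of at least 3 between sites
  of the two intervals, as \<open>tiles\<close> demands.\<close>

lemma starts_separated:
  assumes "s \<in> starts n M l t" "s' \<in> starts n M l t" "s \<noteq> s'" "l + 2 \<le> M" "2 * l + 2 \<le> n"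
  shows "l + 2 \<le> \<bar>s - s'\<bar>"
proof (cases "t < M")
  case True
  then have "s mod M = s' mod M" using assms(1,2) by (simp add: starts_def)
  then have "M dvd s - s'" by (simp add: mod_eq_dvd_iff)
  then have "\<bar>M\<bar> \<le> \<bar>s - s'\<bar>" using assms(3) by (intro dvd_imp_le_int) auto
  then show ?thesis using assms(4) by linarith
qed (use assms in \<open>auto simp: starts_def\<close>)

lemma card_mod_image:
  fixes a M L :: int
  assumes "0 \<le> L" "L \<le> M" "0 < M"
  shows "card ((\<lambda>s. s mod M) ` {a..<a + L}) = nat L"
proof -
  have "inj_on (\<lambda>s. s mod M) {a..<a + L}"
  proof (rule inj_onI, rule ccontr)
    fix x y assume xy: "x \<in> {a..<a + L}" "y \<in> {a..<a + L}" "x mod M = y mod M" "x \<noteq> y"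
    then have "\<bar>M\<bar> \<le> \<bar>x - y\<bar>" by (intro dvd_imp_le_int) (auto simp: mod_eq_dvd_iff)
    then show False using xy assms by auto
  qed
  then show ?thesis by (simp add: card_image)
qed

definition covered :: "int \<Rightarrow> int \<Rightarrow> int \<Rightarrow> int \<Rightarrow> int set" where
  "covered n M l k = {t \<in> {0..<2 * M}. \<exists>s\<in>starts n M l t. s \<le> k \<and> k \<le> s + l - 1}"

definition grazed :: "int \<Rightarrow> int \<Rightarrow> int \<Rightarrow> int \<Rightarrow> int set" where
  "grazed n M l k = {t \<in> {0..<2 * M}. \<exists>s\<in>starts n M l t. k = s - 1 \<or> k = s + l}"

lemma finite_covered [simp]: "finite (covered n M l k)"
  by (rule finite_subset[of _ "{0..<2 * M}"]) (auto simp: covered_def)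

lemma finite_grazed [simp]: "finite (grazed n M l k)"
  by (rule finite_subset[of _ "{0..<2 * M}"]) (auto simp: grazed_def)

text \<open>Near the end points the extreme intervals cover \<open>k\<close>, and they account for
  \<open>M\<close> types. Elsewhere \<open>L\<close> consecutive starting points do, with distinct
  residues because \<open>L \<le> M\<close>; towards the right end this window has to move left to
  respect \<open>s \<le> n - l\<close>, which separates the last two cases.\<close>

lemma card_covered_ge:
  assumes L: "1 \<le> L" "L \<le> l" "l < 2 * L" and n: "4 * L \<le> n" and M: "L \<le> M" and k: "0 \<le> k" "k < n"
  shows "nat L \<le> card (covered n M l k)"
proof -
  have window: ?thesis if a: "\<And>s. s \<in> {a..<a + L} \<Longrightarrow> 0 \<le> s \<and> s \<le> n - l \<and> s \<le> k \<and> k \<le> s + l - 1" for a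
  proof -
    have "(\<lambda>s. s mod M) ` {a..<a + L} \<subseteq> covered n M l k"
    proof
      fix t assume "t \<in> (\<lambda>s. s mod M) ` {a..<a + L}"
      then obtain s where s: "s \<in> {a..<a + L}" "t = s mod M" by auto
      have "0 \<le> t" "t < M" using s(2) L M by auto
      then show "t \<in> covered n M l k" using a[OF s(1)] s(2) by (auto simp: covered_def starts_def)
    qed
    then have "card ((\<lambda>s. s mod M) ` {a..<a + L}) \<le> card (covered n M l k)" by (rule card_mono[OF finite_covered])
    then show ?thesis using card_mod_image[of L M a] L M by simp
  qed
  consider "k < L \<or> n - L \<le> k" | "L \<le> k" "k < n - 2 * L" | "n - 2 * L \<le> k" "k < n - L" by linarith
  then show ?thesis
  proof cases
    case 1
    have "{M..<2 * M} \<subseteq> covered n M l k"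
      using 1 L M n k by (auto simp: covered_def starts_def)
    then have "card {M..<2 * M} \<le> card (covered n M l k)" by (rule card_mono[OF finite_covered])
    then show ?thesis using M by simp
  next
    case 2
    show ?thesis by (rule window[of "k - L + 1"]) (use 2 L n in auto)
  next
    case 3
    show ?thesis by (rule window[of "k - l + 1"]) (use 3 L n in auto)
  qed
qed

text \<open>A translate grazes \<open>k\<close> only if its residue is that of \<open>k + 1\<close>
  or of \<open>k - l\<close>. The extreme intervals graze \<open>k\<close> only when
  \<open>l\<close> is \<open>k\<close> or \<open>n - 1 - k\<close>, but then through all their
  \<open>M\<close> types at once.\<close>

lemma card_grazed_le:
  assumes M: "0 < M" and l: "1 \<le> l" "l \<le> n" and k: "0 \<le> k" "k < n"
  shows "card (grazed n M l k) \<le> 2 + (if l = k \<or> l = n - 1 - k then nat M else 0)"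
proof -
  have "grazed n M l k \<subseteq> {(k + 1) mod M, (k - l) mod M} \<union> (if l = k \<or> l = n - 1 - k then {M..<2 * M} else {})"
    using assms by (auto simp: grazed_def starts_def split: if_splits)
  then have "card (grazed n M l k) \<le>
      card ({(k + 1) mod M, (k - l) mod M} \<union> (if l = k \<or> l = n - 1 - k then {M..<2 * M} else {}))"
    by (intro card_mono) auto
  also have "\<dots> \<le> card {(k + 1) mod M, (k - l) mod M} + card (if l = k \<or> l = n - 1 - k then {M..<2 * M} else {})"
    by (rule card_Un_le)
  also have "\<dots> \<le> 2 + (if l = k \<or> l = n - 1 - k then nat M else 0)"
    by (intro add_mono) (simp_all add: card_insert_if)
  finally show ?thesis .
qed

text \<open>Here the varying side length pays off: the expensive case of the extreme intervals
  occurs for at most two of the \<open>L\<close> lengths, so for \<open>M\<close> of order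
  \<open>L\<close> the grazing proportion is of order \<open>1 / L\<close>.\<close>

lemma sum_card_grazed_le:
  assumes M: "0 < M" and L: "1 \<le> L" "2 * L \<le> n" and k: "0 \<le> k" "k < n"
  shows "(\<Sum>l\<in>{L..<2 * L}. card (grazed n M l k)) \<le> 2 * nat L + 2 * nat M"
proof -
  have "(\<Sum>l\<in>{L..<2 * L}. card (grazed n M l k)) \<le>
     (\<Sum>l\<in>{L..<2 * L}. 2 + ((if l = k then nat M else 0) + (if l = n - 1 - k then nat M else 0)))"
  proof (rule sum_mono)
    fix l assume "l \<in> {L..<2 * L}"
    then have "card (grazed n M l k) \<le> 2 + (if l = k \<or> l = n - 1 - k then nat M else 0)"
      using L by (intro card_grazed_le[OF M _ _ k]) auto
    also have "\<dots> \<le> 2 + ((if l = k then nat M else 0) + (if l = n - 1 - k then nat M else 0))" by simp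
    finally show "card (grazed n M l k) \<le> 2 + ((if l = k then nat M else 0) + (if l = n - 1 - k then nat M else 0))" .
  qed
  also have "\<dots> \<le> 2 * nat L + (nat M + nat M)"
    unfolding sum.distrib using L by (intro add_mono) auto
  finally show ?thesis by simp
qed

section \<open>Product tilings in all dimensions and their counts\<close>

definition tile_list :: "int \<Rightarrow> int \<Rightarrow> ('d::finite \<Rightarrow> int) \<Rightarrow> int \<Rightarrow> ('d \<Rightarrow> int) \<Rightarrow> ('d \<Rightarrow> int) set list" where
  "tile_list n M a l t = (SOME Qs. distinct Qs \<and>
     set Qs = (\<lambda>s. box (\<lambda>i. a i + s i) l) ` PiE UNIV (\<lambda>i. starts n M l (t i)))"

lemma tile_list:
  "distinct (tile_list n M a l t)"
  "set (tile_list n M a l t) = (\<lambda>s. box (\<lambda>i. a i + s i) l) ` PiE UNIV (\<lambda>i. starts n M l (t i))"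
proof -
  have "\<exists>Qs. distinct Qs \<and> set Qs = (\<lambda>s. box (\<lambda>i. a i + s i) l) ` PiE UNIV (\<lambda>i. starts n M l (t i))"
  proof -
    have "finite ((\<lambda>s. box (\<lambda>i. a i + s i) l) ` PiE UNIV (\<lambda>i. starts n M l (t i)))"
      by (intro finite_imageI finite_PiE) auto
    from finite_distinct_list[OF this] show ?thesis by blast
  qed
  from someI_ex[OF this]
  show "distinct (tile_list n M a l t)"
    "set (tile_list n M a l t) = (\<lambda>s. box (\<lambda>i. a i + s i) l) ` PiE UNIV (\<lambda>i. starts n M l (t i))"
    unfolding tile_list_def by auto
qed

lemma tile_list_subset:
  assumes "Q \<in> set (tile_list n M a l t)" "l \<le> n"
  shows "Q \<subseteq> box a n"
proof
  fix x assume x: "x \<in> Q"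
  obtain s where s: "\<And>i. s i \<in> starts n M l (t i)" "Q = box (\<lambda>i. a i + s i) l"
    using assms(1) by (auto simp: tile_list(2) PiE_iff)
  show "x \<in> box a n"
    unfolding box_def
  proof (intro CollectI allI)
    fix i
    have "0 \<le> s i \<and> s i \<le> n - l" using starts_range[OF s(1) assms(2)] .
    moreover have "a i + s i \<le> x i \<and> x i \<le> a i + s i + l - 1" using x by (simp add: s(2) box_def)
    ultimately show "a i \<le> x i \<and> x i \<le> a i + n - 1" by linarith
  qed
qed

lemma tile_list_separated:
  assumes "Q \<in> set (tile_list n M a l t)" "Q' \<in> set (tile_list n M a l t)" "Q \<noteq> Q'"
    and l: "l + 2 \<le> M" "2 * l + 2 \<le> n" and xy: "x \<in> Q" "y \<in> Q'"
  shows "3 \<le> l1dist x y"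
proof -
  obtain s where s: "\<And>i. s i \<in> starts n M l (t i)" "Q = box (\<lambda>i. a i + s i) l"
    using assms(1) by (auto simp: tile_list(2) PiE_iff)
  obtain s' where s': "\<And>i. s' i \<in> starts n M l (t i)" "Q' = box (\<lambda>i. a i + s' i) l"
    using assms(2) by (auto simp: tile_list(2) PiE_iff)
  obtain i where i: "s i \<noteq> s' i" using assms(3) s(2) s'(2) by (metis ext)
  have "l + 2 \<le> \<bar>s i - s' i\<bar>" by (rule starts_separated[OF s(1) s'(1) i l])
  moreover have "a i + s i \<le> x i \<and> x i \<le> a i + s i + l - 1" using xy by (simp add: s(2) box_def)
  moreover have "a i + s' i \<le> y i \<and> y i \<le> a i + s' i + l - 1" using xy by (simp add: s'(2) box_def)
  ultimately have "3 \<le> \<bar>x i - y i\<bar>" by linarith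
  then show ?thesis using abs_le_l1dist[of x i y] by linarith
qed

lemma in_tile_iff:
  "(\<exists>Q\<in>set (tile_list n M a l t). u \<in> Q) \<longleftrightarrow>
   (\<forall>i. \<exists>s\<in>starts n M l (t i). s \<le> u i - a i \<and> u i - a i \<le> s + l - 1)" (is "?L \<longleftrightarrow> ?R")
proof
  assume ?L
  then obtain s where "\<And>i. s i \<in> starts n M l (t i)" "u \<in> box (\<lambda>i. a i + s i) l"
    by (auto simp: tile_list(2) PiE_iff)
  then show ?R by (intro allI bexI[of _ "s _"]) (auto simp: box_def algebra_simps)
next
  assume ?R
  then obtain s where "\<forall>i. s i \<in> starts n M l (t i) \<and> s i \<le> u i - a i \<and> u i - a i \<le> s i + l - 1"
    by metis
  then show ?L unfolding tile_list(2)
    by (intro bexI[of _ "box (\<lambda>i. a i + s i) l"] imageI) (auto simp: box_def algebra_simps)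
qed

lemma bdry_tile_imp:
  assumes "Q \<in> set (tile_list n M a l t)" "u \<in> bdry Q"
  shows "\<exists>i. \<exists>s\<in>starts n M l (t i). u i - a i = s - 1 \<or> u i - a i = s + l"
proof -
  obtain s where s: "\<And>i. s i \<in> starts n M l (t i)" "Q = box (\<lambda>i. a i + s i) l"
    using assms(1) by (auto simp: tile_list(2) PiE_iff)
  obtain v where v: "v \<in> Q" "l1dist u v = 1" and u: "u \<notin> Q"
    using assms(2) by (auto simp: bdry_def adj_def)
  have "\<not> (\<forall>i. a i + s i \<le> u i \<and> u i \<le> a i + s i + l - 1)"
    using u unfolding s(2) box_def mem_Collect_eq .
  then obtain i where i: "u i < a i + s i \<or> a i + s i + l - 1 < u i" unfolding not_all de_Morgan_conj not_le by blast
  have "\<bar>u i - v i\<bar> \<le> 1" using abs_le_l1dist[of u i v] v(2) by simp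
  moreover have "a i + s i \<le> v i \<and> v i \<le> a i + s i + l - 1" using v(1) by (simp add: s(2) box_def)
  ultimately have "u i - a i = s i - 1 \<or> u i - a i = s i + l" using i by linarith
  then show ?thesis using s(1) by blast
qed

text \<open>A uniform index draws one side length, common to all coordinates so that tiles are
  cubes, and an independent type in each coordinate.\<close>

definition tile_index :: "int \<Rightarrow> int \<Rightarrow> (int \<times> ('d::finite \<Rightarrow> int)) set" where
  "tile_index L M = {L..<2 * L} \<times> PiE UNIV (\<lambda>_. {0..<2 * M})"

lemma finite_tile_index [simp]: "finite (tile_index L M)"
  unfolding tile_index_def by (intro finite_cartesian_product finite_PiE) auto

lemma card_tile_index:
  "card (tile_index L M :: (int \<times> ('d::finite \<Rightarrow> int)) set) = nat L * nat (2 * M) ^ CARD('d)"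
  by (simp add: tile_index_def card_cartesian_product card_PiE)

lemma card_tile_cover:
  fixes a u :: "'d::finite \<Rightarrow> int"
  assumes L: "1 \<le> L" "4 * L \<le> n" and M: "L \<le> M" and u: "u \<in> box a n"
  shows "nat L * nat L ^ CARD('d) \<le>
    card {(l, t) \<in> tile_index L M. \<exists>Q\<in>set (tile_list n M a l t). u \<in> Q}"
proof -
  have eq: "{(l, t) \<in> tile_index L M. \<exists>Q\<in>set (tile_list n M a l t). u \<in> Q} =
      Sigma {L..<2 * L} (\<lambda>l. PiE UNIV (\<lambda>i. covered n M l (u i - a i)))"
    unfolding in_tile_iff tile_index_def covered_def by (auto simp: PiE_iff)
  have "nat L * nat L ^ CARD('d) = (\<Sum>l\<in>{L..<2 * L}. \<Prod>i\<in>(UNIV :: 'd set). nat L)" using L by simp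
  also have "\<dots> \<le> (\<Sum>l\<in>{L..<2 * L}. \<Prod>i\<in>UNIV. card (covered n M l (u i - a i)))"
  proof (intro sum_mono prod_mono conjI)
    fix l i assume "l \<in> {L..<2 * L}"
    moreover have "a i \<le> u i \<and> u i \<le> a i + n - 1" using u by (simp add: box_def)
    ultimately show "nat L \<le> card (covered n M l (u i - a i))"
      using L M by (intro card_covered_ge) auto
  qed auto
  also have "\<dots> = card (Sigma {L..<2 * L} (\<lambda>l. PiE UNIV (\<lambda>i. covered n M l (u i - a i))))"
    by (subst card_SigmaI) (auto simp: card_PiE intro!: finite_PiE)
  finally show ?thesis unfolding eq .
qed

text \<open>Union bound over the coordinate in which \<open>u\<close> lies just outside its
  interval; the types of the other coordinates are left free.\<close>

lemma card_tile_bdry: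
  fixes a u :: "'d::finite \<Rightarrow> int"
  assumes L: "1 \<le> L" "2 * L \<le> n" and M: "0 < M" and u: "u \<in> box a n"
  shows "card {(l, t) \<in> tile_index L M. \<exists>Q\<in>set (tile_list n M a l t). u \<in> bdry Q} \<le>
    CARD('d) * ((2 * nat L + 2 * nat M) * nat (2 * M) ^ (CARD('d) - 1))"
proof -
  let ?G = "\<lambda>i l. PiE (UNIV :: 'd set) (\<lambda>j. if j = i then grazed n M l (u i - a i) else {0..<2 * M})"
  have finG: "finite (?G i l)" for i l by (intro finite_PiE) auto
  have cG: "card (?G i l) = card (grazed n M l (u i - a i)) * nat (2 * M) ^ (CARD('d) - 1)" for i l
  proof -
    have "card (?G i l) = (\<Prod>j\<in>UNIV. card (if j = i then grazed n M l (u i - a i) else {0..<2 * M}))"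
      by (rule card_PiE) simp
    also have "\<dots> = card (grazed n M l (u i - a i)) * (\<Prod>j\<in>UNIV - {i}. card (if j = i then grazed n M l (u i - a i) else {0..<2 * M}))"
      by (subst prod.remove[of _ i]) auto
    also have "(\<Prod>j\<in>UNIV - {i}. card (if j = i then grazed n M l (u i - a i) else {0..<2 * M})) = (\<Prod>j\<in>UNIV - {i}. nat (2 * M))"
      by (rule prod.cong) auto
    finally show ?thesis by (simp add: card_Diff_singleton)
  qed
  have "{(l, t) \<in> tile_index L M. \<exists>Q\<in>set (tile_list n M a l t). u \<in> bdry Q} \<subseteq>
      (\<Union>i\<in>UNIV. Sigma {L..<2 * L} (?G i))"
  proof clarify
    fix l t Q assume lt: "(l, t) \<in> tile_index L M" and Q: "Q \<in> set (tile_list n M a l t)" "u \<in> bdry Q"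
    obtain i where i: "\<exists>s\<in>starts n M l (t i). u i - a i = s - 1 \<or> u i - a i = s + l"
      using bdry_tile_imp[OF Q] by blast
    then have "t \<in> ?G i l" using lt by (auto simp: tile_index_def grazed_def PiE_iff)
    then show "(l, t) \<in> (\<Union>i\<in>UNIV. Sigma {L..<2 * L} (?G i))" using lt by (auto simp: tile_index_def)
  qed
  then have "card {(l, t) \<in> tile_index L M. \<exists>Q\<in>set (tile_list n M a l t). u \<in> bdry Q} \<le>
      card (\<Union>i\<in>UNIV. Sigma {L..<2 * L} (?G i))"
    using finG by (intro card_mono) auto
  also have "\<dots> \<le> (\<Sum>i\<in>UNIV. card (Sigma {L..<2 * L} (?G i)))" by (rule card_UN_le) simp
  also have "\<dots> \<le> (\<Sum>i\<in>(UNIV :: 'd set). (2 * nat L + 2 * nat M) * nat (2 * M) ^ (CARD('d) - 1))"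
  proof (rule sum_mono)
    fix i :: 'd
    have k: "0 \<le> u i - a i" "u i - a i < n" using u by (auto simp: box_def) (smt (verit))+
    have "card (Sigma {L..<2 * L} (?G i)) = (\<Sum>l\<in>{L..<2 * L}. card (grazed n M l (u i - a i))) * nat (2 * M) ^ (CARD('d) - 1)"
      using finG by (subst card_SigmaI) (auto simp: cG sum_distrib_right)
    also have "\<dots> \<le> (2 * nat L + 2 * nat M) * nat (2 * M) ^ (CARD('d) - 1)"
      by (intro mult_right_mono sum_card_grazed_le M L k) auto
    finally show "card (Sigma {L..<2 * L} (?G i)) \<le> (2 * nat L + 2 * nat M) * nat (2 * M) ^ (CARD('d) - 1)" .
  qed
  finally show ?thesis by simp
qed

section \<open>Gibbs distributions as spin fields\<close>

lemma eexp_nonneg: "0 \<le> eexp x"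
  by (cases x) (auto simp: eexp_def)

lemma eexp_ereal [simp]: "eexp (ereal r) = exp r"
  by (simp add: eexp_def)

lemma eexp_add: "x \<noteq> \<infinity> \<Longrightarrow> y \<noteq> \<infinity> \<Longrightarrow> eexp (x + y) = eexp x * eexp y"
  by (cases x; cases y) (auto simp: eexp_def exp_add)

lemma sum_ereal_neq_PInf: "(\<And>i. i \<in> I \<Longrightarrow> f i \<noteq> \<infinity>) \<Longrightarrow> (\<Sum>i\<in>I. f i) \<noteq> (\<infinity> :: ereal)"
  by (induction I rule: infinite_finite_induct) auto

lemma eexp_sum:
  assumes "finite I" "\<And>i. i \<in> I \<Longrightarrow> f i \<noteq> \<infinity>"
  shows "eexp (\<Sum>i\<in>I. f i) = (\<Prod>i\<in>I. eexp (f i))"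
  using assms
proof (induction I rule: finite_induct)
  case empty
  show ?case using eexp_ereal[of 0] by (simp add: zero_ereal_def)
next
  case (insert i I)
  then show ?case using sum_ereal_neq_PInf[of I f] by (simp add: eexp_add)
qed

lemma eexp_half: "eexp (ereal (1/2) * x) = sqrt (eexp x)"
proof (cases x)
  case (real r)
  have "exp (r / 2) = sqrt (exp r)"
    by (rule real_sqrt_unique[symmetric]) (auto simp: power2_eq_square exp_add[symmetric])
  then show ?thesis using real by (simp add: eexp_def)
qed (auto simp: eexp_def)

lemma sqrt_prod: "sqrt (\<Prod>i\<in>I. f i) = (\<Prod>i\<in>I. sqrt (f i))"
  by (induction I rule: infinite_finite_induct) (auto simp: real_sqrt_mult)

lemma half_ereal_neq_PInf: "x \<noteq> \<infinity> \<Longrightarrow> ereal (1/2) * x \<noteq> \<infinity>"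
  by (cases x) auto

text \<open>The square root compensates for \<open>weight\<close> seeing every edge in both
  directions.\<close>

definition edge_weight :: "('s \<Rightarrow> 's \<Rightarrow> ereal) \<Rightarrow> 's \<Rightarrow> 's \<Rightarrow> real" where
  "edge_weight U s t = sqrt (eexp (U s t))"

text \<open>\<open>hamil\<close> halves the interior ordered pairs and lists boundary pairs in one
  direction only; both match ordered pairs weighted by square roots. Boundary sites outside
  \<open>D\<close> are absent from \<open>hamil\<close> and contribute the factor 1 to
  \<open>weight\<close>.\<close>

lemma gweight_eq_weight:
  fixes \<tau> :: "('d::finite \<Rightarrow> int) \<Rightarrow> 's::finite"
  assumes U_sym: "\<And>s t. U s t = U t s" and U_fin: "\<And>s t. U s t \<noteq> \<infinity>"
    and A: "finite A" "A \<subseteq> D" and dom: "dom \<phi> = D \<inter> bdry A" and \<phi>: "\<And>x. x \<in> dom \<phi> \<Longrightarrow> \<phi> x = Some (\<tau> x)"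
  shows "gweight U W A \<phi> (restrict \<tau> A) = weight (edge_weight U) (\<lambda>s. exp (W s)) D A \<tau>"
proof -
  let ?I = "{(u, v). u \<in> A \<and> v \<in> A \<and> adj u v}"
  let ?B = "{(u, v). u \<in> dom \<phi> \<and> v \<in> A \<and> adj u v}"
  let ?O = "{(u, v). u \<notin> A \<and> v \<in> A \<and> adj u v}"
  let ?h = "edge_weight U"
  let ?w = "\<lambda>(u, v). if u \<in> D \<and> v \<in> D then ?h (\<tau> u) (\<tau> v) else 1"
  have domA: "x \<notin> A" if "x \<in> dom \<phi>" for x using that dom by (auto simp: bdry_def)
  have fT: "finite (touching A)" using A finite_touching by auto
  have fI: "finite ?I" and fB: "finite ?B" and fO: "finite ?O"
    by (rule finite_subset[OF _ fT]; auto simp: touching_def)+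
  have hsym: "?h s t = ?h t s" for s t by (simp add: edge_weight_def U_sym)
  have hsq: "(?h s t)\<^sup>2 = eexp (U s t)" for s t
    using eexp_nonneg[of "U s t"] by (simp add: edge_weight_def)
  define SI where "SI = (\<Sum>(u, v)\<in>?I. U (restrict \<tau> A u) (restrict \<tau> A v))"
  define SB where "SB = (\<Sum>(u, v)\<in>?B. U (the (\<phi> u)) (restrict \<tau> A v))"
  have SI: "SI \<noteq> \<infinity>" unfolding SI_def by (rule sum_ereal_neq_PInf) (auto simp: U_fin)
  have SB: "SB \<noteq> \<infinity>" unfolding SB_def by (rule sum_ereal_neq_PInf) (auto simp: U_fin)
  have 1: "eexp (ereal (1/2) * SI) = (\<Prod>(u, v)\<in>?I. ?h (\<tau> u) (\<tau> v))"
    unfolding eexp_half SI_def edge_weight_def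
    by (subst eexp_sum[OF fI]) (auto simp: U_fin sqrt_prod case_prod_unfold intro!: prod.cong)
  have 2: "eexp SB = (\<Prod>(u, v)\<in>?B. (?h (\<tau> u) (\<tau> v))\<^sup>2)"
    unfolding hsq SB_def
    by (subst eexp_sum[OF fB]) (auto simp: U_fin case_prod_unfold \<phi> intro!: prod.cong)
  have 3: "eexp (ereal (\<Sum>u\<in>A. W (restrict \<tau> A u))) = (\<Prod>v\<in>A. exp (W (\<tau> v)))"
    using A(1) by (simp add: exp_sum)
  have out: "(\<Prod>e\<in>?O. ?w e) = (\<Prod>(u, v)\<in>?B. ?h (\<tau> u) (\<tau> v))"
  proof -
    have "(\<Prod>e\<in>?O. ?w e) = (\<Prod>e\<in>?B. ?w e)"
      using dom by (intro prod.mono_neutral_right fO) (auto simp: bdry_def)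
    also have "\<dots> = (\<Prod>(u, v)\<in>?B. ?h (\<tau> u) (\<tau> v))"
      by (rule prod.cong) (use A dom in auto)
    finally show ?thesis .
  qed
  have swap: "(\<Prod>e\<in>prod.swap ` ?O. ?w e) = (\<Prod>e\<in>?O. ?w e)"
    by (subst prod.reindex) (auto simp: hsym conj_commute intro!: prod.cong)
  have T: "touching A = ?I \<union> (?O \<union> prod.swap ` ?O)"
    by (auto simp: touching_def adj_commute image_iff)
  have "(\<Prod>e\<in>touching A. ?w e) = (\<Prod>e\<in>?I. ?w e) * ((\<Prod>e\<in>?O. ?w e) * (\<Prod>e\<in>prod.swap ` ?O. ?w e))"
  proof -
    have d1: "?I \<inter> (?O \<union> prod.swap ` ?O) = {}" and d2: "?O \<inter> prod.swap ` ?O = {}" by auto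
    show ?thesis
      unfolding T prod.union_disjoint[OF fI finite_UnI[OF fO finite_imageI[OF fO]] d1]
        prod.union_disjoint[OF fO finite_imageI[OF fO] d2] ..
  qed
  also have "(\<Prod>e\<in>?I. ?w e) = (\<Prod>(u, v)\<in>?I. ?h (\<tau> u) (\<tau> v))"
    by (rule prod.cong) (use A in auto)
  finally have w: "(\<Prod>e\<in>touching A. ?w e) =
      (\<Prod>(u, v)\<in>?I. ?h (\<tau> u) (\<tau> v)) * (\<Prod>(u, v)\<in>?B. (?h (\<tau> u) (\<tau> v))\<^sup>2)"
    unfolding swap out by (simp add: prod.distrib[symmetric] power2_eq_square case_prod_unfold)
  have "gweight U W A \<phi> (restrict \<tau> A) =
      eexp (ereal (1/2) * SI + SB + ereal (\<Sum>u\<in>A. W (restrict \<tau> A u)))"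
    by (simp add: gweight_def hamil_def SI_def SB_def)
  also have "\<dots> = eexp (ereal (1/2) * SI) * eexp SB * eexp (ereal (\<Sum>u\<in>A. W (restrict \<tau> A u)))"
    using half_ereal_neq_PInf[OF SI] SB by (subst eexp_add; (subst eexp_add)?) auto
  finally show ?thesis unfolding 1 2 3 weight_def w by simp
qed


text \<open>\<open>D\<close> is the set of sites carrying a spin: \<open>V\<close> itself and,
  outside \<open>V\<close>, the sites where a boundary spin is prescribed.\<close>

locale gibbs_field =
  fixes U :: "'s::finite \<Rightarrow> 's \<Rightarrow> ereal" and W :: "'s \<Rightarrow> real" and D V :: "('d::finite \<Rightarrow> int) set"
  assumes U_sym: "\<And>s t. U s t = U t s"
    and U_fin: "\<And>s t. U s t \<noteq> \<infinity>"
    and perm: "permissive U W TYPE('d)"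
    and irr: "glauber_irreducible U W TYPE('d)"
    and fin: "finite V" and VD: "V \<subseteq> D"
begin

text \<open>For a block \<open>A\<close> inside \<open>V\<close> this combines spins of
  \<open>V\<close> next to \<open>A\<close> with the prescribed boundary spins. Mixing and
  irreducibility are assumed for all boundary conditions, so they apply to \<open>A\<close> in its
  actual surroundings.\<close>

definition bc_of :: "('d \<Rightarrow> int) set \<Rightarrow> (('d \<Rightarrow> int) \<Rightarrow> 's) \<Rightarrow> (('d \<Rightarrow> int) \<rightharpoonup> 's)" where
  "bc_of A \<sigma> = (\<lambda>x. if x \<in> D \<inter> bdry A then Some (\<sigma> x) else None)"

lemma is_bc_of: "is_bc A (bc_of A \<sigma>)"
  by (auto simp: is_bc_def bc_of_def split: if_splits)

lemma gweight_restrict: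
  assumes "A \<subseteq> V" "\<tau> \<in> cyl A \<sigma>"
  shows "gweight U W A (bc_of A \<sigma>) (restrict \<tau> A) = weight (edge_weight U) (\<lambda>s. exp (W s)) D A \<tau>"
proof (rule gweight_eq_weight[OF U_sym U_fin])
  show "dom (bc_of A \<sigma>) = D \<inter> bdry A" by (auto simp: bc_of_def split: if_splits)
  show "bc_of A \<sigma> x = Some (\<tau> x)" if "x \<in> dom (bc_of A \<sigma>)" for x
    using that assms(2) by (auto simp: bc_of_def bdry_def cyl_iff split: if_splits)
qed (use assms fin VD finite_subset in auto)

definition emb :: "('d \<Rightarrow> int) set \<Rightarrow> (('d \<Rightarrow> int) \<Rightarrow> 's) \<Rightarrow> (('d \<Rightarrow> int) \<Rightarrow> 's) \<Rightarrow> ('d \<Rightarrow> int) \<Rightarrow> 's" where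
  "emb A \<sigma> \<eta> = (\<lambda>x. if x \<in> A then \<eta> x else \<sigma> x)"

lemma emb_cyl [simp]: "emb A \<sigma> \<eta> \<in> cyl A \<sigma>"
  by (simp add: emb_def cyl_iff)

lemma restrict_emb: "\<eta> \<in> configs A \<Longrightarrow> restrict (emb A \<sigma> \<eta>) A = \<eta>"
  by (auto simp: emb_def configs_def PiE_def extensional_def fun_eq_iff)

lemma emb_restrict: "\<tau> \<in> cyl A \<sigma> \<Longrightarrow> emb A \<sigma> (restrict \<tau> A) = \<tau>"
  by (auto simp: emb_def cyl_iff fun_eq_iff)

lemma restrict_configs [simp]: "restrict \<tau> A \<in> configs A"
  by (simp add: configs_def)

sublocale spin_field "edge_weight U" "\<lambda>s. exp (W s)" D V
proof
  fix A and \<sigma> :: "('d \<Rightarrow> int) \<Rightarrow> 's" assume A: "A \<subseteq> V"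
  have "finite A" using A fin finite_subset by auto
  then obtain \<eta> where \<eta>: "\<eta> \<in> Omega U W A (bc_of A \<sigma>)"
    using perm is_bc_of unfolding permissive_def by blast
  then have "restrict (emb A \<sigma> \<eta>) A = \<eta>" by (intro restrict_emb) (simp add: Omega_def)
  then have "weight (edge_weight U) (\<lambda>s. exp (W s)) D A (emb A \<sigma> \<eta>) > 0"
    using \<eta> gweight_restrict[OF A emb_cyl, of \<sigma> \<eta>] by (simp add: Omega_def)
  then show "\<exists>\<tau>\<in>cyl A \<sigma>. weight (edge_weight U) (\<lambda>s. exp (W s)) D A \<tau> > 0"
    using emb_cyl by blast
qed (use fin in \<open>auto simp: edge_weight_def eexp_nonneg\<close>)

lemma w_emb:
  assumes "A \<subseteq> V" "\<eta> \<in> configs A"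
  shows "w A (emb A \<sigma> \<eta>) = gweight U W A (bc_of A \<sigma>) \<eta>"
  using gweight_restrict[OF assms(1) emb_cyl, of \<sigma> \<eta>] by (simp add: restrict_emb[OF assms(2)])

lemma Omega_iff:
  assumes "A \<subseteq> V"
  shows "\<eta> \<in> Omega U W A (bc_of A \<sigma>) \<longleftrightarrow> \<eta> \<in> configs A \<and> 0 < w A (emb A \<sigma> \<eta>)"
  using w_emb[OF assms] by (auto simp: Omega_def)

lemma bij_betw_emb: "bij_betw (emb A \<sigma>) (configs A) (cyl A \<sigma>)"
  by (rule bij_betw_byWitness[where f' = "\<lambda>\<tau>. restrict \<tau> A"]) (auto simp: restrict_emb emb_restrict)

lemma finite_configs: "A \<subseteq> V \<Longrightarrow> finite (configs A :: (('d \<Rightarrow> int) \<Rightarrow> 's) set)"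
  using bij_betw_finite[OF bij_betw_emb] finite_cyl[OF finA] by blast

lemma finite_Omega: "A \<subseteq> V \<Longrightarrow> finite (Omega U W A \<phi>)"
  by (rule finite_subset[OF _ finite_configs]) (auto simp: Omega_def)

lemma sum_Omega:
  assumes A: "A \<subseteq> V"
  shows "(\<Sum>\<eta>\<in>Omega U W A (bc_of A \<sigma>). gweight U W A (bc_of A \<sigma>) \<eta> * F \<eta>) =
    (\<Sum>\<tau>\<in>cyl A \<sigma>. w A \<tau> * F (restrict \<tau> A))"
proof -
  have "(\<Sum>\<eta>\<in>Omega U W A (bc_of A \<sigma>). gweight U W A (bc_of A \<sigma>) \<eta> * F \<eta>) =
      (\<Sum>\<eta>\<in>Omega U W A (bc_of A \<sigma>). w A (emb A \<sigma> \<eta>) * F \<eta>)"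
    using w_emb[OF A] by (intro sum.cong) (auto simp: Omega_def)
  also have "\<dots> = (\<Sum>\<eta>\<in>configs A. w A (emb A \<sigma> \<eta>) * F \<eta>)"
  proof (rule sum.mono_neutral_left[OF finite_configs[OF A]])
    show "\<forall>\<eta>\<in>configs A - Omega U W A (bc_of A \<sigma>). w A (emb A \<sigma> \<eta>) * F \<eta> = 0"
      using Omega_iff[OF A] w_nonneg by (metis DiffE linorder_not_less mult_eq_0_iff order_antisym)
  qed (auto simp: Omega_def)
  also have "\<dots> = (\<Sum>\<eta>\<in>configs A. w A (emb A \<sigma> \<eta>) * F (restrict (emb A \<sigma> \<eta>) A))"
    by (intro sum.cong refl) (simp add: restrict_emb)
  also have "\<dots> = (\<Sum>\<tau>\<in>cyl A \<sigma>. w A \<tau> * F (restrict \<tau> A))"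
    by (rule sum.reindex_bij_betw[OF bij_betw_emb])
  finally show ?thesis .
qed

lemma sum_gibbs:
  assumes A: "A \<subseteq> V"
  shows "(\<Sum>\<eta>\<in>Omega U W A (bc_of A \<sigma>). gibbs U W A (bc_of A \<sigma>) \<eta> * F \<eta>) = avg A (\<lambda>\<tau>. F (restrict \<tau> A)) \<sigma>"
proof -
  have "(\<Sum>\<eta>\<in>Omega U W A (bc_of A \<sigma>). gweight U W A (bc_of A \<sigma>) \<eta>) = Z A \<sigma>"
    using sum_Omega[OF A, of \<sigma> "\<lambda>_. 1"] by (simp add: Z_def)
  then show ?thesis
    using sum_Omega[OF A, of \<sigma> F] by (simp add: gibbs_def avg_def sum_divide_distrib[symmetric])
qed

lemma avg_restrict:
  assumes A: "A \<subseteq> V" and B: "B \<subseteq> A"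
    and R: "finite R" "(\<lambda>\<eta>. restrict \<eta> B) ` Omega U W A (bc_of A \<sigma>) \<subseteq> R"
  shows "avg A (\<lambda>\<tau>. F (restrict \<tau> B)) \<sigma> =
    (\<Sum>\<zeta>\<in>R. (\<Sum>\<eta>\<in>{\<eta> \<in> Omega U W A (bc_of A \<sigma>). restrict \<eta> B = \<zeta>}. gibbs U W A (bc_of A \<sigma>) \<eta>) * F \<zeta>)"
proof -
  have "avg A (\<lambda>\<tau>. F (restrict \<tau> B)) \<sigma> = avg A (\<lambda>\<tau>. F (restrict (restrict \<tau> A) B)) \<sigma>"
    using B by (simp add: Int_absorb1 Int_commute)
  also have "\<dots> = (\<Sum>\<eta>\<in>Omega U W A (bc_of A \<sigma>). gibbs U W A (bc_of A \<sigma>) \<eta> * F (restrict \<eta> B))"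
    by (rule sum_gibbs[OF A, symmetric])
  also have "\<dots> = (\<Sum>\<zeta>\<in>R. \<Sum>\<eta>\<in>{\<eta> \<in> Omega U W A (bc_of A \<sigma>). restrict \<eta> B = \<zeta>}. gibbs U W A (bc_of A \<sigma>) \<eta> * F (restrict \<eta> B))"
    by (rule sum.group[OF finite_Omega[OF A] R, symmetric])
  also have "\<dots> = (\<Sum>\<zeta>\<in>R. (\<Sum>\<eta>\<in>{\<eta> \<in> Omega U W A (bc_of A \<sigma>). restrict \<eta> B = \<zeta>}. gibbs U W A (bc_of A \<sigma>) \<eta>) * F \<zeta>)"
    unfolding sum_distrib_right by (intro sum.cong refl) simp
  finally show ?thesis .
qed

text \<open>The 2 undoes the factor \<open>1/2\<close> in \<open>tv_marginal\<close>, since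
  \<open>F\<close> may range over the whole interval from -1 to 1.\<close>

lemma avg_diff_le_tv:
  assumes A: "A \<subseteq> V" and B: "B \<subseteq> A" and F: "\<And>\<zeta>. \<bar>F \<zeta>\<bar> \<le> 1"
  shows "\<bar>avg A (\<lambda>\<tau>. F (restrict \<tau> B)) \<sigma> - avg A (\<lambda>\<tau>. F (restrict \<tau> B)) \<sigma>'\<bar>
    \<le> 2 * tv_marginal U W A (bc_of A \<sigma>) (bc_of A \<sigma>') B"
proof -
  let ?R = "(\<lambda>\<eta>. restrict \<eta> B) ` (Omega U W A (bc_of A \<sigma>) \<union> Omega U W A (bc_of A \<sigma>'))"
  let ?p = "\<lambda>\<sigma> \<zeta>. \<Sum>\<eta>\<in>{\<eta> \<in> Omega U W A (bc_of A \<sigma>). restrict \<eta> B = \<zeta>}. gibbs U W A (bc_of A \<sigma>) \<eta>"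
  have fR: "finite ?R" using finite_Omega[OF A] by simp
  have "avg A (\<lambda>\<tau>. F (restrict \<tau> B)) \<sigma> = (\<Sum>\<zeta>\<in>?R. ?p \<sigma> \<zeta> * F \<zeta>)"
    by (rule avg_restrict[OF A B fR]) auto
  moreover have "avg A (\<lambda>\<tau>. F (restrict \<tau> B)) \<sigma>' = (\<Sum>\<zeta>\<in>?R. ?p \<sigma>' \<zeta> * F \<zeta>)"
    by (rule avg_restrict[OF A B fR]) auto
  ultimately have "\<bar>avg A (\<lambda>\<tau>. F (restrict \<tau> B)) \<sigma> - avg A (\<lambda>\<tau>. F (restrict \<tau> B)) \<sigma>'\<bar> =
      \<bar>\<Sum>\<zeta>\<in>?R. (?p \<sigma> \<zeta> - ?p \<sigma>' \<zeta>) * F \<zeta>\<bar>"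
    by (simp add: sum_subtractf left_diff_distrib)
  also have "\<dots> \<le> (\<Sum>\<zeta>\<in>?R. \<bar>(?p \<sigma> \<zeta> - ?p \<sigma>' \<zeta>) * F \<zeta>\<bar>)" by (rule sum_abs)
  also have "\<dots> \<le> (\<Sum>\<zeta>\<in>?R. \<bar>?p \<sigma> \<zeta> - ?p \<sigma>' \<zeta>\<bar>)"
  proof (rule sum_mono)
    fix \<zeta>
    show "\<bar>(?p \<sigma> \<zeta> - ?p \<sigma>' \<zeta>) * F \<zeta>\<bar> \<le> \<bar>?p \<sigma> \<zeta> - ?p \<sigma>' \<zeta>\<bar>"
      using mult_left_mono[OF F[of \<zeta>], of "\<bar>?p \<sigma> \<zeta> - ?p \<sigma>' \<zeta>\<bar>"] by (simp add: abs_mult)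
  qed
  finally show ?thesis by (simp add: tv_marginal_def)
qed

lemma mixing_cube:
  assumes Q: "Q \<subseteq> V" "is_cube Q" and ab: "0 < a" "0 < b"
    and ssm: "\<And>B u \<psi> \<psi>'. B \<subseteq> Q \<Longrightarrow> u \<in> bdry Q \<Longrightarrow> is_bc Q \<psi> \<Longrightarrow> is_bc Q \<psi>' \<Longrightarrow> (\<forall>x. x \<noteq> u \<longrightarrow> \<psi> x = \<psi>' x) \<Longrightarrow>
      tv_marginal U W Q \<psi> \<psi>' B \<le> b * exp (- a * real_of_int (set_dist u B))"
  shows "mixing m (2 * b * exp (- a * real m)) Q"
  unfolding mixing_def
proof (intro ballI allI impI)
  fix u \<sigma> s and H :: "(('d \<Rightarrow> int) \<Rightarrow> 's) \<Rightarrow> real"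
  assume u: "u \<in> V \<inter> bdry Q" and H1: "\<forall>\<tau>. \<bar>H \<tau>\<bar> \<le> 1"
    and H2: "\<forall>\<tau> \<tau>'. (\<forall>x\<in>Q. int m < l1dist u x \<longrightarrow> \<tau> x = \<tau>' x) \<longrightarrow> H \<tau> = H \<tau>'"
  define B where "B = {x \<in> Q. int m < l1dist u x}"
  have BQ: "B \<subseteq> Q" by (auto simp: B_def)
  show "\<bar>avg Q H \<sigma> - avg Q H (\<sigma>(u := s))\<bar> \<le> 2 * b * exp (- a * real m)"
  proof (cases "B = {}")
    \<comment> \<open>\<open>set_dist\<close> is meaningful only for a nonempty set. If no site of
      \<open>Q\<close> is farther than \<open>m\<close>, the test function is constant.\<close>
    case True
    then have "H = (\<lambda>_. H \<sigma>)" using H2 by (intro ext) (auto simp: B_def)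
    then have "avg Q H \<sigma> = H \<sigma>" "avg Q H (\<sigma>(u := s)) = H \<sigma>" using avg_const[OF Q(1)] by metis+
    then show ?thesis using ab by simp
  next
    case False
    have "H \<tau> = H (restrict \<tau> B)" for \<tau> using H2[rule_format, of \<tau> "restrict \<tau> B"] by (auto simp: B_def)
    then have "\<bar>avg Q H \<sigma> - avg Q H (\<sigma>(u := s))\<bar> =
        \<bar>avg Q (\<lambda>\<tau>. H (restrict \<tau> B)) \<sigma> - avg Q (\<lambda>\<tau>. H (restrict \<tau> B)) (\<sigma>(u := s))\<bar>" by presburger
    also have "\<dots> \<le> 2 * tv_marginal U W Q (bc_of Q \<sigma>) (bc_of Q (\<sigma>(u := s))) B"
      by (rule avg_diff_le_tv[OF Q(1) BQ]) (use H1 in auto)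
    also have "\<dots> \<le> 2 * (b * exp (- a * real_of_int (set_dist u B)))"
      by (intro mult_left_mono ssm[OF BQ _ is_bc_of is_bc_of]) (use u in \<open>auto simp: bc_of_def\<close>)
    also have "\<dots> \<le> 2 * (b * exp (- a * real m))"
    proof -
      have "finite B" using finite_subset[OF BQ finA[OF Q(1)]] .
      then have "int m \<le> set_dist u B" unfolding set_dist_def using False by (auto simp: B_def)
      then have "real m \<le> real_of_int (set_dist u B)" by linarith
      then show ?thesis using ab by (intro mult_left_mono) auto
    qed
    finally show ?thesis by simp
  qed
qed

end

section \<open>Uniform weight bounds and the choice of scales\<close>

lemma ex_weight_const:
  fixes U :: "'s::finite \<Rightarrow> 's \<Rightarrow> ereal" and W :: "'s \<Rightarrow> real"
  obtains c :: real where "0 < c" "c \<le> 1"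
    "\<And>s t. edge_weight U s t \<noteq> 0 \<Longrightarrow> c \<le> edge_weight U s t" "\<And>s t. edge_weight U s t \<le> 1 / c"
    "\<And>s. c \<le> exp (W s)" "\<And>s. exp (W s) \<le> 1 / c"
proof -
  define S where "S = {x \<in> range (\<lambda>(s, t). edge_weight U s t) \<union> range (\<lambda>s. exp (W s)). 0 < x}"
  \<comment> \<open>With 1 and all reciprocals included, a single minimum yields
    \<open>c \<le> 1\<close>, the lower bounds and the upper bounds.\<close>
  define T where "T = insert 1 (S \<union> (\<lambda>x. 1 / x) ` S)"
  have fT: "finite T" by (simp add: T_def S_def)
  define c where "c = Min T"
  have "c \<in> T" unfolding c_def by (rule Min_in[OF fT]) (simp add: T_def)
  then have c0: "0 < c" by (auto simp: T_def S_def)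
  have cle: "c \<le> x" if "x \<in> T" for x unfolding c_def using Min_le[OF fT that] .
  have S: "c \<le> x \<and> x \<le> 1 / c" if x: "x \<in> S" for x
  proof -
    have "0 < x" using x by (simp add: S_def)
    moreover have "c \<le> x" "c \<le> 1 / x" using x by (auto intro!: cle simp: T_def)
    ultimately show ?thesis using c0 by (simp add: field_simps)
  qed
  have e: "0 \<le> edge_weight U s t" for s t by (simp add: edge_weight_def eexp_nonneg)
  have eS: "edge_weight U s t \<in> S" if "edge_weight U s t \<noteq> 0" for s t
    using that e[of s t] by (auto simp: S_def)
  have WS: "exp (W s) \<in> S" for s by (simp add: S_def)
  show ?thesis
  proof (rule that[OF c0])
    show "c \<le> 1" by (rule cle) (simp add: T_def)
    show "c \<le> edge_weight U s t" if "edge_weight U s t \<noteq> 0" for s t using S[OF eS[OF that]] by simp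
    show "edge_weight U s t \<le> 1 / c" for s t
      using S[OF eS, of s t] c0 by (cases "edge_weight U s t = 0") auto
    show "c \<le> exp (W s)" "exp (W s) \<le> 1 / c" for s using S[OF WS] by auto
  qed
qed

lemma prod_ge_power:
  fixes c :: real
  assumes "0 \<le> c" "c \<le> 1" "\<And>i. i \<in> I \<Longrightarrow> c \<le> f i" "card I \<le> n"
  shows "c ^ n \<le> (\<Prod>i\<in>I. f i)"
proof -
  have "c ^ n \<le> (\<Prod>i\<in>I. c)" using power_decreasing[OF assms(4,1,2)] by simp
  also have "\<dots> \<le> (\<Prod>i\<in>I. f i)" using assms by (intro prod_mono) auto
  finally show ?thesis .
qed

lemma prod_le_power:
  fixes c :: real
  assumes "1 \<le> c" "\<And>i. i \<in> I \<Longrightarrow> 0 \<le> f i \<and> f i \<le> c" "card I \<le> n"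
  shows "(\<Prod>i\<in>I. f i) \<le> c ^ n"
proof -
  have "(\<Prod>i\<in>I. f i) \<le> (\<Prod>i\<in>I. c)" using assms by (intro prod_mono) auto
  also have "\<dots> \<le> c ^ n" using power_increasing[OF assms(3,1)] by simp
  finally show ?thesis .
qed

text \<open>The Poincare constant of a cube with at most \<open>N\<close> sites: paths in the Glauber graph have length at
  most \<open>(q ^ N)\<^sup>2\<close>, the fraction in the denominator bounds the Gibbs probabilities of valid configurations
  from below, and the final \<open>N\<close> accounts for the sites sharing a block.\<close>

definition loc_const :: "nat \<Rightarrow> nat \<Rightarrow> real \<Rightarrow> nat \<Rightarrow> real" where
  "loc_const q d c N =
     4 * real (q ^ N) ^ 4 / (c ^ (2 * (2 * N * 3 ^ d + N)) / real (q ^ N)) * real N"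

text \<open>The bracket is the factor \<open>K\<close> lost at a boundary site: of order
  \<open>m ^ d\<close>, plus the mixing error times the volume of a tile. With
  \<open>L = m ^ (d + 1)\<close> the first part is beaten by a spare factor \<open>m\<close>, and
  the exponential absorbs the volume, of order \<open>m ^ ((d + 1) * d)\<close>. The prefactor comes
  from the tiling counts, as \<open>2 * d * (8 * L) * (6 * L) ^ (d - 1)\<close> divided by
  \<open>L ^ d\<close>.\<close>

lemma ex_scale:
  fixes a b :: real and d :: nat
  assumes ab: "0 < a" "0 < b" and d: "1 \<le> d"
  obtains m L :: nat where "1 \<le> L"
    "16 * real d * 6 ^ (d - 1) * (2 * (2 * real m + 1) ^ d + 1 + real ((2 * L) ^ d) * (2 * b * exp (- a * real m))) \<le> real L"
proof -
  define P where "P = (d + 1) * d"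
  define \<epsilon> where "\<epsilon> = a ^ P / (2 ^ d * (2 * b))"
  have \<epsilon>: "0 < \<epsilon>" using ab by (simp add: \<epsilon>_def)
  define R where "R = 16 * real d * 6 ^ (d - 1) * (2 * 3 ^ d + 2)"
  have "filterlim (\<lambda>m. a * real m) at_top sequentially"
    using ab(1) by (intro filterlim_tendsto_pos_mult_at_top[OF tendsto_const] filterlim_real_sequentially)
  then have "(\<lambda>m. (a * real m) ^ P / exp (a * real m)) \<longlonglongrightarrow> 0"
    by (rule filterlim_compose[OF tendsto_power_div_exp_0])
  then have "\<forall>\<^sub>F m in sequentially. (a * real m) ^ P / exp (a * real m) < \<epsilon>"
    using \<epsilon> by (rule order_tendstoD(2))
  moreover have "\<forall>\<^sub>F m in sequentially. R \<le> real m"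
    using filterlim_real_sequentially by (simp add: filterlim_at_top)
  ultimately have "\<forall>\<^sub>F m in sequentially. (a * real m) ^ P / exp (a * real m) < \<epsilon> \<and> R \<le> real m \<and> 1 \<le> m"
    using eventually_ge_at_top[of "1 :: nat"] by eventually_elim auto
  then obtain m where m: "(a * real m) ^ P / exp (a * real m) < \<epsilon>" "R \<le> real m" "1 \<le> m"
    using eventually_happens'[OF sequentially_bot] by blast
  define L where "L = m ^ (d + 1)"
  have lt: "real m ^ P * exp (- a * real m) < 1 / (2 ^ d * (2 * b))"
  proof -
    have "a ^ P * (real m ^ P * exp (- a * real m)) < a ^ P * (1 / (2 ^ d * (2 * b)))"
      using m(1) by (simp add: \<epsilon>_def exp_minus power_mult_distrib field_simps)
    moreover have "0 < a ^ P" using ab by simp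
    ultimately show ?thesis by (simp only: mult_less_cancel_left_pos)
  qed
  have far: "real ((2 * L) ^ d) * (2 * b * exp (- a * real m)) \<le> 1"
  proof -
    have eq: "real ((2 * L) ^ d) = 2 ^ d * real m ^ P"
      by (simp only: L_def P_def of_nat_power of_nat_mult of_nat_numeral power_mult_distrib power_mult)
    have "real ((2 * L) ^ d) * (2 * b * exp (- a * real m)) =
        (2 ^ d * (2 * b)) * (real m ^ P * exp (- a * real m))"
      unfolding eq by (simp only: mult_ac)
    also have "\<dots> \<le> (2 ^ d * (2 * b)) * (1 / (2 ^ d * (2 * b)))"
      using lt ab by (intro mult_left_mono) auto
    also have "\<dots> = 1" using ab by simp
    finally show ?thesis .
  qed
  have "2 * (2 * real m + 1) ^ d \<le> 2 * (3 * real m) ^ d"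
    using m(3) by (intro mult_left_mono power_mono) auto
  also have "\<dots> = 2 * 3 ^ d * real m ^ d" by (simp add: power_mult_distrib)
  finally have near: "2 * (2 * real m + 1) ^ d \<le> 2 * 3 ^ d * real m ^ d" .
  have "1 \<le> real m ^ d" using m(3) by simp
  then have "2 * (2 * real m + 1) ^ d + 1 + real ((2 * L) ^ d) * (2 * b * exp (- a * real m)) \<le> (2 * 3 ^ d + 2) * real m ^ d"
    using near far by (simp add: algebra_simps)
  then have "16 * real d * 6 ^ (d - 1) * (2 * (2 * real m + 1) ^ d + 1 + real ((2 * L) ^ d) * (2 * b * exp (- a * real m)))
      \<le> 16 * real d * 6 ^ (d - 1) * ((2 * 3 ^ d + 2) * real m ^ d)"
    by (intro mult_left_mono) auto
  also have "\<dots> = R * real m ^ d" by (simp add: R_def)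
  also have "\<dots> \<le> real m * real m ^ d" using m(2) by (intro mult_right_mono) auto
  also have "\<dots> = real L" by (simp add: L_def)
  finally show ?thesis using m(3) by (intro that[of L m]) (auto simp: L_def)
qed

section \<open>Poincare inequalities for small and large cubes\<close>

context gibbs_field
begin

lemma w_bounds:
  assumes A: "A \<subseteq> V" "card A \<le> N" and c: "0 < c" "c \<le> 1"
    and U: "\<And>s t. edge_weight U s t \<noteq> 0 \<Longrightarrow> c \<le> edge_weight U s t" "\<And>s t. edge_weight U s t \<le> 1 / c"
    and W: "\<And>s. c \<le> exp (W s)" "\<And>s. exp (W s) \<le> 1 / c"
  shows "w A \<tau> \<le> (1 / c) ^ (2 * N * 3 ^ CARD('d) + N)"
    and "0 < w A \<tau> \<Longrightarrow> c ^ (2 * N * 3 ^ CARD('d) + N) \<le> w A \<tau>"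
proof -
  let ?f = "\<lambda>(u, v). if u \<in> D \<and> v \<in> D then edge_weight U (\<tau> u) (\<tau> v) else 1"
  let ?E = "2 * N * 3 ^ CARD('d)"
  have "card (touching A) \<le> 2 * card A * 3 ^ CARD('d)" by (rule card_touching[OF finA[OF A(1)]])
  also have "\<dots> \<le> ?E" using A(2) by simp
  finally have cT: "card (touching A) \<le> ?E" .
  have c1: "1 \<le> 1 / c" using c by simp
  have "(\<Prod>e\<in>touching A. ?f e) \<le> (1 / c) ^ ?E"
    using c1 U(2) cT by (intro prod_le_power) (auto simp: h_nonneg split: prod.split)
  moreover have "(\<Prod>v\<in>A. exp (W (\<tau> v))) \<le> (1 / c) ^ N"
    using c1 W(2) A(2) by (intro prod_le_power) auto
  ultimately show "w A \<tau> \<le> (1 / c) ^ (?E + N)"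
    unfolding weight_def power_add using c by (intro mult_mono prod_nonneg) auto
  assume "0 < w A \<tau>"
  then have nz: "(\<Prod>e\<in>touching A. ?f e) \<noteq> 0" by (auto simp: weight_def)
  have "?f e \<noteq> 0" if "e \<in> touching A" for e
    using nz finite_touching[OF finA[OF A(1)]] that by (meson prod_zero_iff)
  then have "c \<le> ?f e" if "e \<in> touching A" for e
    using that U(1) c(2) by (force split: prod.splits if_splits)
  then have "c ^ ?E \<le> (\<Prod>e\<in>touching A. ?f e)"
    using c cT by (intro prod_ge_power) auto
  moreover have "c ^ N \<le> (\<Prod>v\<in>A. exp (W (\<tau> v)))"
    using c W(1) A(2) by (intro prod_ge_power) auto
  ultimately show "c ^ (?E + N) \<le> w A \<tau>"
    unfolding weight_def power_add using c by (intro mult_mono prod_nonneg) (auto simp: h_nonneg)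
qed

text \<open>Irreducibility is applied to the region \<open>A\<close> with the boundary condition
  read off \<sigma>. A step of positive Glauber probability alters one site only, so a path of
  extensional configurations lifts through \<open>emb\<close>.\<close>

lemma glauber_connected:
  assumes A: "A \<subseteq> V" and S: "S = {\<tau> \<in> cyl A \<sigma>. 0 < w A \<tau>}" and t: "\<tau> \<in> S" "\<tau>' \<in> S"
  shows "(\<tau>, \<tau>') \<in> {(\<tau>, \<tau>'). \<tau> \<in> S \<and> \<tau>' \<in> S \<and> (\<exists>x\<in>A. \<tau>' \<in> cyl {x} \<tau>)}\<^sup>*"
proof -
  let ?\<phi> = "bc_of A \<sigma>"
  let ?\<Omega> = "Omega U W A ?\<phi>"
  let ?G = "{(x, y). x \<in> ?\<Omega> \<and> y \<in> ?\<Omega> \<and> glauber U W A ?\<phi> x y > 0}"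
  have irrA: "irreducible_on ?\<Omega> (glauber U W A ?\<phi>)"
    using irr finA[OF A] is_bc_of unfolding glauber_irreducible_def by blast
  have mem: "restrict \<rho> A \<in> ?\<Omega>" if "\<rho> \<in> S" for \<rho>
    using that by (simp add: S Omega_iff[OF A] emb_restrict)
  let ?R = "{(\<tau>, \<tau>'). \<tau> \<in> S \<and> \<tau>' \<in> S \<and> (\<exists>x\<in>A. \<tau>' \<in> cyl {x} \<tau>)}"
  have path: "(restrict \<tau> A, restrict \<tau>' A) \<in> ?G\<^sup>*"
    using irrA mem[OF t(1)] mem[OF t(2)] unfolding irreducible_on_def by blast
  have edge: "(emb A \<sigma> x, emb A \<sigma> y) \<in> ?R" if xy: "(x, y) \<in> ?G" for x y
  proof -
    have "0 < (\<Sum>v\<in>A. cond_update U W A ?\<phi> {v} x y)"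
      using xy by (auto simp: glauber_def zero_less_divide_iff)
    then have "\<not> (\<forall>v\<in>A. cond_update U W A ?\<phi> {v} x y \<le> 0)"
      using sum_nonpos[of A "\<lambda>v. cond_update U W A ?\<phi> {v} x y"] by auto
    then obtain v where v: "v \<in> A" "0 < cond_update U W A ?\<phi> {v} x y" by (auto simp: not_le)
    then have "\<forall>z\<in>A - {v}. y z = x z" by (auto simp: cond_update_def split: if_splits)
    then have "emb A \<sigma> y \<in> cyl {v} (emb A \<sigma> x)" by (auto simp: emb_def cyl_iff)
    moreover have "emb A \<sigma> x \<in> S" "emb A \<sigma> y \<in> S" using xy by (auto simp: S Omega_iff[OF A])
    ultimately show ?thesis using v(1) by blast
  qed
  from path have "(emb A \<sigma> (restrict \<tau> A), emb A \<sigma> (restrict \<tau>' A)) \<in> ?R\<^sup>*"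
  proof (induction rule: rtrancl_induct)
    case (step y z)
    show ?case by (rule rtrancl.rtrancl_into_rtrancl[OF step.IH edge[OF step.hyps(2)]])
  qed simp
  then show ?thesis using t by (simp add: S emb_restrict)
qed

text \<open>Every site of \<open>Q\<close> lies in some \<open>A i\<close>, and the loss of
  \<open>avg {x}\<close> is at most that of the larger region \<open>A i \<inter> Q\<close>. Summing
  over sites costs a factor \<open>card Q\<close>, independent of the number of blocks.\<close>

lemma loc_const_bound:
  fixes n :: nat
  assumes Q: "Q \<subseteq> V" "card Q \<le> N" and c: "0 < c" "c \<le> 1"
    and U: "\<And>s t. edge_weight U s t \<noteq> 0 \<Longrightarrow> c \<le> edge_weight U s t" "\<And>s t. edge_weight U s t \<le> 1 / c"
    and W: "\<And>s. c \<le> exp (W s)" "\<And>s. exp (W s) \<le> 1 / c"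
    and A: "\<And>i. i < n \<Longrightarrow> A i \<subseteq> V" "Q \<subseteq> (\<Union>i<n. A i)"
  shows "nrm \<sigma> f - nrm \<sigma> (avg Q f) \<le>
    loc_const CARD('s) CARD('d) c N * (\<Sum>i<n. nrm \<sigma> f - nrm \<sigma> (avg (A i \<inter> Q) f))"
proof -
  let ?E = "2 * N * 3 ^ CARD('d) + N"
  let ?q = "CARD('s)"
  \<comment> \<open>A positive weight is at least \<open>c ^ ?E\<close> and the partition function
    is at most \<open>?q ^ N * (1 / c) ^ ?E\<close>; \<open>p\<close> is the quotient.\<close>
  define p where "p = c ^ (2 * ?E) / real (?q ^ N)"
  have q1: "1 \<le> ?q" by (simp add: Suc_leI)
  have p: "0 < p" using c q1 by (simp add: p_def)
  have qN: "?q ^ card Q \<le> ?q ^ N" by (rule power_increasing[OF Q(2) q1])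
  define C where "C = 4 * real (?q ^ N) ^ 4 / p"
  have C: "0 \<le> C" using p by (simp add: C_def)
  define dr where "dr B = nrm \<sigma> f - nrm \<sigma> (avg B f)" for B
  have dr0: "0 \<le> dr B" if "B \<subseteq> V" for B using nrm_avg_le[OF that] by (simp add: dr_def)
  have cancel: "c ^ (2 * e) * (1 / c) ^ e = c ^ e" for e
    using c by (simp add: mult_2 power_add power_one_over)
  have drQ: "0 \<le> dr (B \<inter> Q)" for B by (rule dr0[OF order_trans[OF Int_lower2 Q(1)]])
  have lower: "p * Z Q \<rho> \<le> w Q \<tau>" if "\<tau> \<in> cyl Q \<rho>" "0 < w Q \<tau>" for \<rho> \<tau>
  proof -
    have "Z Q \<rho> \<le> real (card (cyl Q \<rho>)) * (1 / c) ^ ?E"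
      unfolding Z_def by (rule sum_bounded_above) (rule w_bounds(1)[OF Q c U W])
    also have "\<dots> \<le> real (?q ^ N) * (1 / c) ^ ?E"
      unfolding card_cyl[OF finA[OF Q(1)]] using qN c by (intro mult_right_mono of_nat_mono) auto
    finally have "p * Z Q \<rho> \<le> p * (real (?q ^ N) * (1 / c) ^ ?E)" using p by (intro mult_left_mono) auto
    also have "\<dots> = c ^ (2 * ?E) * (1 / c) ^ ?E" using q1 by (simp add: p_def)
    also have "\<dots> = c ^ ?E" by (rule cancel)
    also have "\<dots> \<le> w Q \<tau>" by (rule w_bounds(2)[OF Q c U W that(2)])
    finally show ?thesis .
  qed
  have pw: "avg Q (\<lambda>\<tau>. (f \<tau>)\<^sup>2) \<rho> - (avg Q f \<rho>)\<^sup>2 \<le> C * (\<Sum>x\<in>Q. avg Q (\<lambda>\<tau>. (f \<tau> - avg {x} f \<tau>)\<^sup>2) \<rho>)" for \<rho>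
  proof -
    have "avg Q (\<lambda>\<tau>. (f \<tau>)\<^sup>2) \<rho> - (avg Q f \<rho>)\<^sup>2 \<le>
        4 * real (?q ^ card Q) ^ 4 / p * (\<Sum>x\<in>Q. avg Q (\<lambda>\<tau>. (f \<tau> - avg {x} f \<tau>)\<^sup>2) \<rho>)"
      by (rule local_poincare[OF Q(1) p lower refl glauber_connected[OF Q(1) refl]])
    also have "\<dots> \<le> C * (\<Sum>x\<in>Q. avg Q (\<lambda>\<tau>. (f \<tau> - avg {x} f \<tau>)\<^sup>2) \<rho>)"
    proof (rule mult_right_mono)
      have "real (?q ^ card Q) ^ 4 \<le> real (?q ^ N) ^ 4" by (rule power_mono[OF of_nat_mono[OF qN]]) simp
      then show "4 * real (?q ^ card Q) ^ 4 / p \<le> C"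
        unfolding C_def using p by (simp add: divide_right_mono)
      show "0 \<le> (\<Sum>x\<in>Q. avg Q (\<lambda>\<tau>. (f \<tau> - avg {x} f \<tau>)\<^sup>2) \<rho>)"
        by (intro sum_nonneg avg_nonneg Q(1)) simp
    qed
    finally show ?thesis .
  qed
  \<comment> \<open>The loss of \<open>avg Q\<close> is the mean of the conditional variance on
    \<open>Q\<close>, so the inequality for fixed surroundings can be averaged.\<close>
  have "dr Q = avg V (\<lambda>\<rho>. avg Q (\<lambda>\<tau>. (f \<tau>)\<^sup>2) \<rho> - (avg Q f \<rho>)\<^sup>2) \<sigma>"
    using avg_tower[OF Q(1) order_refl] by (simp add: dr_def nrm_def avg_diff)
  also have "\<dots> \<le> avg V (\<lambda>\<rho>. C * (\<Sum>x\<in>Q. avg Q (\<lambda>\<tau>. (f \<tau> - avg {x} f \<tau>)\<^sup>2) \<rho>)) \<sigma>"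
    by (rule avg_mono[OF order_refl pw])
  also have "\<dots> = C * (\<Sum>x\<in>Q. avg V (avg Q (\<lambda>\<tau>. (f \<tau> - avg {x} f \<tau>)\<^sup>2)) \<sigma>)"
    by (simp add: avg_cmult avg_sum)
  also have "\<dots> = C * (\<Sum>x\<in>Q. dr {x})"
    using Q(1) nrm_drop[of "{_}" \<sigma> f]
    by (intro arg_cong2[where f = "(*)"] sum.cong refl) (simp add: avg_tower[OF Q(1) order_refl] dr_def nrm_def subset_iff)
  also have "\<dots> \<le> C * (\<Sum>x\<in>Q. \<Sum>i<n. dr (A i \<inter> Q))"
  proof (intro mult_left_mono[OF _ C] sum_mono)
    fix x assume x: "x \<in> Q"
    then obtain i where i: "i < n" "x \<in> A i" using A(2) by auto
    have "dr {x} \<le> dr (A i \<inter> Q)"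
      unfolding dr_def using x i Q(1) by (intro diff_left_mono nrm_avg_antimono) auto
    also have "\<dots> \<le> (\<Sum>i<n. dr (A i \<inter> Q))"
      using i(1) by (intro member_le_sum[of i "{..<n}" "\<lambda>i. dr (A i \<inter> Q)"] drQ) auto
    finally show "dr {x} \<le> (\<Sum>i<n. dr (A i \<inter> Q))" .
  qed
  also have "\<dots> = C * real (card Q) * (\<Sum>i<n. dr (A i \<inter> Q))" by simp
  also have "\<dots> \<le> C * real N * (\<Sum>i<n. dr (A i \<inter> Q))"
    using C Q(2) by (intro mult_right_mono mult_left_mono sum_nonneg drQ) auto
  finally show ?thesis by (simp add: dr_def C_def p_def loc_const_def)
qed

lemma poincare_cube:
  fixes m L r :: nat
  assumes V: "V = box a0 n" "1 \<le> n" and c: "0 < c" "c \<le> 1"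
    and U: "\<And>s t. edge_weight U s t \<noteq> 0 \<Longrightarrow> c \<le> edge_weight U s t" "\<And>s t. edge_weight U s t \<le> 1 / c"
    and W: "\<And>s. c \<le> exp (W s)" "\<And>s. exp (W s) \<le> 1 / c"
    and ab: "0 < a" "0 < b"
    and ssm: "\<And>(Q :: ('d \<Rightarrow> int) set) B u \<psi> \<psi>'. is_cube Q \<Longrightarrow> B \<subseteq> Q \<Longrightarrow> u \<in> bdry Q \<Longrightarrow> is_bc Q \<psi> \<Longrightarrow> is_bc Q \<psi>' \<Longrightarrow>
      (\<forall>x. x \<noteq> u \<longrightarrow> \<psi> x = \<psi>' x) \<Longrightarrow>
      tv_marginal U W Q \<psi> \<psi>' B \<le> b * exp (- a * real_of_int (set_dist u B))"
    and L: "1 \<le> L" "16 * real CARD('d) * 6 ^ (CARD('d) - 1) *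
      (2 * (2 * real m + 1) ^ CARD('d) + 1 + real ((2 * L) ^ CARD('d)) * (2 * b * exp (- a * real m))) \<le> real L"
    and A: "\<And>i. i < r \<Longrightarrow> A i \<subseteq> V" "V \<subseteq> (\<Union>i<r. A i)"
    and mean: "avg V g \<sigma> = 0"
    and C: "C = loc_const CARD('s) CARD('d) c ((4 * L) ^ CARD('d))"
  shows "nrm \<sigma> g \<le> 2 * 6 ^ CARD('d) * C * (\<Sum>i<r. nrm \<sigma> g - nrm \<sigma> (avg (A i) g))"
proof -
  let ?d = "CARD('d)"
  define dr where "dr = (\<Sum>i<r. nrm \<sigma> g - nrm \<sigma> (avg (A i) g))"
  have d1: "1 \<le> ?d" by (simp add: Suc_leI)
  have C0: "0 \<le> C" unfolding C loc_const_def using c by simp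
  have dr0: "0 \<le> dr" unfolding dr_def using nrm_avg_le A(1) by (intro sum_nonneg) auto
  have loc: "nrm \<sigma> f - nrm \<sigma> (avg Q f) \<le> C * (\<Sum>i<r. nrm \<sigma> f - nrm \<sigma> (avg (A i \<inter> Q) f))"
    if "Q \<subseteq> V" "card Q \<le> (4 * L) ^ ?d" for Q f
    unfolding C using A(2) that by (intro loc_const_bound c U W A(1)) auto
  show ?thesis
  proof (cases "4 * int L \<le> n")
    \<comment> \<open>Such a cube is too short for the tilings and is treated as one single cube;
      this is why \<open>C\<close> allows \<open>(4 * L) ^ ?d\<close> sites while tiles have at most
      \<open>(2 * L) ^ ?d\<close>.\<close>
    case False
    have "card V \<le> (4 * L) ^ ?d"
      unfolding V(1) card_box using False by (intro power_mono) auto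
    then have "nrm \<sigma> g - nrm \<sigma> (avg V g) \<le> C * (\<Sum>i<r. nrm \<sigma> g - nrm \<sigma> (avg (A i \<inter> V) g))"
      by (rule loc[OF order_refl])
    also have "(\<Sum>i<r. nrm \<sigma> g - nrm \<sigma> (avg (A i \<inter> V) g)) = dr"
      unfolding dr_def using A(1) by (intro sum.cong refl) (simp add: Int_absorb2)
    also have "nrm \<sigma> (avg V g) = 0"
      using avg_pull_out[of V V "avg V g" g \<sigma>] mean by (simp add: nrm_def power2_eq_square)
    finally have "nrm \<sigma> g \<le> 1 * (C * dr)" by simp
    also have "\<dots> \<le> (2 * 6 ^ ?d) * (C * dr)"
    proof (rule mult_right_mono)
      have "(1 :: real) \<le> 6 ^ ?d" by simp
      then show "(1 :: real) \<le> 2 * 6 ^ ?d" by linarith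
    qed (use C0 dr0 in simp)
    finally show ?thesis by (simp add: dr_def mult.assoc)
  next
    case n: True
    \<comment> \<open>The least modulus with \<open>l + 2 \<le> M\<close> for all side lengths
      \<open>l < 2 * L\<close>.\<close>
    define M where "M = 2 * int L + 1"
    define J where "J = (tile_index (int L) M :: (int \<times> ('d \<Rightarrow> int)) set)"
    define Qs where "Qs = (\<lambda>(l, t). tile_list n M a0 l t)"
    define K where "K = 2 * (2 * real m + 1) ^ ?d + 1 + real ((2 * L) ^ ?d) * (2 * b * exp (- a * real m))"
    \<comment> \<open>At least \<open>L * L ^ ?d\<close> of the \<open>L * (2 * M) ^ ?d\<close>
      indices cover a given site, and \<open>2 * M = 4 * L + 2\<close> is at most
      \<open>6 * L\<close>.\<close>
    define p :: real where "p = 1 / 6 ^ ?d"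
    have p: "0 < p" "p \<le> 1" by (auto simp: p_def)
    have lb: "int L \<le> l \<and> l < 2 * int L" if "(l, t) \<in> J" for l t using that by (simp add: J_def tile_index_def)
    have cJ: "card J = L * nat (2 * M) ^ ?d" by (simp add: J_def card_tile_index)
    have M2: "nat (2 * M) \<le> 6 * L" "2 * L + 2 * nat M \<le> 8 * L" "0 < nat (2 * M)" using L(1) by (auto simp: M_def)
    have finJ: "finite J" by (simp add: J_def)
    have neJ: "J \<noteq> {}" using cJ M2(3) L(1) finJ by (metis card.empty mult_eq_0_iff not_one_le_zero power_eq_0_iff less_numeral_extra(3))
    have tl: "tiles (Qs j)" if j: "j \<in> J" for j
    proof -
      obtain l t where lt: "j = (l, t)" by (cases j)
      have l: "int L \<le> l" "l < 2 * int L" using lb j lt by auto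
      show ?thesis
        unfolding tiles_def Qs_def lt case_prod_conv
      proof (intro conjI ballI impI)
        show "distinct (tile_list n M a0 l t)" by (rule tile_list(1))
        show "Q \<subseteq> V" if "Q \<in> set (tile_list n M a0 l t)" for Q
          unfolding V(1) using l n by (intro tile_list_subset[OF that]) auto
        show "3 \<le> l1dist x y" if "Q \<in> set (tile_list n M a0 l t)" "Q' \<in> set (tile_list n M a0 l t)"
          "Q \<noteq> Q'" "x \<in> Q" "y \<in> Q'" for Q Q' x y
          using l n by (intro tile_list_separated[OF that(1-3) _ _ that(4,5)]) (auto simp: M_def)
      qed
    qed
    have cube: "is_cube Q \<and> card Q \<le> (2 * L) ^ ?d" if j: "j \<in> J" and Q: "Q \<in> set (Qs j)" for j Q
    proof -
      obtain l t where lt: "j = (l, t)" by (cases j)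
      have l: "int L \<le> l" "l < 2 * int L" using lb j lt by auto
      obtain s where "Q = box s l" using Q by (auto simp: Qs_def lt tile_list(2))
      moreover have "nat l ^ ?d \<le> (2 * L) ^ ?d" using l by (intro power_mono) auto
      ultimately show ?thesis using l L(1) by (simp add: is_cube_box card_box del: power_mult_distrib)
    qed
    have contr: "gb \<sigma> V (mix_scan J Qs f) ((1 - p / 2) * l)" if l: "0 < l" and gb: "gb \<sigma> V f l" for f l
    proof (rule gb_mix_scan[OF finJ neJ tl _ K_def _ _ _ l gb])
      show "mixing m (2 * b * exp (- a * real m)) Q \<and> card Q \<le> (2 * L) ^ ?d"
        if j: "j \<in> J" and Q: "Q \<in> set (Qs j)" for j Q
      proof
        have Qc: "is_cube Q" using cube[OF that] by simp
        show "mixing m (2 * b * exp (- a * real m)) Q"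
          by (rule mixing_cube[OF tiles_sub[OF tl[OF j] Q] Qc ab ssm[OF Qc]])
      qed (use cube[OF that] in simp)
      show "0 \<le> 2 * b * exp (- a * real m)" using ab by simp
      fix u assume u: "u \<in> V"
      let ?I = "{j \<in> J. \<exists>Q\<in>set (Qs j). u \<in> Q}"
      let ?B = "{j \<in> J. \<exists>Q\<in>set (Qs j). u \<in> bdry Q}"
      have "nat (int L) * nat (int L) ^ ?d \<le> card {(l, t) \<in> tile_index (int L) M. \<exists>Q\<in>set (tile_list n M a0 l t). u \<in> Q}"
        using u L(1) n by (intro card_tile_cover) (auto simp: V(1) M_def)
      also have "{(l, t) \<in> tile_index (int L) M. \<exists>Q\<in>set (tile_list n M a0 l t). u \<in> Q} = ?I"
        by (auto simp: J_def Qs_def)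
      finally have I: "real (L * L ^ ?d) \<le> real (card ?I)" by (intro of_nat_mono) simp
      have "real (card J) \<le> real L * real (6 * L) ^ ?d"
        unfolding cJ of_nat_mult of_nat_power using M2(1) by (intro mult_left_mono power_mono) auto
      then have "p * real (card J) \<le> real (L * L ^ ?d)"
        by (simp add: p_def power_mult_distrib field_simps)
      then show "p * real (card J) \<le> real (card ?I)" using I by linarith
      have "card {(l, t) \<in> tile_index (int L) M. \<exists>Q\<in>set (tile_list n M a0 l t). u \<in> bdry Q} \<le>
          ?d * ((2 * nat (int L) + 2 * nat M) * nat (2 * M) ^ (?d - 1))"
        using u L(1) n by (intro card_tile_bdry) (auto simp: V(1) M_def)
      also have "{(l, t) \<in> tile_index (int L) M. \<exists>Q\<in>set (tile_list n M a0 l t). u \<in> bdry Q} = ?B"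
        by (auto simp: J_def Qs_def)
      also have "?d * ((2 * nat (int L) + 2 * nat M) * nat (2 * M) ^ (?d - 1)) \<le> ?d * ((8 * L) * (6 * L) ^ (?d - 1))"
        using M2 by (intro mult_left_mono mult_mono power_mono) auto
      finally have "real (card ?B) \<le> real (?d * ((8 * L) * (6 * L) ^ (?d - 1)))" by (rule of_nat_mono)
      moreover have "0 \<le> K" using ab by (simp add: K_def)
      ultimately have "2 * K * real (card ?B) \<le> 2 * K * real (?d * ((8 * L) * (6 * L) ^ (?d - 1)))"
        by (intro mult_left_mono) auto
      also have "\<dots> = (16 * real ?d * 6 ^ (?d - 1) * K) * (real L * real L ^ (?d - 1))"
        by (simp add: power_mult_distrib)
      also have "real L * real L ^ (?d - 1) = real L ^ ?d"
        using d1 power_minus_mult[of ?d "real L"] by (simp only: mult.commute)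
      also have "(16 * real ?d * 6 ^ (?d - 1) * K) * real L ^ ?d \<le> real L * real L ^ ?d"
        using L(2) unfolding K_def[symmetric] by (intro mult_right_mono) auto
      also have "\<dots> \<le> real (card ?I)" using I by simp
      finally show "2 * K * real (card ?B) \<le> real (card ?I)" .
    qed
    have "nrm \<sigma> g \<le> 2 / p * C * dr"
      unfolding dr_def
    proof (rule poincare_tiles[OF finJ neJ tl contr p(1) _ mean A(1) C0 loc])
      show "p < 2" using p by simp
      fix j Q assume jQ: "j \<in> J" "Q \<in> set (Qs j)"
      show "Q \<subseteq> V" by (rule tiles_sub[OF tl[OF jQ(1)] jQ(2)])
      have "card Q \<le> (2 * L) ^ ?d" using cube[OF jQ] by simp
      also have "\<dots> \<le> (4 * L) ^ ?d" by (intro power_mono) auto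
      finally show "card Q \<le> (4 * L) ^ ?d" .
    qed auto
    then show ?thesis by (simp add: p_def dr_def)
  qed
qed

section \<open>The block dynamics in terms of conditional averages\<close>

lemma sum_gibbs_agreeing:
  assumes A: "A \<subseteq> V" and x: "x \<in> Omega U W V (bc_of V \<sigma>)"
  obtains \<kappa> where "0 < \<kappa>" "\<And>G. (\<Sum>\<eta>\<in>{\<eta> \<in> Omega U W V (bc_of V \<sigma>). \<forall>z\<in>V - A. \<eta> z = x z}.
      gibbs U W V (bc_of V \<sigma>) \<eta> * G \<eta>) = \<kappa> * (\<Sum>\<tau>\<in>cyl A (emb V \<sigma> x). w A \<tau> * G (restrict \<tau> V))"
proof -
  let ?e = "emb V \<sigma> x" and ?\<Omega> = "Omega U W V (bc_of V \<sigma>)"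
  obtain r where r: "\<And>\<tau>. 0 \<le> r \<tau>" "\<And>\<tau>. w V \<tau> = w A \<tau> * r \<tau>" "\<And>\<tau> \<tau>'. \<tau>' \<in> cyl A \<tau> \<Longrightarrow> r \<tau>' = r \<tau>"
    using w_split[OF A order_refl] by metis
  have "0 < w V ?e" using x by (simp add: Omega_iff)
  then have re: "0 < r ?e" using r(1)[of ?e] by (cases "r ?e = 0") (auto simp: r(2))
  have cyl: "cyl A ?e = {\<tau> \<in> cyl V \<sigma>. \<forall>z\<in>V - A. \<tau> z = x z}"
    using A by (auto simp: cyl_def emb_def)
  show ?thesis
  \<comment> \<open>\<open>r ?e\<close> is the weight of the part frozen outside \<open>A\<close>,
    positive because \<open>x\<close> is valid; being common to all agreeing configurations, it
    cancels in conditional probabilities.\<close>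
  proof (rule that[of "r ?e / Z V \<sigma>"])
    show "0 < r ?e / Z V \<sigma>" using re Z_pos[of V \<sigma>] by simp
    fix G :: "(('d \<Rightarrow> int) \<Rightarrow> 's) \<Rightarrow> real"
    let ?F = "\<lambda>\<eta>. if \<forall>z\<in>V - A. \<eta> z = x z then G \<eta> else 0"
    have "(\<Sum>\<eta>\<in>{\<eta> \<in> ?\<Omega>. \<forall>z\<in>V - A. \<eta> z = x z}. gibbs U W V (bc_of V \<sigma>) \<eta> * G \<eta>) =
        (\<Sum>\<eta>\<in>?\<Omega>. gibbs U W V (bc_of V \<sigma>) \<eta> * ?F \<eta>)"
      using finite_Omega[of V] by (intro sum.mono_neutral_cong_left) auto
    also have "\<dots> = avg V (\<lambda>\<tau>. ?F (restrict \<tau> V)) \<sigma>" by (rule sum_gibbs) simp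
    also have "\<dots> = (\<Sum>\<tau>\<in>cyl V \<sigma>. w V \<tau> * ?F (restrict \<tau> V)) / Z V \<sigma>" by (simp add: avg_def)
    also have "(\<Sum>\<tau>\<in>cyl V \<sigma>. w V \<tau> * ?F (restrict \<tau> V)) = (\<Sum>\<tau>\<in>cyl A ?e. w V \<tau> * G (restrict \<tau> V))"
      unfolding cyl using finV by (intro sum.mono_neutral_cong_right) auto
    also have "\<dots> = (\<Sum>\<tau>\<in>cyl A ?e. r ?e * (w A \<tau> * G (restrict \<tau> V)))"
      using r(2,3) by (intro sum.cong refl) (metis mult.assoc mult.commute)
    finally show "(\<Sum>\<eta>\<in>{\<eta> \<in> ?\<Omega>. \<forall>z\<in>V - A. \<eta> z = x z}. gibbs U W V (bc_of V \<sigma>) \<eta> * G \<eta>) =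
        r ?e / Z V \<sigma> * (\<Sum>\<tau>\<in>cyl A ?e. w A \<tau> * G (restrict \<tau> V))"
      by (simp add: sum_distrib_left[symmetric])
  qed
qed

text \<open>Bridge between the two descriptions: conditioning extensional configurations on
  \<open>V - A\<close> amounts to applying \<open>avg A\<close> at the extension by
  \<open>emb\<close>, which supplies the boundary spins.\<close>

lemma sum_cond_update:
  assumes A: "A \<subseteq> V" and x: "x \<in> Omega U W V (bc_of V \<sigma>)"
  shows "(\<Sum>y\<in>Omega U W V (bc_of V \<sigma>). cond_update U W V (bc_of V \<sigma>) A x y * f y) =
    avg A (\<lambda>\<tau>. f (restrict \<tau> V)) (emb V \<sigma> x)"
proof -
  let ?\<Omega> = "Omega U W V (bc_of V \<sigma>)" and ?g = "gibbs U W V (bc_of V \<sigma>)"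
  let ?X = "{\<eta> \<in> ?\<Omega>. \<forall>z\<in>V - A. \<eta> z = x z}"
  obtain \<kappa> where \<kappa>: "0 < \<kappa>" "\<And>G. (\<Sum>\<eta>\<in>?X. ?g \<eta> * G \<eta>) = \<kappa> * (\<Sum>\<tau>\<in>cyl A (emb V \<sigma> x). w A \<tau> * G (restrict \<tau> V))"
    by (rule sum_gibbs_agreeing[OF A x]) blast
  have den: "(\<Sum>\<eta>\<in>?X. ?g \<eta>) = \<kappa> * Z A (emb V \<sigma> x)" using \<kappa>(2)[of "\<lambda>_. 1"] by (simp add: Z_def)
  have "(\<Sum>y\<in>?\<Omega>. cond_update U W V (bc_of V \<sigma>) A x y * f y) = (\<Sum>y\<in>?X. ?g y * f y / (\<Sum>\<eta>\<in>?X. ?g \<eta>))"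
    using finite_Omega[of V] by (intro sum.mono_neutral_cong_right) (auto simp: cond_update_def)
  also have "\<dots> = (\<Sum>y\<in>?X. ?g y * f y) / (\<Sum>\<eta>\<in>?X. ?g \<eta>)" by (simp add: sum_divide_distrib)
  also have "\<dots> = avg A (\<lambda>\<tau>. f (restrict \<tau> V)) (emb V \<sigma> x)"
    unfolding \<kappa>(2) den avg_def using \<kappa>(1) by simp
  finally show ?thesis .
qed

lemma cond_update_reversible:
  assumes "x \<in> Omega U W V \<phi>" "y \<in> Omega U W V \<phi>"
  shows "gibbs U W V \<phi> x * cond_update U W V \<phi> A x y = gibbs U W V \<phi> y * cond_update U W V \<phi> A y x"
proof (cases "\<forall>z\<in>V - A. y z = x z")
  case True
  then have "{\<eta> \<in> Omega U W V \<phi>. \<forall>z\<in>V - A. \<eta> z = x z} = {\<eta> \<in> Omega U W V \<phi>. \<forall>z\<in>V - A. \<eta> z = y z}"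
    by auto
  then show ?thesis using True assms by (simp add: cond_update_def)
next
  case False
  then have "cond_update U W V \<phi> A x y = 0" "cond_update U W V \<phi> A y x = 0"
    unfolding cond_update_def by (intro if_not_P, metis)+
  then show ?thesis by simp
qed

text \<open>The quadratic form of the dynamics is the mean of the squared norms of the projections
  \<open>avg (As ! i)\<close>. It is nonnegative, which settles the smallest eigenvalue, and its
  deficit is exactly the energy in \<open>poincare\<close> divided by the number of blocks.\<close>

lemma block_dyn_gap:
  assumes As: "\<And>A. A \<in> set As \<Longrightarrow> A \<subseteq> V" "As \<noteq> []"
    and C: "1 \<le> C"
    and poincare: "\<And>g. avg V g \<sigma> = 0 \<Longrightarrow> nrm \<sigma> g \<le> C * (\<Sum>i<length As. nrm \<sigma> g - nrm \<sigma> (avg (As ! i) g))"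
  shows "1 / C / real (length As) \<le>
    spectral_gap (kernel_mat (Omega U W V (bc_of V \<sigma>)) (block_dyn U W V (bc_of V \<sigma>) As))"
proof -
  let ?\<phi> = "bc_of V \<sigma>" and ?r = "real (length As)"
  let ?\<Omega> = "Omega U W V ?\<phi>" and ?g = "gibbs U W V ?\<phi>" and ?K = "block_dyn U W V ?\<phi> As"
  have r: "1 \<le> ?r" using As(2) by (simp add: Suc_le_eq)
  then have r0: "0 < ?r" by linarith
  have AV: "As ! i \<subseteq> V" if "i < length As" for i using As(1) that by simp
  have act: "(\<Sum>y\<in>?\<Omega>. ?K x y * f y) = (\<Sum>i<length As. avg (As ! i) (\<lambda>\<tau>. f (restrict \<tau> V)) (emb V \<sigma> x)) / ?r"
    if x: "x \<in> ?\<Omega>" for x f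
  proof -
    have "(\<Sum>y\<in>?\<Omega>. ?K x y * f y) = (\<Sum>y\<in>?\<Omega>. \<Sum>i<length As. cond_update U W V ?\<phi> (As ! i) x y * f y) / ?r"
      by (simp add: block_dyn_def sum_distrib_right sum_divide_distrib)
    also have "\<dots> = (\<Sum>i<length As. \<Sum>y\<in>?\<Omega>. cond_update U W V ?\<phi> (As ! i) x y * f y) / ?r"
      by (subst sum.swap) simp
    finally show ?thesis using sum_cond_update[OF AV x] by simp
  qed
  have quad: "(\<Sum>x\<in>?\<Omega>. ?g x * f x * (\<Sum>y\<in>?\<Omega>. ?K x y * f y)) =
      (\<Sum>i<length As. nrm \<sigma> (avg (As ! i) (\<lambda>\<tau>. f (restrict \<tau> V)))) / ?r" for f
  proof -
    let ?f = "\<lambda>\<tau>. f (restrict \<tau> V)"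
    let ?T = "\<lambda>\<tau>. \<Sum>i<length As. avg (As ! i) ?f \<tau>"
    have "(\<Sum>x\<in>?\<Omega>. ?g x * f x * (\<Sum>y\<in>?\<Omega>. ?K x y * f y)) = (\<Sum>x\<in>?\<Omega>. ?g x * (f x * (?T (emb V \<sigma> x) / ?r)))"
      by (intro sum.cong refl) (simp add: act)
    also have "\<dots> = avg V (\<lambda>\<tau>. ?f \<tau> * (?T (emb V \<sigma> (restrict \<tau> V)) / ?r)) \<sigma>"
      by (rule sum_gibbs) simp
    also have "\<dots> = avg V (\<lambda>\<tau>. inverse ?r * (\<Sum>i<length As. ?f \<tau> * avg (As ! i) ?f \<tau>)) \<sigma>"
      by (intro avg_cong) (simp add: emb_restrict sum_distrib_left[symmetric] field_simps)
    also have "\<dots> = inverse ?r * (\<Sum>i<length As. avg V (\<lambda>\<tau>. ?f \<tau> * avg (As ! i) ?f \<tau>) \<sigma>)"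
      by (simp only: avg_cmult avg_sum)
    also have "(\<Sum>i<length As. avg V (\<lambda>\<tau>. ?f \<tau> * avg (As ! i) ?f \<tau>) \<sigma>) = (\<Sum>i<length As. nrm \<sigma> (avg (As ! i) ?f))"
    proof (intro sum.cong refl)
      fix i assume "i \<in> {..<length As}"
      then show "avg V (\<lambda>\<tau>. ?f \<tau> * avg (As ! i) ?f \<tau>) \<sigma> = nrm \<sigma> (avg (As ! i) ?f)"
        using avg_selfadjoint[OF AV order_refl, of i ?f ?f] by (simp add: nrm_def power2_eq_square)
    qed
    finally show ?thesis by (simp add: field_simps)
  qed
  show ?thesis
  proof (rule spectral_gap_ge[where m = ?g])
    show "finite ?\<Omega>" by (rule finite_Omega) simp
    show "?\<Omega> \<noteq> {}" using perm fin is_bc_of unfolding permissive_def by blast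
    show "0 \<le> 1 / C / ?r" using C r by simp
    show "1 / C / ?r \<le> 1"
    proof -
      have "1 * 1 \<le> C * ?r" using C r by (intro mult_mono) auto
      then show ?thesis by (simp add: divide_le_eq_1)
    qed
    show "0 < ?g x" if "x \<in> ?\<Omega>" for x
    proof -
      have "0 < (\<Sum>\<eta>\<in>?\<Omega>. gweight U W V ?\<phi> \<eta>)"
        using that finite_Omega[of V] by (intro sum_pos2[of _ x]) (auto simp: Omega_def less_imp_le)
      moreover have "0 < gweight U W V ?\<phi> x" using that by (simp add: Omega_def)
      ultimately show ?thesis using that by (simp add: gibbs_def)
    qed
    show "(\<Sum>y\<in>?\<Omega>. ?K x y) = 1" if "x \<in> ?\<Omega>" for x
      using act[OF that, of "\<lambda>_. 1"] AV As(2) by (simp add: avg_const)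
    show "?g x * ?K x y = ?g y * ?K y x" if "x \<in> ?\<Omega>" "y \<in> ?\<Omega>" for x y
      unfolding block_dyn_def times_divide_eq_right sum_distrib_left
      by (simp only: cond_update_reversible[OF that])
    show "0 \<le> (\<Sum>x\<in>?\<Omega>. ?g x * f x * (\<Sum>y\<in>?\<Omega>. ?K x y * f y))" for f
      unfolding quad using nrm_nonneg by (intro divide_nonneg_nonneg sum_nonneg) auto
    fix f assume mean: "(\<Sum>x\<in>?\<Omega>. ?g x * f x) = 0"
    let ?f = "\<lambda>\<tau>. f (restrict \<tau> V)"
    have N: "(\<Sum>x\<in>?\<Omega>. ?g x * (f x)\<^sup>2) = nrm \<sigma> ?f" unfolding nrm_def by (rule sum_gibbs) simp
    have "avg V ?f \<sigma> = 0" using mean sum_gibbs[of V \<sigma> f] by simp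
    then have "nrm \<sigma> ?f \<le> C * (?r * nrm \<sigma> ?f - (\<Sum>i<length As. nrm \<sigma> (avg (As ! i) ?f)))"
      using poincare[of ?f] by (simp add: sum_subtractf)
    then have *: "nrm \<sigma> ?f / C \<le> ?r * nrm \<sigma> ?f - (\<Sum>i<length As. nrm \<sigma> (avg (As ! i) ?f))"
      using C by (simp add: field_simps)
    have "(1 - 1 / C / ?r) * nrm \<sigma> ?f * ?r = ?r * nrm \<sigma> ?f - nrm \<sigma> ?f / C"
      using As(2) C by (simp add: field_simps)
    then have "(\<Sum>i<length As. nrm \<sigma> (avg (As ! i) ?f)) \<le> (1 - 1 / C / ?r) * nrm \<sigma> ?f * ?r"
      using * by linarith
    then show "(\<Sum>x\<in>?\<Omega>. ?g x * f x * (\<Sum>y\<in>?\<Omega>. ?K x y * f y)) \<le> (1 - 1 / C / ?r) * (\<Sum>x\<in>?\<Omega>. ?g x * (f x)\<^sup>2)"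
      unfolding quad N pos_divide_le_eq[OF r0] .
  qed
qed

end

theorem theorem2:
  fixes U :: "'s::finite \<Rightarrow> 's \<Rightarrow> ereal" and W :: "'s \<Rightarrow> real"
  assumes U_sym: "\<And>s t. U s t = U t s"
    and U_fin: "\<And>s t. U s t \<noteq> \<infinity>"
    and perm: "permissive U W TYPE('d::finite)"
    and irr: "glauber_irreducible U W TYPE('d)"
    and ssm: "SSM U W TYPE('d)"
  shows "\<exists>c>0. \<forall>(V::('d \<Rightarrow> int) set) \<psi> As.
           is_cube V \<longrightarrow> is_bc V \<psi> \<longrightarrow> (\<forall>A\<in>set As. A \<subseteq> V) \<longrightarrow> \<Union>(set As) = V \<longrightarrow>
           spectral_gap (kernel_mat (Omega U W V \<psi>) (block_dyn U W V \<psi> As))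
             \<ge> c / real (length As)"
proof -
  obtain a b where ab: "0 < a" "0 < b" and
    mix: "\<And>(Q :: ('d \<Rightarrow> int) set) B u \<psi> \<psi>'. is_cube Q \<Longrightarrow> B \<subseteq> Q \<Longrightarrow> u \<in> bdry Q \<Longrightarrow> is_bc Q \<psi> \<Longrightarrow>
      is_bc Q \<psi>' \<Longrightarrow> (\<forall>x. x \<noteq> u \<longrightarrow> \<psi> x = \<psi>' x) \<Longrightarrow>
      tv_marginal U W Q \<psi> \<psi>' B \<le> b * exp (- a * real_of_int (set_dist u B))"
    using ssm unfolding SSM_def by blast
  obtain w where w: "0 < w" "w \<le> 1"
    "\<And>s t. edge_weight U s t \<noteq> 0 \<Longrightarrow> w \<le> edge_weight U s t" "\<And>s t. edge_weight U s t \<le> 1 / w"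
    "\<And>s. w \<le> exp (W s)" "\<And>s. exp (W s) \<le> 1 / w"
    by (rule ex_weight_const[of U W]) blast
  have "1 \<le> CARD('d)" by (simp add: Suc_leI)
  from ex_scale[OF ab this] obtain m L :: nat where L: "1 \<le> L"
    "16 * real CARD('d) * 6 ^ (CARD('d) - 1) *
      (2 * (2 * real m + 1) ^ CARD('d) + 1 + real ((2 * L) ^ CARD('d)) * (2 * b * exp (- a * real m))) \<le> real L"
    by blast
  define C where "C = loc_const CARD('s) CARD('d) w ((4 * L) ^ CARD('d))"
  \<comment> \<open>The maximum with 1 provides the hypothesis \<open>1 \<le> C\<close> of
    \<open>block_dyn_gap\<close>, which keeps the claimed gap at most 1. \<open>C'\<close> is fixed
    before \<open>V\<close>, \<psi> and the blocks are chosen.\<close>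
  define C' where "C' = max 1 (2 * 6 ^ CARD('d) * C)"
  have "1 / C' / real (length As) \<le> spectral_gap (kernel_mat (Omega U W V \<psi>) (block_dyn U W V \<psi> As))"
    if V: "is_cube V" and \<psi>: "is_bc V \<psi>" and As: "\<forall>A\<in>set As. A \<subseteq> V" "\<Union>(set As) = V"
    for V :: "('d \<Rightarrow> int) set" and \<psi> As
  proof -
    obtain a0 n where n: "1 \<le> n" "V = box a0 n"
      using V by (auto simp: is_cube_def box_def)
    interpret gibbs_field U W "V \<union> dom \<psi>" V
      by unfold_locales (use U_sym U_fin perm irr n in auto)
    \<comment> \<open>Where \<psi> is undefined this value is arbitrary: inside \<open>V\<close> it
      is overwritten in \<open>cyl V\<close>, and elsewhere the site is not in
      \<open>V \<union> dom \<psi>\<close> and does not interact.\<close>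
    define \<sigma> where "\<sigma> = (\<lambda>x. the (\<psi> x))"
    have bc: "bc_of V \<sigma> = \<psi>"
    proof
      fix x show "bc_of V \<sigma> x = \<psi> x"
        using \<psi> by (cases "\<psi> x") (auto simp: bc_of_def \<sigma>_def is_bc_def bdry_def)
    qed
    have "a0 \<in> V" using n by (simp add: box_def)
    then have ne: "As \<noteq> []" using As(2) by auto
    have cover: "V \<subseteq> (\<Union>i<length As. As ! i)" using As(2) by (auto simp: set_conv_nth)
    have "1 / C' / real (length As) \<le> spectral_gap (kernel_mat (Omega U W V (bc_of V \<sigma>)) (block_dyn U W V (bc_of V \<sigma>) As))"
    proof (rule block_dyn_gap[OF _ ne])
      show "A \<subseteq> V" if "A \<in> set As" for A using As(1) that by blast
      show "1 \<le> C'" by (simp add: C'_def)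
      fix g assume mean: "avg V g \<sigma> = 0"
      let ?S = "\<Sum>i<length As. nrm \<sigma> g - nrm \<sigma> (avg (As ! i) g)"
      have "0 \<le> ?S" using As(1) by (intro sum_nonneg) (simp add: nrm_avg_le)
      have "nrm \<sigma> g \<le> 2 * 6 ^ CARD('d) * C * ?S"
        by (rule poincare_cube[OF n(2,1) w ab mix L _ cover mean C_def]) (use As(1) in auto)
      also have "\<dots> \<le> C' * ?S"
        using \<open>0 \<le> ?S\<close> by (intro mult_right_mono) (auto simp: C'_def)
      finally show "nrm \<sigma> g \<le> C' * ?S" .
    qed
    then show ?thesis by (simp only: bc)
  qed
  moreover have "0 < 1 / C'" by (simp add: C'_def)
  ultimately show ?thesis by blast
qed

end
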